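(* Let $\mathfrak g=\mathfrak{sp}(n,\mathbb C)$ for some $n\ge 2$. Let $k\ge l\ge 0$ be integers and $\mu\in\mathbb Z^n$. If $r(\mu):=(k+l-\|\mu\|_1)/2$ is not a non-negative integer, then $m_{\pi_{k\varepsilon_1+l\varepsilon_2}}(\mu)=0$, and otherwise $$\begin{aligned} m_{\pi_{k\varepsilon_1+l\varepsilon_2}}(\mu)=&\ C_n(l,r(\mu),\ell_0(\mu),\dots,\ell_{l-1}(\mu))-C_n(l-1,r(\mu),\ell_0(\mu),\dots,\ell_{l-1}(\mu))\\ &-C_n(l-1,r(\mu)-1,\ell_0(\mu),\dots,\ell_{l-1}(\mu))+C_n(l-2,r(\mu)-1,\ell_0(\mu),\dots,\ell_{l-1}(\mu)), \end{aligned}$$ where, for given arguments $l,r,\ell_0,\ell_1,\dots$ (only $\ell_0,\dots,\ell_{l-1}$ enter the expression), $$\begin{aligned} C_n(l,r,\ell_0,\dots,\ell_{l-1})=&\sum_{\substack{0\le N\le l\\ N\equiv l\ (\mathrm{mod}\ 2)}}\ \sum_{\mathbf q\in\mathcal Q_n(N)}\ \sum_{\beta\in\mathcal B^{\mathbf q}}\ \sum_{\alpha\in\mathcal A^{\mathbf q}_\beta}\binom{(l-N)/2+n-1}{n-1}\\ &\binom{r-(l+N)/2+\sum_{j=1}^N\sum_{i=1}^j(j+1-i)\alpha_i^j+n-1}{n-1}\\ &\prod_{j=1}^N\Bigg(2^{s_j^{\mathbf q}-\sum_{i=1}^j\beta_i^j}\binom{\beta_1^j}{\alpha_1^j}\binom{n-\sum_{t=0}^{j-1}\ell_t-\sum_{r'=j+1}^N\sum_{s=1}^{r'-j+1}\beta_s^{r'}}{\beta_1^j}\\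 &\qquad\binom{\ell_0-\sum_{h=j+1}^N\big(s_h^{\mathbf q}-\sum_{s=1}^h\beta_s^h\big)}{s_j^{\mathbf q}-\sum_{t=1}^j\beta_t^j}\prod_{i=2}^j\binom{\ell_{j-i+1}-\sum_{t=1}^{N-j}\beta_{i+t}^{j+t}}{\beta_i^j}\binom{\beta_i^j}{\alpha_i^j}\Bigg). \end{aligned}$$
   Context: $\mathfrak{sp}(n,\mathbb C)$ is the symplectic Lie algebra of rank $n$ (type $\mathrm C_n$). Fix a Cartan subalgebra $\mathfrak h$ of $\mathfrak g$ and let $\{\varepsilon_1,\dots,\varepsilon_n\}$ be the standard basis of $\mathfrak h^*$, for which the positive roots are $\{\varepsilon_i\pm\varepsilon_j:i<j\}\cup\{2\varepsilon_i\}$. $\pi_\lambda$ is the irreducible representation of $\mathfrak g$ with highest weight $\lambda$, and $m_\pi(\mu)$ is the multiplicity of the weight $\mu$ in $\pi$ (the dimension of the $\mu$-weight space, $0$ if $\mu$ is not a weight). $\mathbb Z^n$ denotes the set of $\mu=\sum_{i=1}^n a_i\varepsilon_i$ with all $a_i\in\mathbb Z$. For such $\mu$, $\|\mu\|_1=\sum_{i=1}^n|a_i|$ and $\ell_t(\mu)=\#\{i:1\le i\le n,\ |a_i|=t\}$ for integers $t\ge0$. For $N\ge 0$, $$\mathcal Q_n(N)=\{\mathbf q=(q_1,\dots,q_n)\in\mathbb Z^n: q_1\ge q_2\ge\dots\ge q_n\ge 0,\ \textstyle\sum_{i=1}^n q_i=N\}.$$ For $\mathbf q\in\mathcal Q_n(N)$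 and $1\le j\le N$, $s_j^{\mathbf q}=\#\{i:1\le i\le n,\ q_i=j\}$. $\mathcal B^{\mathbf q}$ is the set of tuples of integers $\beta=(\beta_t^j)_{1\le t\le j\le N}$ (upper index $j$, lower index $t$) with $\beta_t^j\ge 0$ and $\sum_{t=1}^j\beta_t^j\le s_j^{\mathbf q}$ for every $1\le j\le N$. For $\beta\in\mathcal B^{\mathbf q}$, $\mathcal A^{\mathbf q}_\beta$ is the set of tuples of integers $\alpha=(\alpha_t^j)_{1\le t\le j\le N}$ with $0\le\alpha_t^j\le\beta_t^j$. (For $N=0$ both sets consist of the empty tuple.) Conventions: $\binom ba=0$ if $a<0$ or $b<a$; empty sums are $0$ and empty products are $1$ (so $C_n$ with negative first argument is $0$). *)

theory Defs
  imports Complex_Main "HOL-Library.FuncSet" "Jordan_Normal_Form.Matrix"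
begin

definition symp_form :: "nat \<Rightarrow> complex mat" where
  "symp_form n = four_block_mat (0\<^sub>m n n) (1\<^sub>m n) (- 1\<^sub>m n) (0\<^sub>m n n)"

definition sp :: "nat \<Rightarrow> complex mat set" where
  "sp n = {X \<in> carrier_mat (2 * n) (2 * n).
     transpose_mat X * symp_form n + symp_form n * X = 0\<^sub>m (2 * n) (2 * n)}"

definition bracket :: "complex mat \<Rightarrow> complex mat \<Rightarrow> complex mat" where
  "bracket X Y = X * Y - Y * X"

text \<open>The fixed Cartan subalgebra is the diagonal one; its elements have the form
  $\mathrm{diag}(h_1,\dots,h_n,-h_1,\dots,-h_n)$, and \<open>eps i\<close> reads off $h_i$ for $1 \le i \le n$.
  Linear functionals on it are represented by functions on all matrices, of which only the
  values on \<open>cartan n\<close> matter.\<close>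

definition cartan :: "nat \<Rightarrow> complex mat set" where
  "cartan n = {H \<in> sp n. diagonal_mat H}"

definition eps :: "nat \<Rightarrow> complex mat \<Rightarrow> complex" where
  "eps i H = H $$ (i - 1, i - 1)"

definition root_space :: "nat \<Rightarrow> (complex mat \<Rightarrow> complex) \<Rightarrow> complex mat set" where
  "root_space n \<alpha> = {X \<in> sp n. \<forall>H\<in>cartan n. bracket H X = \<alpha> H \<cdot>\<^sub>m X}"

definition positive_roots :: "nat \<Rightarrow> (complex mat \<Rightarrow> complex) set" where
  "positive_roots n =
     {\<lambda>H. eps i H + eps j H | i j. 1 \<le> i \<and> i < j \<and> j \<le> n} \<union>
     {\<lambda>H. eps i H - eps j H | i j. 1 \<le> i \<and> i < j \<and> j \<le> n} \<union>
     {\<lambda>H. 2 * eps i H | i. 1 \<le> i \<and> i \<le> n}"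

locale sp_rep = vector_space scale
  for scale :: "complex \<Rightarrow> 'v::ab_group_add \<Rightarrow> 'v" +
  fixes n :: nat and \<pi> :: "complex mat \<Rightarrow> 'v \<Rightarrow> 'v"
  assumes finite_dim: "\<exists>B. finite B \<and> span B = UNIV"
    and rep_linear: "X \<in> sp n \<Longrightarrow> Vector_Spaces.linear scale scale (\<pi> X)"
    and rep_add: "X \<in> sp n \<Longrightarrow> Y \<in> sp n \<Longrightarrow> \<pi> (X + Y) v = \<pi> X v + \<pi> Y v"
    and rep_smult: "X \<in> sp n \<Longrightarrow> \<pi> (c \<cdot>\<^sub>m X) v = scale c (\<pi> X v)"
    and rep_bracket:
      "X \<in> sp n \<Longrightarrow> Y \<in> sp n \<Longrightarrow> \<pi> (bracket X Y) v = \<pi> X (\<pi> Y v) - \<pi> Y (\<pi> X v)"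
begin

definition weight_space :: "(complex mat \<Rightarrow> complex) \<Rightarrow> 'v set" where
  "weight_space \<mu> = {v. \<forall>H\<in>cartan n. \<pi> H v = scale (\<mu> H) v}"

definition multiplicity :: "(complex mat \<Rightarrow> complex) \<Rightarrow> nat" where
  "multiplicity \<mu> = dim (weight_space \<mu>)"

definition has_highest_weight :: "(complex mat \<Rightarrow> complex) \<Rightarrow> bool" where
  "has_highest_weight \<mu> \<longleftrightarrow> (\<exists>v \<in> weight_space \<mu>. v \<noteq> 0 \<and>
     (\<forall>\<alpha>\<in>positive_roots n. \<forall>X\<in>root_space n \<alpha>. \<pi> X v = 0))"

end

locale irreducible_sp_rep = sp_rep scale n \<pi>
  for scale :: "complex \<Rightarrow> 'v::ab_group_add \<Rightarrow> 'v" and n \<pi> +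
  assumes nontrivial: "(UNIV :: 'v set) \<noteq> {0}"
    and irreducible:
      "subspace W \<Longrightarrow> (\<And>X w. X \<in> sp n \<Longrightarrow> w \<in> W \<Longrightarrow> \<pi> X w \<in> W) \<Longrightarrow> W = {0} \<or> W = UNIV"

text \<open>The weight $\sum_{i=1}^n a_i\varepsilon_i$ is represented by its coordinate function \<open>a\<close>,
  of which only the values on \<open>{1..n}\<close> matter.\<close>

definition weight_of :: "nat \<Rightarrow> (nat \<Rightarrow> int) \<Rightarrow> complex mat \<Rightarrow> complex" where
  "weight_of n a H = (\<Sum>i=1..n. of_int (a i) * eps i H)"

definition norm1 :: "nat \<Rightarrow> (nat \<Rightarrow> int) \<Rightarrow> int" where
  "norm1 n a = (\<Sum>i=1..n. \<bar>a i\<bar>)"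

definition ell :: "nat \<Rightarrow> (nat \<Rightarrow> int) \<Rightarrow> nat \<Rightarrow> int" where
  "ell n a t = int (card {i \<in> {1..n}. \<bar>a i\<bar> = int t})"

definition binom :: "int \<Rightarrow> int \<Rightarrow> int" where
  "binom b a = (if a < 0 \<or> b < a then 0 else int (nat b choose nat a))"

text \<open>Tuples are extensional functions; in \<open>\<beta> j t\<close> the first argument is the upper index.\<close>

definition QQ :: "nat \<Rightarrow> nat \<Rightarrow> (nat \<Rightarrow> int) set" where
  "QQ n N = {q \<in> {1..n} \<rightarrow>\<^sub>E {0..}.
     (\<forall>i\<in>{1..n}. \<forall>j\<in>{1..n}. i \<le> j \<longrightarrow> q j \<le> q i) \<and> (\<Sum>i=1..n. q i) = int N}"

definition ss :: "nat \<Rightarrow> (nat \<Rightarrow> int) \<Rightarrow> nat \<Rightarrow> int" where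
  "ss n q j = int (card {i \<in> {1..n}. q i = int j})"

definition BB :: "nat \<Rightarrow> nat \<Rightarrow> (nat \<Rightarrow> int) \<Rightarrow> (nat \<Rightarrow> nat \<Rightarrow> int) set" where
  "BB n N q = {\<beta> \<in> (\<Pi>\<^sub>E j\<in>{1..N}. {1..j} \<rightarrow>\<^sub>E {0..}).
     \<forall>j\<in>{1..N}. (\<Sum>t=1..j. \<beta> j t) \<le> ss n q j}"

definition AA :: "nat \<Rightarrow> (nat \<Rightarrow> nat \<Rightarrow> int) \<Rightarrow> (nat \<Rightarrow> nat \<Rightarrow> int) set" where
  "AA N \<beta> = (\<Pi>\<^sub>E j\<in>{1..N}. \<Pi>\<^sub>E t\<in>{1..j}. {0..\<beta> j t})"

text \<open>Both occurrences of \<open>div 2\<close> below are exact, by the parity condition on \<open>N\<close>.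
  For negative \<open>l\<close> the outer sum is empty, and only \<open>L 0, \<dots>, L (l - 1)\<close> enter.
  The product over \<open>i\<close> comprises both binomials that follow it.\<close>

definition CC :: "nat \<Rightarrow> int \<Rightarrow> int \<Rightarrow> (nat \<Rightarrow> int) \<Rightarrow> int" where
  "CC n l r L =
    (\<Sum>N \<in> {N::nat. int N \<le> l \<and> int N mod 2 = l mod 2}.
     \<Sum>q \<in> QQ n N. \<Sum>\<beta> \<in> BB n N q. \<Sum>\<alpha> \<in> AA N \<beta>.
       binom ((l - int N) div 2 + int n - 1) (int n - 1) *
       binom (r - (l + int N) div 2
                + (\<Sum>j=1..N. \<Sum>i=1..j. (int j + 1 - int i) * \<alpha> j i) + int n - 1) (int n - 1) *
       (\<Prod>j=1..N.
          2 ^ nat (ss n q j - (\<Sum>i=1..j. \<beta> j i)) *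
          binom (\<beta> j 1) (\<alpha> j 1) *
          binom (int n - (\<Sum>t=0..j-1. L t)
                   - (\<Sum>r'=j+1..N. \<Sum>s=1..r'-j+1. \<beta> r' s)) (\<beta> j 1) *
          binom (L 0 - (\<Sum>h=j+1..N. ss n q h - (\<Sum>s=1..h. \<beta> h s)))
                (ss n q j - (\<Sum>t=1..j. \<beta> j t)) *
          (\<Prod>i=2..j.
             binom (L (j - i + 1) - (\<Sum>t=1..N-j. \<beta> (j + t) (i + t))) (\<beta> j i) *
             binom (\<beta> j i) (\<alpha> j i))))"

text \<open>The index sets are finite, so no sum in \<open>CC\<close> is zero merely by the convention for infinite sets.\<close>

lemma finite_N_range: "finite {N::nat. int N \<le> l \<and> int N mod 2 = l mod 2}"
  by (rule finite_subset[of _ "{..nat l}"]) auto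

lemma finite_QQ: "finite (QQ n N)"
proof (rule finite_subset)
  show "QQ n N \<subseteq> {1..n} \<rightarrow>\<^sub>E {0..int N}"
  proof
    fix q assume q: "q \<in> QQ n N"
    then have pos: "q i \<ge> 0" if "i \<in> {1..n}" for i
      using that by (auto simp: QQ_def PiE_iff)
    have "q i \<le> int N" if "i \<in> {1..n}" for i
      using member_le_sum[of i "{1..n}" q] that pos q by (auto simp: QQ_def)
    with pos q show "q \<in> {1..n} \<rightarrow>\<^sub>E {0..int N}"
      by (auto simp: QQ_def PiE_iff)
  qed
  show "finite ({1..n} \<rightarrow>\<^sub>E {0..int N})"
    by (intro finite_PiE) auto
qed

lemma finite_BB: "finite (BB n N q)"
proof (rule finite_subset)
  show "BB n N q \<subseteq> (\<Pi>\<^sub>E j\<in>{1..N}. {1..j} \<rightarrow>\<^sub>E {0..ss n q j})"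
  proof
    fix b assume b: "b \<in> BB n N q"
    then have pos: "b j t \<ge> 0" if "j \<in> {1..N}" "t \<in> {1..j}" for j t
      using that by (fastforce simp: BB_def PiE_iff)
    have "b j t \<le> ss n q j" if j: "j \<in> {1..N}" and t: "t \<in> {1..j}" for j t
    proof -
      have "b j t \<le> (\<Sum>t=1..j. b j t)"
        using member_le_sum[of t "{1..j}" "b j"] t pos[OF j] by auto
      also have "\<dots> \<le> ss n q j"
        using b j by (auto simp: BB_def)
      finally show ?thesis .
    qed
    with pos b show "b \<in> (\<Pi>\<^sub>E j\<in>{1..N}. {1..j} \<rightarrow>\<^sub>E {0..ss n q j})"
      by (simp add: BB_def PiE_iff)
  qed
  show "finite (\<Pi>\<^sub>E j\<in>{1..N}. {1..j} \<rightarrow>\<^sub>E {0..ss n q j})"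
    by (intro finite_PiE) auto
qed

lemma finite_AA: "finite (AA N \<beta>)"
  unfolding AA_def by (intro finite_PiE) auto

end

theory Submission
  imports Defs "HOL-Library.Function_Algebras"
begin

text \<open>
  The proof has a representation-theoretic and a combinatorial half, which meet in the numbers
  $c(k,l)$ of monomials of bidegree $(k,l)$ and weight $\mu$ in two copies $x_a, y_a$ of the $2n$
  coordinates of $\mathbb{C}^{2n}$. In other words, $c(k,l)$ is the multiplicity of $\mu$ in
  $S^k(\mathbb{C}^{2n}) \otimes S^l(\mathbb{C}^{2n})$.

  Representation theory. On polynomials in $x$ and $y$ the symplectic Lie algebra commutes with
  the polarisations $\sum_a x_a \partial_{y_a}$ (\<open>up_op\<close>), $\sum_a y_a \partial_{x_a}$ (\<open>down_op\<close>), with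
  multiplication by $\omega(x,y)$ (\<open>omega_mul\<close>), and with its dual differential operator
  (\<open>omega_diff\<close>). The model of the representation is the space of polynomials of bidegree $(k,l)$
  that \<open>up_op\<close> and \<open>omega_diff\<close> annihilate. The Fischer inner product, for which multiplication by a
  variable is adjoint to differentiation, makes this space a unitary representation of the
  compact form. It replaces all structure theory of semisimple Lie algebras: the only highest
  weight polynomials in the model are the multiples of $(x_1 y_2 - x_2 y_1)^l x_1^{k-l}$
  (\<open>hw_poly_in_model\<close>), and every nonzero invariant subspace contains them
  (\<open>model_contains_hw\<close>); applied to orthogonal complements, this shows that an invariant
  subspace containing them is the whole model (\<open>model_generated\<close>). Uniqueness of the irreducible
  representation with a given highest weight comes from the submodule that the pair of the two
  highest weight vectors generates in the direct sum: it is the graph of an isomorphism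
  (\<open>multiplicity_eq_dim_model\<close>). Finally, both operators that cut out the model are surjective
  between the relevant weight spaces, because their adjoints are injective, and hence the
  multiplicity of $\mu$ is
  $c(k,l) - c(k+1,l-1) - c(k-1,l-1) + c(k,l-2)$ (\<open>multiplicity_count\<close>).
  This is the weight multiplicity form of the symplectic Jacobi--Trudi determinant with two rows.

  Combinatorics. It remains to show $c(k,l) = C_n(l,r,\ell_0,\dots)$ for $2r = k+l-\|\mu\|_1$
  (\<open>card_wt_monos_eq_CC\<close>). Splitting $\mu$ as $(\mu - \eta) + \eta$ according to the weight $\eta$ of the
  $y$-part gives a sum over integer vectors $\eta$ of products of two binomial coefficients, by stars
  and bars. These depend on $\|\eta\|_1 = N$ and on $\|\mu-\eta\|_1$ only, so the vectors are grouped by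
  three data: the sorted absolute values $q$ of $\eta$; the number $\beta^j_t$ of positions with
  $|\eta_i| = j$ at which $|\mu_i| \ge j$ (if $t = 1$) or $|\mu_i| = j - t + 1$ (if $t \ge 2$); and the number
  $\alpha^j_t$ of those where $\eta_i$ and $\mu_i$ have the same sign. Each of the latter positions lowers
  $\|\mu-\eta\|_1$ below $\|\mu\|_1 + \|\eta\|_1$ by twice $\min(|\mu_i|,|\eta_i|) = j+1-t$
  (\<open>norm1_diff\<close>). Placing the entries of absolute
  value $N, N-1, \dots, 1$ in this order, the number of $\eta$ with given data is the product
  over $j$ in $C_n$ (\<open>card_partial_vecs\<close>).
\<close>

section \<open>Rank and nullity inside a vector space of any dimension\<close>

context vector_space begin

text \<open>
  The ambient spaces of coefficient functions have infinite dimension, so the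
  finite-dimensional facts are stated for subspaces inside the span of a finite set.
\<close>

lemma finite_dim_subspace:
  assumes "subspace U" "U \<subseteq> span B" "finite B"
  obtains C where "finite C" "independent C" "span C = U" "C \<subseteq> U" "card C = dim U"
proof -
  obtain C where C: "C \<subseteq> U" "independent C" "U \<subseteq> span C" "card C = dim U"
    using basis_exists by blast
  have "finite C"
    using independent_span_bound[OF assms(3) C(2)] C(1) assms(2) by blast
  moreover have "span C = U" using C span_minimal[OF C(1) assms(1)] by blast
  ultimately show ?thesis using C that by blast
qed

end

context vector_space_pair begin

text \<open>
  A basis of the kernel is extended to a basis of the subspace; the added vectors span a
  complement on which the map is injective.
\<close>

lemma rank_nullity:
  assumes f: "Vector_Spaces.linear s1 s2 f" and U: "vs1.subspace U"
    and fin: "U \<subseteq> vs1.span B" "finite B"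
  shows "vs1.dim U = vs2.dim (f ` U) + vs1.dim {x\<in>U. f x = 0}"
proof -
  interpret f: Vector_Spaces.linear s1 s2 f by fact
  let ?K = "{x\<in>U. f x = 0}"
  have K: "vs1.subspace ?K"
    using U unfolding vs1.subspace_def by (auto simp: f.add f.scale)
  obtain C where C: "finite C" "vs1.independent C" "vs1.span C = ?K" "C \<subseteq> ?K" "card C = vs1.dim ?K"
    by (rule vs1.finite_dim_subspace[OF K _ fin(2)]) (use fin in auto)
  obtain D where D: "C \<subseteq> D" "D \<subseteq> U" "vs1.independent D" "U \<subseteq> vs1.span D"
    using vs1.maximal_independent_subset_extend[of C U] C by blast
  have finD: "finite D"
    using vs1.independent_span_bound[OF fin(2) D(3)] D(2) fin(1) by blast
  have spD: "vs1.span D = U" using D vs1.span_minimal[OF D(2) U] by blast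
  have dimU: "vs1.dim U = card D" using vs1.basis_card_eq_dim[OF D(2,4,3)] by simp
  have inj: "inj_on f (vs1.span (D - C))"
  proof (rule f.inj_on_iff_eq_0[THEN iffD2, rule_format])
    show "vs1.subspace (vs1.span (D - C))" by simp
    fix x assume x: "x \<in> vs1.span (D - C)" and fx: "f x = 0"
    have "x \<in> vs1.span C" using x fx C(3) spD vs1.span_mono[of "D - C" D] by auto
    moreover have "vs1.span (D - C) \<inter> vs1.span C = {0}"
    proof (rule ccontr)
      assume "\<not> ?thesis"
      then obtain y where y: "y \<in> vs1.span (D - C)" "y \<in> vs1.span C" "y \<noteq> 0"
        using vs1.span_zero by blast
      have "vs1.representation D y = vs1.representation (D - C) y"
        by (rule vs1.representation_extend[OF D(3) y(1)]) auto
      moreover have "vs1.representation D y = vs1.representation C y"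
        by (rule vs1.representation_extend[OF D(3) y(2) D(1)])
      ultimately have "vs1.representation D y b = 0" for b
        using vs1.representation_ne_zero[of "D - C" y b] vs1.representation_ne_zero[of C y b] by auto
      moreover have "y \<in> vs1.span D" using y(1) vs1.span_mono[of "D - C" D] by auto
      ultimately show False
        using vs1.sum_nonzero_representation_eq[OF D(3), of y] y(3) by simp
    qed
    ultimately show "x = 0" using x by auto
  qed
  have ind: "vs2.independent (f ` (D - C))"
    by (rule f.independent_injective_image[OF _ inj]) (use D(3) vs1.independent_mono in auto)
  have "f ` U = vs2.span (f ` D)" by (simp add: spD[symmetric] f.span_image)
  also have "\<dots> = vs2.span (f ` (D - C))"
  proof (rule antisym)
    have "f ` D \<subseteq> insert 0 (f ` (D - C))" using C(4) by auto
    then show "vs2.span (f ` D) \<subseteq> vs2.span (f ` (D - C))"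
      by (metis vs2.span_insert_0 vs2.span_mono)
  next
    have "f ` (D - C) \<subseteq> f ` D" by blast
    then show "vs2.span (f ` (D - C)) \<subseteq> vs2.span (f ` D)" by (rule vs2.span_mono)
  qed
  finally have "vs2.dim (f ` U) = card (f ` (D - C))"
    using ind vs2.dim_span_eq_card_independent by simp
  also have "\<dots> = card (D - C)"
    using inj by (intro card_image) (meson inj_on_subset vs1.span_superset)
  finally show ?thesis
    using dimU C(5) card_Diff_subset[OF C(1) D(1)] card_mono[OF finD D(1)] by simp
qed

lemma dim_image_inj:
  assumes f: "Vector_Spaces.linear s1 s2 f" and U: "vs1.subspace U"
    and fin: "U \<subseteq> vs1.span B" "finite B" and inj: "\<And>x. x \<in> U \<Longrightarrow> f x = 0 \<Longrightarrow> x = 0"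
  shows "vs2.dim (f ` U) = vs1.dim U"
proof -
  interpret f: Vector_Spaces.linear s1 s2 f by fact
  have "{x\<in>U. f x = 0} = {0}" using inj U vs1.subspace_0 by (auto simp: f.zero)
  moreover have "vs1.dim {0} = 0" by (metis card.empty vs1.dim_span_eq_card_independent vs1.independent_empty vs1.span_empty)
  ultimately show ?thesis using rank_nullity[OF f U fin] by simp
qed

end

section \<open>Polynomials as coefficient functions\<close>

text \<open>
  A polynomial is the function that sends an exponent vector to its coefficient. All
  operators below make sense on arbitrary coefficient functions, that is, on formal power
  series; polynomials are singled out by gradings.
\<close>

type_synonym 'i fock = "('i \<Rightarrow> nat) \<Rightarrow> complex"

definition fscale :: "complex \<Rightarrow> 'i fock \<Rightarrow> 'i fock" where
  "fscale c f = (\<lambda>m. c * f m)"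

lemma fscale_apply: "fscale c f m = c * f m" by (simp add: fscale_def)

interpretation fs: vector_space "fscale :: complex \<Rightarrow> 'i fock \<Rightarrow> 'i fock"
  by unfold_locales (auto simp: fscale_def fun_eq_iff algebra_simps)

interpretation fsp: vector_space_pair "fscale :: complex \<Rightarrow> 'i fock \<Rightarrow> 'i fock" "fscale :: complex \<Rightarrow> 'i fock \<Rightarrow> 'i fock"
  by unfold_locales

abbreviation lin :: "('i fock \<Rightarrow> 'i fock) \<Rightarrow> bool" where
  "lin \<equiv> Vector_Spaces.linear fscale fscale"

lemma linI: "(\<And>f g. T (f + g) = T f + T g) \<Longrightarrow> (\<And>c f. T (fscale c f) = fscale c (T f)) \<Longrightarrow> lin T"
  by (simp add: Vector_Spaces.linear_iff fs.vector_space_axioms)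

lemma lin_add: "lin T \<Longrightarrow> T (f + g) = T f + T g"
  and lin_scale: "lin T \<Longrightarrow> T (fscale c f) = fscale c (T f)"
  and lin_zero: "lin T \<Longrightarrow> T 0 = 0"
  and lin_neg: "lin T \<Longrightarrow> T (- f) = - T f"
  and lin_diff: "lin T \<Longrightarrow> T (f - g) = T f - T g"
  and lin_sum: "lin T \<Longrightarrow> T (sum h A) = (\<Sum>a\<in>A. T (h a))"
  by (auto intro: fsp.linear_add fsp.linear_scale fsp.linear_0 fsp.linear_neg fsp.linear_diff fsp.linear_sum)

lemma lin_sumI:
  assumes "\<And>a. a \<in> A \<Longrightarrow> lin (T a)" shows "lin (\<lambda>f. \<Sum>a\<in>A. T a f)"
proof (rule linI)
  fix f g c
  show "(\<Sum>a\<in>A. T a (f + g)) = (\<Sum>a\<in>A. T a f) + (\<Sum>a\<in>A. T a g)"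
    unfolding sum.distrib[symmetric] by (rule sum.cong[OF refl], rule lin_add, rule assms)
  show "(\<Sum>a\<in>A. T a (fscale c f)) = fscale c (\<Sum>a\<in>A. T a f)"
    unfolding fs.scale_sum_right by (rule sum.cong[OF refl], rule lin_scale, rule assms)
qed

lemma lin_scaleI: assumes "lin T" shows "lin (\<lambda>f. fscale c (T f))"
  by (rule linI) (simp_all only: lin_add[OF assms] lin_scale[OF assms] fs.scale_right_distrib fs.scale_left_commute)

lemma lin_addI: assumes "lin T" "lin S" shows "lin (\<lambda>f. T f + S f)"
  by (rule linI) (simp_all only: lin_add[OF assms(1)] lin_scale[OF assms(1)] lin_add[OF assms(2)] lin_scale[OF assms(2)] ac_simps fs.scale_right_distrib)

lemma lin_diffI: assumes "lin T" "lin S" shows "lin (\<lambda>f. T f - S f)"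
  by (rule linI) (simp_all only: lin_add[OF assms(1)] lin_scale[OF assms(1)] lin_add[OF assms(2)] lin_scale[OF assms(2)] fs.scale_right_diff_distrib add_diff_add)

lemma lin_compI: assumes "lin T" "lin S" shows "lin (\<lambda>f. T (S f))"
  by (rule linI) (simp_all only: lin_add[OF assms(1)] lin_scale[OF assms(1)] lin_add[OF assms(2)] lin_scale[OF assms(2)])

lemma sum_apply: "(\<Sum>a\<in>A. f a) m = (\<Sum>a\<in>A. (f a m :: 'b :: comm_monoid_add))"
  by (induction A rule: infinite_finite_induct) auto

text \<open>
  Multiplication by a variable and the partial derivative, in terms of coefficients: the
  creation and annihilation operators of the bosonic Fock space.
\<close>

definition cr :: "'i \<Rightarrow> 'i fock \<Rightarrow> 'i fock" where
  "cr v f = (\<lambda>m. if m v = 0 then 0 else f (m(v := m v - 1)))"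

definition an :: "'i \<Rightarrow> 'i fock \<Rightarrow> 'i fock" where
  "an v f = (\<lambda>m. of_nat (m v + 1) * f (m(v := m v + 1)))"

lemma lin_cr: "lin (cr v)" and lin_an: "lin (an v)"
  by (auto intro!: linI simp: cr_def an_def fscale_def fun_eq_iff algebra_simps)

lemmas lin_rules = lin_add lin_scale lin_zero lin_neg lin_diff lin_sum
lemmas cr_lin = lin_rules[OF lin_cr]
lemmas an_lin = lin_rules[OF lin_an]

lemma cr_cr: "cr u (cr v f) = cr v (cr u f)"
  by (cases "u = v") (auto simp: cr_def fun_eq_iff fun_upd_twist)

lemma an_an: "an u (an v f) = an v (an u f)"
  by (cases "u = v") (auto simp: an_def fun_eq_iff fun_upd_twist)

text \<open>The canonical commutation relation. Every commutator computed below reduces to it.\<close>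

lemma an_cr: "an u (cr v f) = cr v (an u f) + (if u = v then f else 0)"
proof (cases "u = v")
  case True
  have "an v (cr v f) m = cr v (an v f) m + f m" for m
    by (cases "m v") (auto simp: an_def cr_def algebra_simps fun_upd_idem)
  with True show ?thesis by (auto simp: fun_eq_iff)
next
  case False
  then show ?thesis by (auto simp: an_def cr_def fun_eq_iff fun_upd_twist)
qed

text \<open>
  The only cancellation law that the proofs need, so polynomials are not made into a ring.
\<close>

lemma cr_inj: "cr v f = 0 \<Longrightarrow> f = 0"
proof (rule ext)
  fix m assume "cr v f = 0"
  then have "cr v f (m(v := m v + 1)) = 0" by simp
  then show "f m = 0 m" by (simp add: cr_def)
qed

lemma cr_an_apply: "cr v (an v f) m = of_nat (m v) * f m"
  by (cases "m v") (auto simp: cr_def an_def fun_upd_idem)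

section \<open>Polarisations and the invariant two-form\<close>

type_synonym poly2 = "(bool \<times> nat) fock"

text \<open>
  Indices are $0,\dots,2n-1$, whereas comments number coordinates from 1: index $a < n$
  carries the weight $\varepsilon_{a+1}$, and \<open>bar\<close> pairs it with the index of
  the opposite weight under the symplectic form, whose sign is \<open>sg\<close>. The order
  of the indices by decreasing \<open>ht\<close> is $1, \dots, n, \bar n, \dots, \bar 1$ in
  the usual notation.
\<close>

definition bar :: "nat \<Rightarrow> nat \<Rightarrow> nat" where "bar n a = (if a < n then a + n else a - n)"
definition sg :: "nat \<Rightarrow> nat \<Rightarrow> complex" where "sg n a = (if a < n then 1 else - 1)"
definition ht :: "nat \<Rightarrow> nat \<Rightarrow> int" where
  "ht n a = (if a < n then int n - int a else int a - 2 * int n)"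

text \<open>
  The variable \<open>(False, a)\<close> is $x_a$ and \<open>(True, a)\<close> is $y_a$.
\<close>

definition vars :: "nat \<Rightarrow> (bool \<times> nat) set" where "vars n = UNIV \<times> {..<2 * n}"

lemma bar_less [simp]: "a < 2 * n \<Longrightarrow> bar n a < 2 * n"
  and bar_bar [simp]: "a < 2 * n \<Longrightarrow> bar n (bar n a) = a"
  and sg_bar [simp]: "a < 2 * n \<Longrightarrow> sg n (bar n a) = - sg n a"
  and sg_sg [simp]: "sg n a * sg n a = 1"
  and sg_sg2 [simp]: "sg n a * (sg n a * c) = c"
  and bar_ne [simp]: "a < 2 * n \<Longrightarrow> bar n a \<noteq> a" "a < 2 * n \<Longrightarrow> a \<noteq> bar n a"
  and cnj_sg [simp]: "cnj (sg n a) = sg n a"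
  and ht_bar [simp]: "a < 2 * n \<Longrightarrow> ht n (bar n a) = - ht n a"
  by (auto simp: bar_def sg_def ht_def)

lemma bar_eq_iff: "a < 2 * n \<Longrightarrow> b < 2 * n \<Longrightarrow> bar n a = b \<longleftrightarrow> a = bar n b"
  by (auto simp: bar_def)

lemma finite_vars [simp]: "finite (vars n)" by (simp add: vars_def)
lemma in_vars [simp]: "(s, a) \<in> vars n \<longleftrightarrow> a < 2 * n" by (auto simp: vars_def)

lemma sum_vars: "(\<Sum>v\<in>vars n. g v) = (\<Sum>a<2*n. g (False, a)) + (\<Sum>a<2*n. g (True, a))"
  using sum.cartesian_product[of "\<lambda>s a. g (s, a)" "{..<2*n}" "UNIV :: bool set"]
  by (simp add: vars_def UNIV_bool)

lemma sum_bar: "(\<Sum>a<2*n. h (bar n a)) = (\<Sum>a<2*n. h a)"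
  by (rule sum.reindex_bij_witness[of _ "bar n" "bar n"]) auto

text \<open>The terms of $a$ and $\bar a$ cancel; this is $\omega(x, x) = 0$.\<close>

lemma sum_sg_sym:
  fixes H :: "nat \<Rightarrow> nat \<Rightarrow> 'i fock"
  assumes "\<And>a b. H a b = H b a"
  shows "(\<Sum>a<2*n. fscale (sg n a) (H a (bar n a))) = 0"
proof -
  let ?S = "\<Sum>a<2*n. fscale (sg n a) (H a (bar n a))"
  have "?S = (\<Sum>a<2*n. fscale (sg n (bar n a)) (H (bar n a) (bar n (bar n a))))"
    by (rule sum_bar[symmetric])
  also have "\<dots> = (\<Sum>a<2*n. - fscale (sg n a) (H a (bar n a)))"
    by (rule sum.cong) (auto simp: assms[of "bar n _"])
  finally have S: "?S = - ?S" by (simp add: sum_negf)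
  have "?S m = 0" for m
  proof -
    have "?S m = - (?S m)" using fun_cong[OF S, of m] unfolding fun_Compl_def .
    then have "2 * ?S m = 0" unfolding eq_neg_iff_add_eq_0 mult_2 .
    then show ?thesis unfolding mult_eq_0_iff by (elim disjE) simp_all
  qed
  then show ?thesis by (auto simp: fun_eq_iff)
qed

text \<open>
  The elementary matrix $E_{ab}$ acts on polynomials in $x$ and $y$ as the derivation $x_a
  \partial_{x_b} + y_a \partial_{y_b}$.
\<close>

definition gl_op :: "nat \<Rightarrow> nat \<Rightarrow> poly2 \<Rightarrow> poly2" where
  "gl_op a b f = cr (False, a) (an (False, b) f) + cr (True, a) (an (True, b) f)"

text \<open>
  \<open>up_op\<close> and \<open>down_op\<close> are $\sum_a x_a \partial_{y_a}$ and
  $\sum_a y_a \partial_{x_a}$, the two nilpotent generators of an $\mathfrak{sl}_2$ that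
  commutes with all \<open>gl_op\<close>.
\<close>

definition up_op :: "nat \<Rightarrow> poly2 \<Rightarrow> poly2" where
  "up_op n f = (\<Sum>a<2*n. cr (False, a) (an (True, a) f))"
definition down_op :: "nat \<Rightarrow> poly2 \<Rightarrow> poly2" where
  "down_op n f = (\<Sum>a<2*n. cr (True, a) (an (False, a) f))"

text \<open>
  Multiplication by the symplectic form $\omega(x, y) = \sum_a \pm x_a y_{\bar a}$, and the
  differential operator obtained from it by replacing each variable by the corresponding
  derivative.
\<close>

definition omega_mul :: "nat \<Rightarrow> poly2 \<Rightarrow> poly2" where
  "omega_mul n f = (\<Sum>a<2*n. fscale (sg n a) (cr (False, a) (cr (True, bar n a) f)))"
definition omega_diff :: "nat \<Rightarrow> poly2 \<Rightarrow> poly2" where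
  "omega_diff n f = (\<Sum>a<2*n. fscale (sg n a) (an (False, a) (an (True, bar n a) f)))"

text \<open>
  The action of $E_{ab} - s_a s_b E_{\bar b \bar a}$, where $s$ is the sign
  \<open>sg\<close>. These matrices span the symplectic Lie algebra.
\<close>

definition sp_op :: "nat \<Rightarrow> nat \<Rightarrow> nat \<Rightarrow> poly2 \<Rightarrow> poly2" where
  "sp_op n a b f = gl_op a b f - fscale (sg n a * sg n b) (gl_op (bar n b) (bar n a) f)"
definition rho :: "nat \<Rightarrow> complex mat \<Rightarrow> poly2 \<Rightarrow> poly2" where
  "rho n X f = (\<Sum>a<2*n. \<Sum>b<2*n. fscale (X $$ (a, b)) (gl_op a b f))"

lemma lin_gl_op: "lin (gl_op a b)"
  unfolding gl_op_def by (rule lin_addI; rule lin_compI[OF lin_cr], rule lin_an)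
lemma lin_up_op: "lin (up_op n)"
  unfolding up_op_def by (rule lin_sumI, rule lin_compI[OF lin_cr], rule lin_an)
lemma lin_omega_mul: "lin (omega_mul n)"
  unfolding omega_mul_def by (rule lin_sumI, rule lin_scaleI, rule lin_compI[OF lin_cr], rule lin_cr)
lemma lin_omega_diff: "lin (omega_diff n)"
  unfolding omega_diff_def by (rule lin_sumI, rule lin_scaleI, rule lin_compI[OF lin_an], rule lin_an)
lemma lin_sp_op: "lin (sp_op n a b)"
  unfolding sp_op_def by (rule lin_diffI, rule lin_gl_op, rule lin_scaleI, rule lin_gl_op)
lemma lin_rho: "lin (rho n X)"
  unfolding rho_def by (rule lin_sumI, rule lin_sumI, rule lin_scaleI, rule lin_gl_op)

lemmas gl_op_lin = lin_rules[OF lin_gl_op]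
lemmas up_op_lin = lin_rules[OF lin_up_op]
lemmas omega_mul_lin = lin_rules[OF lin_omega_mul]
lemmas omega_diff_lin = lin_rules[OF lin_omega_diff]
lemmas sp_op_lin = lin_rules[OF lin_sp_op]
lemmas rho_lin = lin_rules[OF lin_rho]

lemma gl_op_cr: "gl_op a b (cr (s, c) f) = cr (s, c) (gl_op a b f) + (if b = c then cr (s, a) f else 0)"
  by (cases s; simp add: gl_op_def an_cr cr_lin cr_cr)

lemma gl_op_an: "gl_op a b (an (s, c) f) = an (s, c) (gl_op a b f) - (if a = c then an (s, b) f else 0)"
  by (cases s; auto simp: gl_op_def an_cr an_lin an_an)

lemma up_op_cr: "up_op n (cr (s, c) f) = cr (s, c) (up_op n f) + (if s \<and> c < 2 * n then cr (False, c) f else 0)"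
proof -
  have "cr (False, a) (an (True, a) (cr (s, c) f)) = cr (s, c) (cr (False, a) (an (True, a) f))
     + (if a = c then (if s then cr (False, c) f else 0) else 0)" for a
    by (auto simp: an_cr cr_lin cr_cr)
  then show ?thesis by (simp add: up_op_def sum.distrib cr_lin)
qed

lemma up_op_an: "up_op n (an (s, c) f) = an (s, c) (up_op n f) - (if \<not> s \<and> c < 2 * n then an (True, c) f else 0)"
proof -
  have "an (s, c) (cr (False, a) (an (True, a) f)) = cr (False, a) (an (True, a) (an (s, c) f))
     + (if a = c then (if s then 0 else an (True, c) f) else 0)" for a
    by (auto simp: an_cr an_an)
  then show ?thesis by (simp add: up_op_def sum.distrib an_lin)
qed

lemma up_op_gl_op: "a < 2 * n \<Longrightarrow> b < 2 * n \<Longrightarrow> up_op n (gl_op a b f) = gl_op a b (up_op n f)"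
  by (simp add: gl_op_def up_op_lin up_op_cr up_op_an cr_lin)

lemma up_op_sp_op: "a < 2 * n \<Longrightarrow> b < 2 * n \<Longrightarrow> up_op n (sp_op n a b f) = sp_op n a b (up_op n f)"
  by (simp add: sp_op_def up_op_lin up_op_gl_op)

text \<open>Polarising $\omega(x, y)$ gives $\omega(x, x) = 0$.\<close>

lemma up_op_omega_mul: "up_op n (omega_mul n f) = omega_mul n (up_op n f)"
proof -
  have "up_op n (omega_mul n f) = omega_mul n (up_op n f) + (\<Sum>a<2*n. fscale (sg n a) (cr (False, a) (cr (False, bar n a) f)))"
    by (simp add: omega_mul_def up_op_lin up_op_cr cr_lin fs.scale_right_distrib sum.distrib)
  also have "(\<Sum>a<2*n. fscale (sg n a) (cr (False, a) (cr (False, bar n a) f))) = 0"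
    by (rule sum_sg_sym) (rule cr_cr)
  finally show ?thesis by simp
qed

lemma up_op_omega_diff: "up_op n (omega_diff n f) = omega_diff n (up_op n f)"
proof -
  have "up_op n (omega_diff n f) = omega_diff n (up_op n f) - (\<Sum>a<2*n. fscale (sg n a) (an (True, a) (an (True, bar n a) f)))"
    by (simp add: omega_diff_def up_op_lin up_op_an an_lin fs.scale_right_diff_distrib sum_subtractf)
  also have "(\<Sum>a<2*n. fscale (sg n a) (an (True, a) (an (True, bar n a) f))) = 0"
    by (rule sum_sg_sym) (rule an_an)
  finally show ?thesis by simp
qed

text \<open>
  A general linear vector field moves $\omega$ by two terms; for \<open>sp_op\<close> the
  two pairs of terms cancel.
\<close>

lemma gl_op_omega_mul:
  assumes "c < 2 * n" "d < 2 * n"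
  shows "gl_op c d (omega_mul n f) = omega_mul n (gl_op c d f) + fscale (sg n d) (cr (False, c) (cr (True, bar n d) f))
     - fscale (sg n d) (cr (False, bar n d) (cr (True, c) f))"
proof -
  have t: "fscale (sg n a) (gl_op c d (cr (False, a) (cr (True, bar n a) f))) =
     fscale (sg n a) (cr (False, a) (cr (True, bar n a) (gl_op c d f)))
     + (if a = d then fscale (sg n d) (cr (False, c) (cr (True, bar n d) f)) else 0)
     - (if a = bar n d then fscale (sg n d) (cr (False, bar n d) (cr (True, c) f)) else 0)"
    if "a < 2 * n" for a
    using assms that by (auto simp: gl_op_cr cr_lin fs.scale_right_distrib bar_eq_iff)
  show ?thesis
    using assms by (simp add: omega_mul_def gl_op_lin t sum.distrib sum_subtractf)
qed

lemma sp_op_omega_mul: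
  assumes "a < 2 * n" "b < 2 * n"
  shows "sp_op n a b (omega_mul n f) = omega_mul n (sp_op n a b f)"
  unfolding sp_op_def gl_op_omega_mul[OF assms] gl_op_omega_mul[OF bar_less[OF assms(2)] bar_less[OF assms(1)]]
    bar_bar[OF assms(1)] bar_bar[OF assms(2)] sg_bar[OF assms(1)] sg_bar[OF assms(2)] omega_mul_lin
  by (simp add: fun_eq_iff fscale_apply algebra_simps)

lemma gl_op_omega_diff:
  assumes "c < 2 * n" "d < 2 * n"
  shows "gl_op c d (omega_diff n f) = omega_diff n (gl_op c d f) - fscale (sg n c) (an (False, d) (an (True, bar n c) f))
     + fscale (sg n c) (an (False, bar n c) (an (True, d) f))"
proof -
  have t: "fscale (sg n a) (gl_op c d (an (False, a) (an (True, bar n a) f))) =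
     fscale (sg n a) (an (False, a) (an (True, bar n a) (gl_op c d f)))
     - (if a = c then fscale (sg n c) (an (False, d) (an (True, bar n c) f)) else 0)
     + (if a = bar n c then fscale (sg n c) (an (False, bar n c) (an (True, d) f)) else 0)"
    if "a < 2 * n" for a
    using assms that by (auto simp: gl_op_an an_lin fs.scale_right_diff_distrib bar_eq_iff)
  show ?thesis
    using assms by (simp add: omega_diff_def gl_op_lin t sum.distrib sum_subtractf)
qed

lemma sp_op_omega_diff:
  assumes "a < 2 * n" "b < 2 * n"
  shows "sp_op n a b (omega_diff n f) = omega_diff n (sp_op n a b f)"
  unfolding sp_op_def gl_op_omega_diff[OF assms] gl_op_omega_diff[OF bar_less[OF assms(2)] bar_less[OF assms(1)]]
    bar_bar[OF assms(1)] bar_bar[OF assms(2)] sg_bar[OF assms(1)] sg_bar[OF assms(2)] omega_diff_lin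
  by (simp add: fun_eq_iff fscale_apply algebra_simps)

lemma gl_op_gl_op: "gl_op a b (gl_op c d f) = gl_op c d (gl_op a b f) + (if b = c then gl_op a d f else 0)
   - (if d = a then gl_op c b f else 0)"
proof -
  have "gl_op a b (gl_op c d f) = gl_op a b (cr (False, c) (an (False, d) f)) + gl_op a b (cr (True, c) (an (True, d) f))"
    by (simp add: gl_op_def[of c d] gl_op_lin)
  then show ?thesis
    by (auto simp: gl_op_cr gl_op_an cr_lin gl_op_def[of c] gl_op_def[of a d])
qed

section \<open>Gradings\<close>

text \<open>
  \<open>graded n c t f\<close>: all monomials of \<open>f\<close> involve only the given
  variables and have total weight \<open>t\<close>, when each variable \<open>v\<close> has
  weight \<open>c v\<close>. Bidegrees, weights of the torus and heights are all instances.
\<close>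

definition graded :: "nat \<Rightarrow> (bool \<times> nat \<Rightarrow> int) \<Rightarrow> int \<Rightarrow> poly2 \<Rightarrow> bool" where
  "graded n c t f \<longleftrightarrow> (\<forall>m. f m \<noteq> 0 \<longrightarrow> (\<forall>v. v \<notin> vars n \<longrightarrow> m v = 0) \<and> (\<Sum>v\<in>vars n. c v * int (m v)) = t)"

lemma graded_cr:
  assumes "graded n c t f" "v \<in> vars n" shows "graded n c (t + c v) (cr v f)"
  unfolding graded_def
proof (intro allI impI)
  fix m assume "cr v f m \<noteq> 0"
  then have mv: "m v \<noteq> 0" and f: "f (m(v := m v - 1)) \<noteq> 0" by (auto simp: cr_def split: if_splits)
  from f assms(1) have 1: "\<forall>u. u \<notin> vars n \<longrightarrow> (m(v := m v - 1)) u = 0"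
    and 2: "(\<Sum>u\<in>vars n. c u * int ((m(v := m v - 1)) u)) = t" unfolding graded_def by blast+
  have "(\<Sum>u\<in>vars n. c u * int (m u)) = (\<Sum>u\<in>vars n. c u * int ((m(v := m v - 1)) u) + (if u = v then c v else 0))"
    using mv by (intro sum.cong) (auto simp: algebra_simps of_nat_diff)
  with 2 assms(2) have "(\<Sum>u\<in>vars n. c u * int (m u)) = t + c v" by (simp add: sum.distrib)
  moreover have "m u = 0" if "u \<notin> vars n" for u
    using 1[rule_format, OF that] assms(2) that by (cases "u = v") auto
  ultimately show "(\<forall>u. u \<notin> vars n \<longrightarrow> m u = 0) \<and> (\<Sum>u\<in>vars n. c u * int (m u)) = t + c v"
    by blast
qed

lemma graded_an:
  assumes "graded n c t f" "v \<in> vars n" shows "graded n c (t - c v) (an v f)"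
  unfolding graded_def
proof (intro allI impI)
  fix m assume "an v f m \<noteq> 0"
  then have f: "f (m(v := m v + 1)) \<noteq> 0" by (auto simp: an_def split: if_splits)
  from f assms(1) have 1: "\<forall>u. u \<notin> vars n \<longrightarrow> (m(v := m v + 1)) u = 0"
    and 2: "(\<Sum>u\<in>vars n. c u * int ((m(v := m v + 1)) u)) = t" unfolding graded_def by blast+
  have "(\<Sum>u\<in>vars n. c u * int ((m(v := m v + 1)) u)) = (\<Sum>u\<in>vars n. c u * int (m u) + (if u = v then c v else 0))"
    by (intro sum.cong) (auto simp: algebra_simps)
  with 2 assms(2) have "(\<Sum>u\<in>vars n. c u * int (m u)) = t - c v" by (simp add: sum.distrib)
  with 1 assms(2) show "(\<forall>u. u \<notin> vars n \<longrightarrow> m u = 0) \<and> (\<Sum>u\<in>vars n. c u * int (m u)) = t - c v"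
    by (auto split: if_splits)
qed

lemma graded_0 [simp]: "graded n c t 0" by (simp add: graded_def)
lemma graded_add: "graded n c t f \<Longrightarrow> graded n c t g \<Longrightarrow> graded n c t (f + g)"
  unfolding graded_def by (metis add.right_neutral plus_fun_apply)
lemma graded_scale: "graded n c t f \<Longrightarrow> graded n c t (fscale a f)"
  unfolding graded_def by (auto simp: fscale_apply)
lemma graded_diff: "graded n c t f \<Longrightarrow> graded n c t g \<Longrightarrow> graded n c t (f - g)"
  using graded_add[of n c t f "fscale (-1) g"] graded_scale[of n c t g "-1"]
  by (simp add: fs.scale_minus_left)
lemma graded_sum: "(\<And>a. a \<in> A \<Longrightarrow> graded n c t (f a)) \<Longrightarrow> graded n c t (sum f A)"
  by (induction A rule: infinite_finite_induct) (auto intro: graded_add)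

lemma graded_neg: assumes "graded n c t f" "t < 0" "\<And>v. c v \<ge> 0" shows "f = 0"
proof (rule ext, rule ccontr)
  fix m assume "f m \<noteq> 0 m"
  then have "(\<Sum>v\<in>vars n. c v * int (m v)) = t" using assms(1) unfolding graded_def by auto
  moreover have "(\<Sum>v\<in>vars n. c v * int (m v)) \<ge> 0" by (intro sum_nonneg mult_nonneg_nonneg assms) auto
  ultimately show False using assms(2) by simp
qed

text \<open>Weighted form of the Euler identity for homogeneous polynomials.\<close>

lemma euler:
  assumes "graded n c t f"
  shows "(\<Sum>v\<in>vars n. fscale (of_int (c v)) (cr v (an v f))) = fscale (of_int t) f"
proof (rule ext)
  fix m
  have "(\<Sum>v\<in>vars n. fscale (of_int (c v)) (cr v (an v f))) m = of_int (\<Sum>v\<in>vars n. c v * int (m v)) * f m"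
    by (simp add: sum_apply fscale_apply cr_an_apply sum_distrib_right mult.assoc)
  then show "(\<Sum>v\<in>vars n. fscale (of_int (c v)) (cr v (an v f))) m = fscale (of_int t) f m"
    using assms by (cases "f m = 0") (auto simp: graded_def fscale_apply)
qed

definition degx :: "bool \<times> nat \<Rightarrow> int" where "degx v = (if fst v then 0 else 1)"
definition degy :: "bool \<times> nat \<Rightarrow> int" where "degy v = (if fst v then 1 else 0)"

definition bideg :: "nat \<Rightarrow> int \<Rightarrow> int \<Rightarrow> poly2 \<Rightarrow> bool" where
  "bideg n k l f \<longleftrightarrow> graded n degx k f \<and> graded n degy l f"

text \<open>
  The $\mathfrak{sl}_2$ relation between the two polarisations: their commutator acts on
  bidegree $(k,l)$ as $k - l$.
\<close>

lemma up_op_down_op: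
  assumes "bideg n k l f"
  shows "up_op n (down_op n f) = down_op n (up_op n f) + fscale (of_int (k - l)) f"
proof -
  have "up_op n (down_op n f) = (\<Sum>a<2*n. cr (True, a) (an (False, a) (up_op n f)) - cr (True, a) (an (True, a) f)
      + cr (False, a) (an (False, a) f))"
    unfolding down_op_def up_op_lin by (intro sum.cong) (simp_all add: up_op_cr up_op_an cr_lin)
  also have "\<dots> = down_op n (up_op n f) - (\<Sum>a<2*n. cr (True, a) (an (True, a) f)) + (\<Sum>a<2*n. cr (False, a) (an (False, a) f))"
    by (simp add: down_op_def sum.distrib sum_subtractf)
  also have "(\<Sum>a<2*n. cr (True, a) (an (True, a) f)) = fscale (of_int l) f"
    using euler[of n degy l f] assms by (simp add: bideg_def sum_vars degy_def)
  also have "(\<Sum>a<2*n. cr (False, a) (an (False, a) f)) = fscale (of_int k) f"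
    using euler[of n degx k f] assms by (simp add: bideg_def sum_vars degx_def)
  finally show ?thesis by (simp add: fs.scale_left_diff_distrib fun_eq_iff)
qed

lemma bideg_0 [simp]: "bideg n k l 0" by (simp add: bideg_def)
lemma bideg_add: "bideg n k l f \<Longrightarrow> bideg n k l g \<Longrightarrow> bideg n k l (f + g)"
  and bideg_diff: "bideg n k l f \<Longrightarrow> bideg n k l g \<Longrightarrow> bideg n k l (f - g)"
  and bideg_scale: "bideg n k l f \<Longrightarrow> bideg n k l (fscale a f)"
  by (simp_all add: bideg_def graded_add graded_diff graded_scale)
lemma bideg_sum: "(\<And>a. a \<in> A \<Longrightarrow> bideg n k l (f a)) \<Longrightarrow> bideg n k l (sum f A)"
  by (simp add: bideg_def graded_sum)

lemma bideg_cr: "bideg n k l f \<Longrightarrow> a < 2 * n \<Longrightarrow> bideg n (if s then k else k + 1) (if s then l + 1 else l) (cr (s, a) f)"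
  using graded_cr[of n degx k f "(s, a)"] graded_cr[of n degy l f "(s, a)"]
  by (auto simp: bideg_def degx_def degy_def)

lemma bideg_an: "bideg n k l f \<Longrightarrow> a < 2 * n \<Longrightarrow> bideg n (if s then k else k - 1) (if s then l - 1 else l) (an (s, a) f)"
  using graded_an[of n degx k f "(s, a)"] graded_an[of n degy l f "(s, a)"]
  by (auto simp: bideg_def degx_def degy_def)

section \<open>The Fischer inner product\<close>

text \<open>
  All inner products are taken between polynomials of a fixed total degree, so that they are
  finite sums over the monomials of that degree.
\<close>

definition deg_monos :: "nat \<Rightarrow> nat \<Rightarrow> (bool \<times> nat \<Rightarrow> nat) set" where
  "deg_monos n d = {m. (\<forall>v. v \<notin> vars n \<longrightarrow> m v = 0) \<and> (\<Sum>v\<in>vars n. m v) = d}"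

lemma finite_deg_monos [simp]: "finite (deg_monos n d)"
proof (rule finite_subset)
  show "finite {m. \<forall>v. (v \<in> vars n \<longrightarrow> m v \<in> {..d}) \<and> (v \<notin> vars n \<longrightarrow> m v = 0)}"
    by (rule finite_set_of_finite_funs) auto
  show "deg_monos n d \<subseteq> {m. \<forall>v. (v \<in> vars n \<longrightarrow> m v \<in> {..d}) \<and> (v \<notin> vars n \<longrightarrow> m v = 0)}"
    unfolding deg_monos_def by (auto intro: member_le_sum)
qed

definition mfact :: "nat \<Rightarrow> (bool \<times> nat \<Rightarrow> nat) \<Rightarrow> nat" where
  "mfact n m = (\<Prod>v\<in>vars n. fact (m v))"

text \<open>
  The Fischer inner product: monomials are orthogonal, and $x^m$ has norm squared $\prod_v
  m_v!$.
\<close>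

definition fischer :: "nat \<Rightarrow> nat \<Rightarrow> poly2 \<Rightarrow> poly2 \<Rightarrow> complex" where
  "fischer n d f g = (\<Sum>m\<in>deg_monos n d. of_nat (mfact n m) * f m * cnj (g m))"

lemma fischer_lin:
  "fischer n d (f + f') g = fischer n d f g + fischer n d f' g"
  "fischer n d f (g + g') = fischer n d f g + fischer n d f g'"
  "fischer n d (f - f') g = fischer n d f g - fischer n d f' g"
  "fischer n d f (g - g') = fischer n d f g - fischer n d f g'"
  "fischer n d (fscale c f) g = c * fischer n d f g"
  "fischer n d f (fscale c g) = cnj c * fischer n d f g"
  "fischer n d 0 g = 0" "fischer n d f 0 = 0"
  by (simp_all add: fischer_def sum.distrib sum_subtractf sum_distrib_left fscale_apply algebra_simps)

lemma fischer_sum: "fischer n d (\<Sum>a\<in>A. h a) g = (\<Sum>a\<in>A. fischer n d (h a) g)"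
  "fischer n d f (\<Sum>a\<in>A. h a) = (\<Sum>a\<in>A. fischer n d f (h a))"
  by (induction A rule: infinite_finite_induct) (simp_all add: fischer_lin)

lemma fischer_self: "fischer n d f f = of_real (\<Sum>m\<in>deg_monos n d. of_nat (mfact n m) * (cmod (f m))\<^sup>2)"
  by (simp add: fischer_def mult.assoc complex_norm_square[symmetric])

lemma mfact_pos: "mfact n m > 0"
  by (simp add: mfact_def prod_pos)

lemma fischer_pos: "fischer n d f f = of_real (norm (fischer n d f f))"
proof -
  have "(\<Sum>m\<in>deg_monos n d. of_nat (mfact n m) * (cmod (f m))\<^sup>2) \<ge> 0" by (intro sum_nonneg) simp
  then show ?thesis unfolding fischer_self norm_of_real by (simp only: abs_of_nonneg)
qed

lemma fischer_eq_0:
  assumes "fischer n d f f = 0" "m \<in> deg_monos n d" shows "f m = 0"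
proof -
  have "(\<Sum>m\<in>deg_monos n d. of_nat (mfact n m) * (cmod (f m))\<^sup>2) = 0"
    using assms(1) unfolding fischer_self using of_real_eq_0_iff by blast
  then have "real (mfact n m) * (cmod (f m))\<^sup>2 = 0"
    using assms(2) by (subst (asm) sum_nonneg_eq_0_iff) auto
  then show ?thesis using mfact_pos[of n m] by auto
qed

lemma bideg_deg_monos: assumes "bideg n k l f" "f m \<noteq> 0" shows "m \<in> deg_monos n (nat (k + l))"
proof -
  have 1: "\<forall>v. v \<notin> vars n \<longrightarrow> m v = 0" and 2: "(\<Sum>v\<in>vars n. degx v * int (m v)) = k" "(\<Sum>v\<in>vars n. degy v * int (m v)) = l"
    using assms unfolding bideg_def graded_def by blast+
  have "int (\<Sum>v\<in>vars n. m v) = (\<Sum>v\<in>vars n. degx v * int (m v) + degy v * int (m v))"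
    unfolding of_nat_sum by (rule sum.cong) (auto simp: degx_def degy_def)
  also have "\<dots> = k + l" by (simp add: sum.distrib 2)
  finally have "(\<Sum>v\<in>vars n. m v) = nat (k + l)" by (metis nat_int)
  then show ?thesis using 1 by (simp add: deg_monos_def)
qed

lemma fischer_definite:
  assumes "bideg n k l f" "fischer n (nat (k + l)) f f = 0" shows "f = 0"
proof (rule ext, rule ccontr)
  fix m assume "f m \<noteq> 0 m"
  with bideg_deg_monos[OF assms(1), of m] fischer_eq_0[OF assms(2), of m] show False by simp
qed

lemma fischer_cnj: "cnj (fischer n d f g) = fischer n d g f"
  by (simp add: fischer_def mult.commute mult.left_commute)

text \<open>
  Multiplication by a variable is adjoint to differentiation, because $(m_v + 1)! = (m_v +
  1)\, m_v!$.
\<close>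

lemma fischer_cr: assumes v: "v \<in> vars n" shows "fischer n (Suc d) (cr v f) g = fischer n d f (an v g)"
proof -
  have upd: "(\<Sum>u\<in>vars n. (m(v := Suc (m v))) u) = Suc (\<Sum>u\<in>vars n. m u)" for m :: "bool \<times> nat \<Rightarrow> nat"
  proof -
    have "(\<Sum>u\<in>vars n. (m(v := Suc (m v))) u) = (\<Sum>u\<in>vars n. m u + (if u = v then 1 else 0))"
      by (rule sum.cong) auto
    then show ?thesis using v by (simp add: sum.distrib)
  qed
  have updf: "mfact n (m(v := Suc (m v))) = Suc (m v) * mfact n m" for m
    using v by (simp add: mfact_def prod.remove[of "vars n" v] algebra_simps)
  have "fischer n (Suc d) (cr v f) g = (\<Sum>m\<in>{m\<in>deg_monos n (Suc d). m v \<noteq> 0}. of_nat (mfact n m) * cr v f m * cnj (g m))"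
    unfolding fischer_def by (rule sum.mono_neutral_right) (auto simp: cr_def)
  also have "\<dots> = (\<Sum>m\<in>deg_monos n d. of_nat (mfact n m) * f m * cnj (an v g m))"
  proof (rule sum.reindex_bij_witness[of _ "\<lambda>m. m(v := Suc (m v))" "\<lambda>m. m(v := m v - 1)"])
    fix m assume m: "m \<in> {m\<in>deg_monos n (Suc d). m v \<noteq> 0}"
    show eq: "(m(v := m v - 1))(v := Suc ((m(v := m v - 1)) v)) = m" using m by auto
    have "Suc (\<Sum>u\<in>vars n. (m(v := m v - 1)) u) = Suc d"
      using upd[of "m(v := m v - 1)"] m unfolding eq by (simp add: deg_monos_def)
    then show "m(v := m v - 1) \<in> deg_monos n d" using m v by (auto simp: deg_monos_def)
    show "of_nat (mfact n (m(v := m v - 1))) * f (m(v := m v - 1)) * cnj (an v g (m(v := m v - 1))) =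
         of_nat (mfact n m) * cr v f m * cnj (g m)"
    proof -
      have "mfact n m = m v * mfact n (m(v := m v - 1))"
        using updf[of "m(v := m v - 1)"] m unfolding eq by (cases "m v") simp_all
      then have "(of_nat (mfact n m) :: complex) = of_nat (m v) * of_nat (mfact n (m(v := m v - 1)))"
        by (metis of_nat_mult)
      moreover have "Suc (m v - Suc 0) = m v" "m(v := Suc (m v - Suc 0)) = m" using m by auto
      ultimately show ?thesis using m by (simp add: cr_def an_def)
    qed
  next
    fix m assume m: "m \<in> deg_monos n d"
    show "(m(v := Suc (m v)))(v := (m(v := Suc (m v))) v - 1) = m" by auto
    show "m(v := Suc (m v)) \<in> {m \<in> deg_monos n (Suc d). m v \<noteq> 0}"
      using m v upd[of m] by (auto simp: deg_monos_def)
  qed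
  also have "\<dots> = fischer n d f (an v g)" by (simp add: fischer_def)
  finally show ?thesis .
qed

lemma fischer_an: "v \<in> vars n \<Longrightarrow> fischer n (Suc d) g (cr v f) = fischer n d (an v g) f"
  using fischer_cr[of v n d f g] by (metis fischer_cnj)

lemma fischer_cr_0: "v \<in> vars n \<Longrightarrow> fischer n 0 (cr v f) g = 0" "v \<in> vars n \<Longrightarrow> fischer n 0 g (cr v f) = 0"
  by (auto simp: fischer_def deg_monos_def cr_def intro!: sum.neutral)

lemma fischer_cr_an:
  "u \<in> vars n \<Longrightarrow> v \<in> vars n \<Longrightarrow> fischer n d (cr u (an v f)) g = fischer n d f (cr v (an u g))"
  by (cases d) (simp_all add: fischer_cr_0 fischer_cr fischer_an)

lemma fischer_gl_op: "a < 2 * n \<Longrightarrow> b < 2 * n \<Longrightarrow> fischer n d (gl_op a b f) g = fischer n d f (gl_op b a g)"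
  by (simp add: gl_op_def fischer_lin fischer_cr_an)

lemma fischer_sp_op: "a < 2 * n \<Longrightarrow> b < 2 * n \<Longrightarrow> fischer n d (sp_op n a b f) g = fischer n d f (sp_op n b a g)"
  by (simp add: sp_op_def fischer_lin fischer_gl_op mult.commute[of "sg n a" "sg n b"])

lemma fischer_up_op: "fischer n d (up_op n f) g = fischer n d f (down_op n g)"
  by (simp add: up_op_def down_op_def fischer_sum fischer_cr_an)

lemma fischer_omega_mul: "fischer n (Suc (Suc d)) (omega_mul n f) g = fischer n d f (omega_diff n g)"
  by (simp add: omega_mul_def omega_diff_def fischer_sum fischer_lin fischer_cr an_an)

lemma bideg_up_op: assumes "bideg n k l f" shows "bideg n (k + 1) (l - 1) (up_op n f)"
proof -
  have "bideg n (k + 1) (l - 1) (cr (False, a) (an (True, a) f))" if "a < 2 * n" for a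
    using bideg_cr[OF bideg_an[OF assms that, of True] that, of False] by simp
  then show ?thesis unfolding up_op_def by (intro bideg_sum) auto
qed

lemma bideg_down_op: assumes "bideg n k l f" shows "bideg n (k - 1) (l + 1) (down_op n f)"
proof -
  have "bideg n (k - 1) (l + 1) (cr (True, a) (an (False, a) f))" if "a < 2 * n" for a
    using bideg_cr[OF bideg_an[OF assms that, of False] that, of True] by simp
  then show ?thesis unfolding down_op_def by (intro bideg_sum) auto
qed

lemma bideg_omega_mul: assumes "bideg n k l f" shows "bideg n (k + 1) (l + 1) (omega_mul n f)"
proof -
  have "bideg n (k + 1) (l + 1) (cr (False, a) (cr (True, bar n a) f))" if "a < 2 * n" for a
    using bideg_cr[OF bideg_cr[OF assms bar_less[OF that], of True] that, of False] by simp
  then show ?thesis unfolding omega_mul_def by (intro bideg_sum bideg_scale) auto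
qed

lemma bideg_omega_diff: assumes "bideg n k l f" shows "bideg n (k - 1) (l - 1) (omega_diff n f)"
proof -
  have "bideg n (k - 1) (l - 1) (an (False, a) (an (True, bar n a) f))" if "a < 2 * n" for a
    using bideg_an[OF bideg_an[OF assms bar_less[OF that], of True] that, of False] by simp
  then show ?thesis unfolding omega_diff_def by (intro bideg_sum bideg_scale) auto
qed

lemma bideg_gl_op: assumes "bideg n k l f" "a < 2 * n" "b < 2 * n" shows "bideg n k l (gl_op a b f)"
  using bideg_cr[OF bideg_an[OF assms(1,3), of False] assms(2), of False]
    bideg_cr[OF bideg_an[OF assms(1,3), of True] assms(2), of True]
  by (simp add: gl_op_def bideg_add)

lemma bideg_sp_op: "bideg n k l f \<Longrightarrow> a < 2 * n \<Longrightarrow> b < 2 * n \<Longrightarrow> bideg n k l (sp_op n a b f)"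
  by (simp add: sp_op_def bideg_diff bideg_scale bideg_gl_op)

lemma bideg_nonneg: assumes "bideg n k l f" "f \<noteq> 0" shows "k \<ge> 0 \<and> l \<ge> 0"
proof -
  have "degx v \<ge> 0" "degy v \<ge> 0" for v by (simp_all add: degx_def degy_def)
  then have "\<not> k < 0" "\<not> l < 0"
    using graded_neg[of n degx k f] graded_neg[of n degy l f] assms by (auto simp: bideg_def)
  then show ?thesis by simp
qed

text \<open>
  If \<open>down_op\<close> annihilates $f$, the $\mathfrak{sl}_2$ relation and adjointness
  give zero for the sum of the squared norm of \<open>up_op n f\<close> and of $(k -
  l)\|f\|^2$, and both terms are nonnegative.
\<close>

lemma down_op_inj:
  assumes f: "bideg n k l f" and "k > l" and 0: "down_op n f = 0" shows "f = 0"
proof (rule fischer_definite[OF f], rule ccontr)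
  let ?d = "nat (k + l)"
  assume ne: "fischer n ?d f f \<noteq> 0"
  have "0 = down_op n (up_op n f) + fscale (of_int (k - l)) f"
    using up_op_down_op[OF f] by (simp add: 0 up_op_lin)
  then have "fischer n ?d (down_op n (up_op n f) + fscale (of_int (k - l)) f) f = 0"
    by (metis fischer_lin(7))
  then have "fischer n ?d (down_op n (up_op n f)) f + of_int (k - l) * fischer n ?d f f = 0"
    by (simp only: fischer_lin)
  also have "fischer n ?d (down_op n (up_op n f)) f = fischer n ?d (up_op n f) (up_op n f)"
    by (metis fischer_up_op fischer_cnj)
  finally have "of_real (norm (fischer n ?d (up_op n f) (up_op n f)) + of_int (k - l) * norm (fischer n ?d f f)) = (0 :: complex)"
    by (simp add: fischer_pos[symmetric])
  then have "norm (fischer n ?d (up_op n f) (up_op n f)) + of_int (k - l) * norm (fischer n ?d f f) = 0"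
    by (simp only: of_real_eq_0_iff)
  moreover have "of_int (k - l) * norm (fischer n ?d f f) > 0"
    using ne assms(2) by (intro mult_pos_pos) auto
  ultimately show False using norm_ge_zero[of "fischer n ?d (up_op n f) (up_op n f)"] by linarith
qed

text \<open>
  By adjointness the squared norm of $\omega f$ is the inner product of $f$ with the
  polynomial that vanishes by hypothesis.
\<close>

lemma omega_diff_mul_zero:
  assumes f: "bideg n k l f" and 0: "omega_diff n (omega_mul n f) = 0" shows "omega_mul n f = 0"
proof (cases "f = 0")
  case False
  then have kl: "k \<ge> 0" "l \<ge> 0" using bideg_nonneg[OF f] by auto
  have "fischer n (Suc (Suc (nat (k + l)))) (omega_mul n f) (omega_mul n f) = 0"
    by (simp add: fischer_omega_mul 0 fischer_lin)
  moreover have "Suc (Suc (nat (k + l))) = nat ((k + 1) + (l + 1))" using kl by simp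
  ultimately show ?thesis using fischer_definite[OF bideg_omega_mul[OF f]] by metis
qed (simp add: omega_mul_lin)

text \<open>Gram--Schmidt, one spanning vector at a time.\<close>

lemma orth_proj:
  assumes B: "finite B" "\<And>b. b \<in> B \<Longrightarrow> bideg n k l b" and f: "bideg n k l f"
  shows "\<exists>u\<in>fs.span B. bideg n k l u \<and> (\<forall>b\<in>fs.span B. fischer n (nat (k + l)) b (f - u) = 0)"
  using B f
proof (induction B arbitrary: f rule: finite_induct)
  case empty
  have "b = 0" if "b \<in> fs.span ({} :: poly2 set)" for b using that by (simp only: fs.span_empty singleton_iff)
  then show ?case by (metis bideg_0 fs.span_zero fischer_lin(7))
next
  case (insert b B)
  let ?d = "nat (k + l)"
  have bb: "bideg n k l b" using insert.prems by auto
  obtain u where u: "u \<in> fs.span B" "bideg n k l u" "\<And>x. x \<in> fs.span B \<Longrightarrow> fischer n ?d x (f - u) = 0"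
    using insert.IH[OF _ insert.prems(2)] insert.prems(1) by blast
  obtain v where v: "v \<in> fs.span B" "bideg n k l v" "\<And>x. x \<in> fs.span B \<Longrightarrow> fischer n ?d x (b - v) = 0"
    using insert.IH[OF _ bb] insert.prems(1) by blast
  define b1 where "b1 = b - v"
  \<comment> \<open>the coefficient of the projection to the new direction; the inner product is antilinear in its second argument\<close>
  define c where "c = cnj (fischer n ?d b1 (f - u) / fischer n ?d b1 b1)"
  have b1: "bideg n k l b1" using bideg_diff[OF bb v(2)] by (simp add: b1_def)
  define w where "w = u + fscale c b1"
  have sub: "fs.span B \<subseteq> fs.span (insert b B)" by (rule fs.span_mono) auto
  have b1s: "b1 \<in> fs.span (insert b B)"
    unfolding b1_def by (rule fs.span_diff[OF fs.span_base subsetD[OF sub v(1)]]) simp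
  have ws: "w \<in> fs.span (insert b B)"
    unfolding w_def by (rule fs.span_add[OF subsetD[OF sub u(1)] fs.span_scale[OF b1s]])
  have orthB: "fischer n ?d x (f - w) = 0" if "x \<in> fs.span B" for x
    using u(3)[OF that] v(3)[OF that] by (simp add: w_def b1_def fischer_lin)
  have orthb1: "fischer n ?d b1 (f - w) = 0"
  proof (cases "fischer n ?d b1 b1 = 0")
    case True
    then have "b1 = 0" by (rule fischer_definite[OF b1])
    then show ?thesis by (simp add: fischer_lin)
  next
    case False
    have "fischer n ?d b1 (f - w) = fischer n ?d b1 (f - u) - cnj c * fischer n ?d b1 b1"
      by (simp add: w_def fischer_lin)
    then show ?thesis using False by (simp add: c_def)
  qed
  have "fischer n ?d x (f - w) = 0" if x: "x \<in> fs.span (insert b B)" for x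
  proof -
    obtain t where t: "x - fscale t b \<in> fs.span B" using x by (auto simp: fs.span_insert)
    have "x = (x - fscale t b) + fscale t v + fscale t b1"
      by (simp add: b1_def fs.scale_right_diff_distrib fun_eq_iff)
    moreover have "fischer n ?d ((x - fscale t b) + fscale t v + fscale t b1) (f - w) = 0"
      unfolding fischer_lin(1)[of n ?d "_ + _"] fischer_lin(1)[of n ?d "x - fscale t b"] fischer_lin(5) 
      using orthB[OF t] orthB[OF v(1)] orthb1 by simp
    ultimately show ?thesis by metis
  qed
  moreover have "bideg n k l w" by (simp add: w_def bideg_add bideg_scale u(2) b1)
  ultimately show ?case using ws by blast
qed

section \<open>Matrices acting by derivations\<close>

lemma rho_gl_op:
  assumes "c < 2 * n" "d < 2 * n"
  shows "rho n X (gl_op c d f) = gl_op c d (rho n X f) + (\<Sum>a<2*n. fscale (X $$ (a, c)) (gl_op a d f))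
     - (\<Sum>b<2*n. fscale (X $$ (d, b)) (gl_op c b f))"
proof -
  have "fscale (X $$ (a, b)) (gl_op a b (gl_op c d f)) = fscale (X $$ (a, b)) (gl_op c d (gl_op a b f))
    + (if b = c then fscale (X $$ (a, b)) (gl_op a d f) else 0)
    - (if a = d then fscale (X $$ (a, b)) (gl_op c b f) else 0)" for a b
    unfolding gl_op_gl_op[of a b] by (auto simp: fs.scale_right_distrib fs.scale_right_diff_distrib)
  then have "rho n X (gl_op c d f) = gl_op c d (rho n X f)
    + (\<Sum>a<2*n. \<Sum>b<2*n. if b = c then fscale (X $$ (a, b)) (gl_op a d f) else 0)
    - (\<Sum>a<2*n. \<Sum>b<2*n. if a = d then fscale (X $$ (a, b)) (gl_op c b f) else 0)"
    by (simp only: rho_def gl_op_lin sum.distrib sum_subtractf)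
  also have "(\<Sum>a<2*n. \<Sum>b<2*n. if b = c then fscale (X $$ (a, b)) (gl_op a d f) else 0)
     = (\<Sum>a<2*n. fscale (X $$ (a, c)) (gl_op a d f))"
    using assms by simp
  also have "(\<Sum>a<2*n. \<Sum>b<2*n. if a = d then fscale (X $$ (a, b)) (gl_op c b f) else 0)
     = (\<Sum>b<2*n. fscale (X $$ (d, b)) (gl_op c b f))"
    using assms by (subst sum.swap) simp
  finally show ?thesis .
qed

lemma rho_mult:
  assumes "X \<in> carrier_mat (2*n) (2*n)" "Y \<in> carrier_mat (2*n) (2*n)"
  shows "rho n (X * Y) f = (\<Sum>a<2*n. \<Sum>c<2*n. \<Sum>b<2*n. fscale (X $$ (a, b) * Y $$ (b, c)) (gl_op a c f))"
proof -
  have "(X * Y) $$ (a, c) = (\<Sum>b<2*n. X $$ (a, b) * Y $$ (b, c))" if "a < 2 * n" "c < 2 * n" for a c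
    using assms that by (auto simp: scalar_prod_def atLeast0LessThan)
  then show ?thesis by (simp add: rho_def fs.scale_sum_left)
qed

lemma rho_bracket:
  assumes X: "X \<in> carrier_mat (2*n) (2*n)" and Y: "Y \<in> carrier_mat (2*n) (2*n)"
  shows "rho n (bracket X Y) f = rho n X (rho n Y f) - rho n Y (rho n X f)"
proof -
  have "rho n X (rho n Y f) = (\<Sum>c<2*n. \<Sum>d<2*n. fscale (Y $$ (c, d)) (rho n X (gl_op c d f)))"
    by (simp add: rho_def[of n Y] rho_lin)
  also have "\<dots> = (\<Sum>c<2*n. \<Sum>d<2*n. fscale (Y $$ (c, d)) (gl_op c d (rho n X f))
      + (\<Sum>a<2*n. fscale (X $$ (a, c) * Y $$ (c, d)) (gl_op a d f))
      - (\<Sum>b<2*n. fscale (Y $$ (c, d) * X $$ (d, b)) (gl_op c b f)))"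
    by (intro sum.cong refl)
       (simp add: rho_gl_op fs.scale_right_distrib fs.scale_right_diff_distrib fs.scale_sum_right mult.commute)
  also have "\<dots> = rho n Y (rho n X f)
      + (\<Sum>c<2*n. \<Sum>d<2*n. \<Sum>a<2*n. fscale (X $$ (a, c) * Y $$ (c, d)) (gl_op a d f))
      - (\<Sum>c<2*n. \<Sum>d<2*n. \<Sum>b<2*n. fscale (Y $$ (c, d) * X $$ (d, b)) (gl_op c b f))"
    by (simp only: rho_def[of n Y] sum.distrib sum_subtractf)
  also have "(\<Sum>c<2*n. \<Sum>d<2*n. \<Sum>b<2*n. fscale (Y $$ (c, d) * X $$ (d, b)) (gl_op c b f)) = rho n (Y * X) f"
    unfolding rho_mult[OF Y X] by (intro sum.cong refl sum.swap)
  also have "(\<Sum>c<2*n. \<Sum>d<2*n. \<Sum>a<2*n. fscale (X $$ (a, c) * Y $$ (c, d)) (gl_op a d f)) = rho n (X * Y) f"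
    unfolding rho_mult[OF X Y]
    by (subst sum.swap, subst (2) sum.swap, subst sum.swap, rule refl)
  finally have "rho n X (rho n Y f) - rho n Y (rho n X f) = rho n (X * Y) f - rho n (Y * X) f"
    by (simp add: fun_eq_iff)
  also have "\<dots> = rho n (bracket X Y) f"
  proof -
    have "(X * Y - Y * X) $$ (a, b) = (X * Y) $$ (a, b) - (Y * X) $$ (a, b)" if "a < 2 * n" "b < 2 * n" for a b
      using X Y that by auto
    then show ?thesis
      by (simp add: rho_def bracket_def fs.scale_left_diff_distrib sum_subtractf)
  qed
  finally show ?thesis by simp
qed

text \<open>
  Evaluating sums of polynomials pointwise would push them below a binder, where the
  operator identities no longer match.
\<close>

declare plus_fun_apply [simp del] zero_fun_apply [simp del] minus_apply [simp del] uminus_apply [simp del]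
lemmas pointwise = fun_eq_iff plus_fun_apply zero_fun_apply minus_apply uminus_apply fscale_apply

section \<open>Highest weight polynomials\<close>

text \<open>
  Highest weight vectors of the symplectic Lie algebra that are also annihilated by the
  raising polarisation.
\<close>

definition hw_poly :: "nat \<Rightarrow> nat \<Rightarrow> nat \<Rightarrow> poly2 \<Rightarrow> bool" where
  "hw_poly n k l p \<longleftrightarrow> bideg n (int k) (int l) p \<and> up_op n p = 0 \<and>
     (\<forall>a<2*n. \<forall>b<2*n. ht n a > ht n b \<longrightarrow> sp_op n a b p = 0)"

text \<open>The constant polynomial 1.\<close>

definition vac :: "poly2" where "vac = (\<lambda>m. if m = (\<lambda>_. 0) then 1 else 0)"

text \<open>Multiplication by $x_1 y_2 - x_2 y_1$.\<close>

definition minor_mul :: "poly2 \<Rightarrow> poly2" where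
  "minor_mul f = cr (False, 0) (cr (True, 1) f) - cr (False, 1) (cr (True, 0) f)"

text \<open>
  The polynomial $(x_1 y_2 - x_2 y_1)^l\, x_1^a$, of bidegree $(a + l, l)$ and weight $(a +
  l)\varepsilon_1 + l\varepsilon_2$.
\<close>

fun hw_vec :: "nat \<Rightarrow> nat \<Rightarrow> poly2" where
  "hw_vec a 0 = (cr (False, 0) ^^ a) vac"
| "hw_vec a (Suc l) = minor_mul (hw_vec a l)"

lemma lin_minor_mul: "lin minor_mul"
  unfolding minor_mul_def by (rule lin_diffI; rule lin_compI[OF lin_cr], rule lin_cr)
lemmas minor_mul_lin = lin_rules[OF lin_minor_mul]

lemma minor_mul_cr: "minor_mul (cr v f) = cr v (minor_mul f)"
  by (simp add: minor_mul_def cr_cr cr_lin)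

lemma hw_vec_Suc: "hw_vec (Suc a) l = cr (False, 0) (hw_vec a l)"
  by (induction l) (simp_all add: minor_mul_cr)

lemma an_vac: "an v vac = 0"
proof -
  have "m(v := Suc (m v)) \<noteq> (\<lambda>_. 0)" for m by (metis fun_upd_same nat.distinct(2))
  then have "an v vac m = 0 m" for m by (simp add: an_def vac_def zero_fun_apply)
  then show ?thesis by blast
qed

lemma an_pow_vac: "v \<noteq> u \<Longrightarrow> an v ((cr u ^^ a) vac) = 0"
  by (induction a) (simp_all add: an_vac an_cr cr_lin)

lemma an_minor_mul_T1: "an (True, 1) (minor_mul f) = minor_mul (an (True, 1) f) + cr (False, 0) f"
  by (simp add: minor_mul_def an_lin an_cr cr_lin)
lemma an_minor_mul_F1: "an (False, 1) (minor_mul f) = minor_mul (an (False, 1) f) - cr (True, 0) f"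
  by (simp add: minor_mul_def an_lin an_cr cr_lin)
lemma an_minor_mul: "b \<noteq> 0 \<Longrightarrow> b \<noteq> 1 \<Longrightarrow> an (s, b) (minor_mul f) = minor_mul (an (s, b) f)"
  by (simp add: minor_mul_def an_lin an_cr cr_lin)

lemma an_hw_vec: "b \<noteq> 0 \<Longrightarrow> b \<noteq> 1 \<Longrightarrow> an (s, b) (hw_vec a l) = 0"
  by (induction l) (simp_all add: an_pow_vac an_minor_mul minor_mul_lin)

lemma an_hw_vec_T1: "an (True, 1) (hw_vec a (Suc l)) = fscale (of_nat (Suc l)) (cr (False, 0) (hw_vec a l))"
proof (induction l)
  case 0
  show ?case by (simp add: an_minor_mul_T1[unfolded One_nat_def] an_pow_vac minor_mul_lin)
next
  case (Suc l)
  have "an (True, 1) (hw_vec a (Suc (Suc l))) = minor_mul (an (True, 1) (hw_vec a (Suc l))) + cr (False, 0) (hw_vec a (Suc l))"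
    unfolding hw_vec.simps(2)[of a "Suc l"] by (rule an_minor_mul_T1)
  also have "\<dots> = fscale (of_nat (Suc l)) (cr (False, 0) (hw_vec a (Suc l))) + cr (False, 0) (hw_vec a (Suc l))"
    unfolding Suc.IH by (simp add: minor_mul_lin minor_mul_cr)
  finally show ?case by (simp add: pointwise algebra_simps)
qed

lemma an_hw_vec_F1: "an (False, 1) (hw_vec a (Suc l)) = fscale (- of_nat (Suc l)) (cr (True, 0) (hw_vec a l))"
proof (induction l)
  case 0
  show ?case by (simp add: an_minor_mul_F1[unfolded One_nat_def] an_pow_vac minor_mul_lin)
next
  case (Suc l)
  have "an (False, 1) (hw_vec a (Suc (Suc l))) = minor_mul (an (False, 1) (hw_vec a (Suc l))) - cr (True, 0) (hw_vec a (Suc l))"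
    unfolding hw_vec.simps(2)[of a "Suc l"] by (rule an_minor_mul_F1)
  also have "\<dots> = fscale (- of_nat (Suc l)) (cr (True, 0) (hw_vec a (Suc l))) - cr (True, 0) (hw_vec a (Suc l))"
    unfolding Suc.IH by (simp only: minor_mul_lin minor_mul_cr hw_vec.simps)
  finally show ?case by (simp add: pointwise algebra_simps)
qed

lemma pow_vac_apply: "(cr v ^^ a) vac m = (if m = (\<lambda>_. 0)(v := a) then 1 else 0)"
proof (induction a arbitrary: m)
  case 0
  have "(\<lambda>_. 0)(v := 0) = (\<lambda>_. 0)" by auto
  then show ?case by (simp add: vac_def)
next
  case (Suc a)
  have "m v \<noteq> 0 \<and> m(v := m v - 1) = (\<lambda>_. 0)(v := a) \<longleftrightarrow> m = (\<lambda>_. 0)(v := Suc a)"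
  proof
    assume *: "m v \<noteq> 0 \<and> m(v := m v - 1) = (\<lambda>_. 0)(v := a)"
    then have "m v - 1 = a" by (metis fun_upd_same)
    moreover have "m u = 0" if "u \<noteq> v" for u using * that by (metis fun_upd_other)
    ultimately show "m = (\<lambda>_. 0)(v := Suc a)" using * by (auto simp: fun_eq_iff)
  qed auto
  moreover have "(cr v ^^ Suc a) vac m = (if m v = 0 then 0 else (cr v ^^ a) vac (m(v := m v - 1)))"
    by (simp add: cr_def[of v "(cr v ^^ a) vac"])
  ultimately show ?case using Suc.IH[of "m(v := m v - 1)"] by (simp only: split: if_split) blast
qed

text \<open>Differentiating by $y_2$ lowers the power of the minor and keeps a nonzero factor.\<close>

lemma hw_vec_nonzero: "hw_vec a l \<noteq> 0"
proof (induction l)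
  case 0
  have "(cr (False, 0) ^^ a) vac ((\<lambda>_. 0)((False, 0) := a)) = 1" by (simp add: pow_vac_apply)
  then show ?case by (metis hw_vec.simps(1) zero_fun_apply zero_neq_one)
next
  case (Suc l)
  show ?case
  proof
    assume "hw_vec a (Suc l) = 0"
    then have "an (True, 1) (hw_vec a (Suc l)) = 0" by (simp only: an_lin)
    then have "cr (False, 0) (hw_vec a l) = 0" by (simp only: an_hw_vec_T1) (simp add: fs.scale_eq_0_iff del: of_nat_Suc)
    then have "hw_vec a l = 0" by (rule cr_inj)
    with Suc.IH show False ..
  qed
qed

lemma graded_vac: "graded n c 0 vac" by (simp add: graded_def vac_def)

lemma bideg_hw_vec: assumes "n \<ge> 2" shows "bideg n (int (a + l)) (int l) (hw_vec a l)"
proof (induction l)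
  case 0
  show ?case
  proof (induction a)
    case 0 show ?case by (simp add: bideg_def graded_vac)
  next
    case (Suc a)
    show ?case using bideg_cr[OF Suc.IH, of 0 False] assms by (simp add: add.commute)
  qed
next
  case (Suc l)
  have "bideg n (int (a + Suc l)) (int (Suc l)) (cr (False, 0) (cr (True, 1) (hw_vec a l)))"
    using bideg_cr[OF bideg_cr[OF Suc.IH, of 1 True], of 0 False] assms by (simp add: algebra_simps)
  moreover have "bideg n (int (a + Suc l)) (int (Suc l)) (cr (False, 1) (cr (True, 0) (hw_vec a l)))"
    using bideg_cr[OF bideg_cr[OF Suc.IH, of 0 True], of 1 False] assms by (simp add: algebra_simps)
  ultimately show ?case by (simp only: hw_vec.simps minor_mul_def bideg_diff)
qed

lemma up_op_hw_vec: assumes "n \<ge> 2" shows "up_op n (hw_vec a l) = 0"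
proof (induction l)
  case 0
  show ?case by (simp add: up_op_def an_pow_vac cr_lin)
next
  case (Suc l)
  have "up_op n (minor_mul (hw_vec a l)) = minor_mul (up_op n (hw_vec a l))"
    using assms by (simp add: minor_mul_def up_op_lin up_op_cr cr_lin cr_cr)
  then show ?case by (simp only: hw_vec.simps Suc.IH minor_mul_lin)
qed

lemma omega_diff_hw_vec: assumes "n \<ge> 2" shows "omega_diff n (hw_vec a l) = 0"
  unfolding omega_diff_def
proof (rule sum.neutral, rule ballI)
  fix b assume b: "b \<in> {..<2*n}"
  consider "b \<ge> 2" | "bar n b \<ge> 2" using assms b by (cases "b < n") (auto simp: bar_def)
  then have "an (False, b) (an (True, bar n b) (hw_vec a l)) = 0"
  proof cases
    case 1
    then show ?thesis by (subst an_an) (simp add: an_hw_vec an_lin)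
  next
    case 2
    then show ?thesis by (simp add: an_hw_vec an_lin)
  qed
  then show "fscale (sg n b) (an (False, b) (an (True, bar n b) (hw_vec a l))) = 0" by simp
qed

lemma gl_op_hw_vec: assumes "n \<ge> 2" "b < 2 * n" "c < 2 * n" "ht n b > ht n c" shows "gl_op b c (hw_vec a l) = 0"
proof (cases "c = 0 \<or> c = 1")
  case False
  then show ?thesis by (simp add: gl_op_def an_hw_vec cr_lin)
next
  case True
  then have bc: "b = 0" "c = 1" using assms by (auto simp: ht_def split: if_splits)
  have D: "gl_op 0 1 (minor_mul f) = minor_mul (gl_op 0 1 f)" for f
    by (simp add: minor_mul_def gl_op_lin gl_op_cr cr_lin cr_cr)
  have "gl_op 0 1 (hw_vec a l) = 0"
  proof (induction l)
    case 0
    show ?case by (simp add: gl_op_def an_pow_vac cr_lin)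
  next
    case (Suc l)
    then show ?case by (simp only: hw_vec.simps D minor_mul_lin)
  qed
  then show ?thesis by (simp only: bc)
qed

lemma sp_op_hw_vec: assumes "n \<ge> 2" "b < 2 * n" "c < 2 * n" "ht n b > ht n c" shows "sp_op n b c (hw_vec a l) = 0"
  using gl_op_hw_vec[OF assms] gl_op_hw_vec[OF assms(1) bar_less[OF assms(3)] bar_less[OF assms(2)]] assms
  by (simp add: sp_op_def)

lemma hw_poly_hw_vec: "n \<ge> 2 \<Longrightarrow> hw_poly n (a + l) l (hw_vec a l)"
  unfolding hw_poly_def using bideg_hw_vec[of n a l] up_op_hw_vec[of n a l] sp_op_hw_vec[of n] by blast

lemma hw_poly_diff: "hw_poly n k l p \<Longrightarrow> hw_poly n k l q \<Longrightarrow> hw_poly n k l (p - q)"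
  unfolding hw_poly_def by (simp add: bideg_diff up_op_lin sp_op_lin)
lemma hw_poly_scale: "hw_poly n k l p \<Longrightarrow> hw_poly n k l (fscale c p)"
  unfolding hw_poly_def by (simp add: bideg_scale up_op_lin sp_op_lin)
lemma hw_poly_sum: "(\<And>a. a \<in> A \<Longrightarrow> hw_poly n k l (p a)) \<Longrightarrow> hw_poly n k l (sum p A)"
  unfolding hw_poly_def by (simp add: bideg_sum up_op_lin sp_op_lin)
lemma hw_poly_omega_mul: "hw_poly n k l p \<Longrightarrow> hw_poly n (Suc k) (Suc l) (omega_mul n p)"
  unfolding hw_poly_def using bideg_omega_mul[of n "int k" "int l" p]
  by (simp add: up_op_omega_mul sp_op_omega_mul omega_mul_lin add.commute)

lemma hw_poly_omega_mul_pow: "hw_poly n k l p \<Longrightarrow> hw_poly n (k + d) (l + d) ((omega_mul n ^^ d) p)"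
  by (induction d) (auto dest: hw_poly_omega_mul)

lemma hw_poly_sp_op:
  assumes "hw_poly n k l p" "a < 2 * n" "b < 2 * n" "ht n a > ht n b"
  shows "gl_op a b p = fscale (sg n a * sg n b) (gl_op (bar n b) (bar n a) p)"
proof -
  have "sp_op n a b p = 0" using assms unfolding hw_poly_def by blast
  then show ?thesis unfolding sp_op_def by (simp only: right_minus_eq)
qed

text \<open>
  Differentiation by $y_b$ commutes with the raising operators up to derivatives by
  variables of lower height. If these vanish, the result is again a highest weight
  polynomial, of smaller bidegree; this drives both inductions below.
\<close>

lemma hw_poly_an:
  assumes p: "hw_poly n k (Suc l) p" and b: "b < 2 * n"
    and low: "\<And>c s. c < 2 * n \<Longrightarrow> ht n c < ht n b \<Longrightarrow> an (s, c) p = 0"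
  shows "hw_poly n k l (an (True, b) p)"
  unfolding hw_poly_def
proof (intro conjI allI impI)
  show "bideg n (int k) (int l) (an (True, b) p)"
    using bideg_an[of n k "Suc l" p b True] p b by (simp add: hw_poly_def)
  show "up_op n (an (True, b) p) = 0" using p by (simp add: hw_poly_def up_op_an an_lin)
  fix c d assume cd: "c < 2 * n" "d < 2 * n" "ht n d < ht n c"
  have 1: "gl_op c d (an (True, b) p) = an (True, b) (gl_op c d p)"
    using low[of d True] cd by (auto simp: gl_op_an)
  have 2: "gl_op (bar n d) (bar n c) (an (True, b) p) = an (True, b) (gl_op (bar n d) (bar n c) p)"
    using low[of "bar n c"] cd by (auto simp add: gl_op_an)
  have "sp_op n c d (an (True, b) p) = an (True, b) (sp_op n c d p)"
    by (simp add: sp_op_def 1 2 an_lin)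
  then show "sp_op n c d (an (True, b) p) = 0" using p cd by (simp add: hw_poly_def an_lin)
qed

lemma eq_neg_self: assumes "f = fscale (- 1) f" shows "f = 0"
proof (rule ext)
  fix m
  have "f m = - f m" using fun_cong[OF assms, of m] unfolding fscale_apply by simp
  then have "2 * f m = 0" unfolding eq_neg_iff_add_eq_0 mult_2 .
  then show "f m = 0 m" by (simp add: zero_fun_apply)
qed

text \<open>The root vector of $2\varepsilon_a$ is twice a single elementary matrix.\<close>

lemma long_root_relation: assumes "hw_poly n k l p" "a < n" shows "gl_op a (bar n a) p = 0"
proof -
  have "gl_op a (bar n a) p = fscale (-1) (gl_op a (bar n a) p)"
    using hw_poly_sp_op[OF assms(1), of a "bar n a"] assms(2) by (simp add: ht_def bar_def sg_def)
  then show ?thesis by (rule eq_neg_self)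
qed

lemma single_var:
  assumes g: "graded n c t p" and v: "v \<in> vars n" "c v = 1" and t: "t = int k"
    and 0: "\<And>u. u \<in> vars n \<Longrightarrow> u \<noteq> v \<Longrightarrow> an u p = 0"
  shows "\<exists>a. p = fscale a ((cr v ^^ k) vac)"
proof -
  let ?m0 = "(\<lambda>_. 0)(v := k)"
  have "m = ?m0" if m: "p m \<noteq> 0" for m
  proof -
    have out: "m u = 0" if "u \<notin> vars n" for u using g m that unfolding graded_def by blast
    have inn: "m u = 0" if "u \<in> vars n" "u \<noteq> v" for u
    proof (rule ccontr)
      assume "m u \<noteq> 0"
      then obtain j where j: "m u = Suc j" by (cases "m u") auto
      then have "m(u := Suc j) = m" by auto
      then have "an u p (m(u := m u - 1)) = of_nat (m u) * p m" by (simp add: an_def j)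
      with 0[OF that] \<open>m u \<noteq> 0\<close> m show False by (simp add: zero_fun_apply)
    qed
    have "(\<Sum>u\<in>vars n. c u * int (m u)) = t"
      using g[unfolded graded_def, rule_format, OF m] by (rule conjunct2)
    then have "int k = (\<Sum>u\<in>vars n. c u * int (m u))" using t by (simp only:)
    also have "\<dots> = (\<Sum>u\<in>{v}. c u * int (m u))"
      using v inn by (intro sum.mono_neutral_right) auto
    finally have "m v = k" using v by simp
    then show ?thesis using out inn by (auto simp: fun_eq_iff)
  qed
  then have "p m = fscale (p ?m0) ((cr v ^^ k) vac) m" for m
    by (auto simp: fscale_apply pow_vac_apply)
  then show ?thesis by blast
qed

text \<open>
  If the last variables $x_{\bar 1}, y_{\bar 1}$ do not occur, the root vector of
  $\varepsilon_1 - \mathrm{wt}(b)$ acts by $x_1\partial_{x_b} + y_1\partial_{y_b}$ alone.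
\<close>

lemma first_row_relation:
  assumes p: "hw_poly n k l p" and b: "b < 2 * n" "b \<noteq> 0"
    and 0: "\<And>s. an (s, bar n 0) p = 0"
  shows "cr (False, 0) (an (False, b) p) = - cr (True, 0) (an (True, b) p)"
proof -
  have "gl_op 0 b p = 0"
    using hw_poly_sp_op[OF p, of 0 b] b 0 by (simp add: ht_def gl_op_def[of "bar n b"] cr_lin)
  then show ?thesis by (simp add: gl_op_def add_eq_0_iff)
qed

text \<open>
  Induction on $l$. The derivative of $p$ by $y_b$, for the lowest variable $b$ that occurs,
  is a highest weight polynomial of smaller bidegree, hence $c\,x_1 w$ with $w =
  (x_1y_2-x_2y_1)^{l-1}x_1^a$, and the relation of the first row gives the derivative
  $-c\,y_1 w$ by $x_b$. If $b \neq 1, 2$, the second row $x_2\partial_{x_b} +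
  y_2\partial_{y_b}$ annihilates $p$ as well, which reads $c\,(x_1y_2-x_2y_1)\,w = 0$, so
  $b$ does not occur. Once only $x_1,y_1,x_2,y_2$ are left, subtracting the right multiple
  of the expected polynomial removes $x_2$ and $y_2$, and the condition on
  \<open>up_op\<close> leaves a polynomial in $x_1$ alone, which vanishes as it has positive
  degree in $y$.
\<close>

lemma hw_poly_without_last_index:
  assumes n: "n \<ge> 2"
  shows "hw_poly n (a + l) l p \<Longrightarrow> (\<And>s. an (s, bar n 0) p = 0) \<Longrightarrow> \<exists>c. p = fscale c (hw_vec a l)"
proof (induction l arbitrary: a p)
  case (0 a p)
  have T: "an (True, b) p = 0" if "b < 2 * n" for b
  proof (rule ccontr)
    assume "an (True, b) p \<noteq> 0"
    moreover have "bideg n (int a) (- 1) (an (True, b) p)"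
      using bideg_an[of n "int a" 0 p b True] 0(1) that by (simp add: hw_poly_def)
    ultimately show False using bideg_nonneg by fastforce
  qed
  have F: "an (False, b) p = 0" if "b < 2 * n" "b \<noteq> 0" for b
    using first_row_relation[OF 0(1) that 0(2)] T[OF that(1)] by - (rule cr_inj[of "(False, 0)"], simp add: cr_lin)
  have "\<exists>c. p = fscale c ((cr (False, 0) ^^ a) vac)"
  proof (rule single_var[of n degx "int a"])
    show "graded n degx (int a) p" using 0(1) by (simp add: hw_poly_def bideg_def)
    show "an u p = 0" if "u \<in> vars n" "u \<noteq> (False, 0)" for u
    proof (cases u)
      case (Pair s b)
      then show ?thesis using that T[of b] F[of b] by (cases s) simp_all
    qed
  qed (use n in \<open>auto simp: degx_def\<close>)
  then show ?case by simp
next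
  case (Suc l a p)
  note p = Suc.prems(1) and nb = Suc.prems(2)
  let ?w = "hw_vec a l"
  have main: "\<exists>c. an (True, b) p = fscale c (cr (False, 0) ?w) \<and> an (False, b) p = fscale (- c) (cr (True, 0) ?w)"
    if b: "b < 2 * n" "b \<noteq> 0" and low: "\<And>c s. c < 2 * n \<Longrightarrow> ht n c < ht n b \<Longrightarrow> an (s, c) p = 0" for b
  proof -
    have I: "hw_poly n (Suc a + l) l (an (True, b) p)"
      using hw_poly_an[OF _ b(1) low, of "Suc a + l" l] p by simp
    moreover have "an (s, bar n 0) (an (True, b) p) = 0" for s
      by (subst an_an) (simp add: nb an_lin)
    ultimately obtain c where c: "an (True, b) p = fscale c (cr (False, 0) ?w)"
      using Suc.IH[OF I] by (auto simp: hw_vec_Suc)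
    have "cr (False, 0) (an (False, b) p) = cr (False, 0) (fscale (- c) (cr (True, 0) ?w))"
      using first_row_relation[OF p b nb] by (simp add: c cr_lin cr_cr)
    then have "cr (False, 0) (an (False, b) p - fscale (- c) (cr (True, 0) ?w)) = 0"
      by (simp add: cr_lin)
    then have "an (False, b) p - fscale (- c) (cr (True, 0) ?w) = 0" by (rule cr_inj)
    then have "an (False, b) p = fscale (- c) (cr (True, 0) ?w)" by (simp only: right_minus_eq)
    with c show ?thesis by blast
  qed
  have van: "an (s, b) p = 0" if "b < 2 * n" "b \<noteq> 0" "b \<noteq> 1" for b s
    using that
  proof (induction "nat (ht n b + int n)" arbitrary: b s rule: less_induct)
    case (less b s)
    have low: "an (s, c) p = 0" if "c < 2 * n" "ht n c < ht n b" for c s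
      using less.hyps[of c s] that less.prems by (auto simp: ht_def split: if_splits)
    show ?case
    proof (cases "b = bar n 0")
      case True
      then show ?thesis by (simp add: nb)
    next
      case False
      obtain c where c: "an (True, b) p = fscale c (cr (False, 0) ?w)" "an (False, b) p = fscale (- c) (cr (True, 0) ?w)"
        using main[OF less.prems(1,2) low] by blast
      have "gl_op 1 b p = 0"
      proof (cases "b = bar n 1")
        case True
        then show ?thesis using long_root_relation[OF p, of 1] n by simp
      next
        case b: False
        have "ht n (bar n 1) < ht n b" using less.prems n b False by (auto simp: ht_def bar_def split: if_splits)
        then have "an (s, bar n 1) p = 0" for s using n by (intro low) auto
        then have "gl_op (bar n b) (bar n 1) p = 0" by (simp add: gl_op_def cr_lin)
        then show ?thesis using hw_poly_sp_op[OF p, of 1 b] less.prems n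
          by (auto simp: ht_def split: if_splits)
      qed
      then have "fscale c (hw_vec a (Suc l)) = 0"
        by (simp add: gl_op_def c cr_lin minor_mul_def cr_cr fs.scale_right_diff_distrib)
      then have "c = 0" using hw_vec_nonzero fs.scale_eq_0_iff by blast
      then show ?thesis using c by (cases s) auto
    qed
  qed
  obtain c where c: "an (True, 1) p = fscale c (cr (False, 0) ?w)" "an (False, 1) p = fscale (- c) (cr (True, 0) ?w)"
    using main[of 1] van n by (force simp: ht_def split: if_splits)
  \<comment> \<open>differentiating the minor to the power $l+1$ by $y_2$ brings down the factor $l+1$\<close>
  define c' where "c' = c / of_nat (Suc l)"
  define q where "q = p - fscale c' (hw_vec a (Suc l))"
  have "an (True, 1) q = 0" "an (False, 1) q = 0"
    unfolding q_def an_lin an_hw_vec_T1 an_hw_vec_F1 c fs.scale_scale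
    by (simp_all add: c'_def del: of_nat_Suc)
  moreover have "an (s, b) q = 0" if "b < 2 * n" "b \<noteq> 0" "b \<noteq> 1" for b s
    unfolding q_def an_lin using van[OF that, of s] an_hw_vec[OF that(2,3), of s a "Suc l"]
    by (simp only: fs.scale_zero_right diff_zero)
  ultimately have q0: "an (s, b) q = 0" if "b < 2 * n" "b \<noteq> 0" for b s
    using that by (cases "b = 1"; cases s) auto
  have bq: "bideg n (int (a + Suc l)) (int (Suc l)) q"
    unfolding q_def using p bideg_hw_vec[OF n, of a "Suc l"] by (intro bideg_diff bideg_scale) (auto simp: hw_poly_def)
  have "up_op n q = 0"
    unfolding q_def up_op_lin up_op_hw_vec[OF n] using p by (simp add: hw_poly_def)
  moreover have "up_op n q = (\<Sum>b<2*n. if b = 0 then cr (False, 0) (an (True, 0) q) else 0)"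
    unfolding up_op_def by (rule sum.cong) (auto simp: q0 cr_lin)
  ultimately have "an (True, 0) q = 0" using n by - (rule cr_inj[of "(False, 0)"], simp)
  then have T: "an (True, b) q = 0" if "b < 2 * n" for b using q0 that by (cases "b = 0") auto
  have "fscale (of_int (int (Suc l))) q = 0"
    using euler[of n degy "int (Suc l)" q] bq T by (simp add: bideg_def sum_vars degy_def cr_lin)
  then have "q = 0" by (simp add: fs.scale_eq_0_iff del: of_nat_Suc)
  then show ?case unfolding q_def by (metis eq_iff_diff_eq_0)
qed

lemma an_omega_mul: assumes "n \<ge> 2" shows "an (True, bar n 0) (omega_mul n f) = omega_mul n (an (True, bar n 0) f) + cr (False, 0) f"
proof -
  have t: "an (True, bar n 0) (fscale (sg n a) (cr (False, a) (cr (True, bar n a) f))) =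
      fscale (sg n a) (cr (False, a) (cr (True, bar n a) (an (True, bar n 0) f))) + (if a = 0 then cr (False, 0) f else 0)"
    if "a < 2 * n" for a
  proof -
    have "bar n 0 = bar n a \<longleftrightarrow> a = 0" using that assms by (auto simp: bar_def split: if_splits)
    then show ?thesis using assms by (auto simp: an_lin an_cr cr_lin sg_def fs.scale_right_distrib)
  qed
  show ?thesis using assms by (simp add: omega_mul_def an_lin(6) t sum.distrib)
qed

lemma omega_mul_cr: "omega_mul n (cr v f) = cr v (omega_mul n f)"
  by (simp add: omega_mul_def cr_lin cr_cr)

lemma an_omega_mul_pow: assumes n: "n \<ge> 2"
  shows "an (True, bar n 0) ((omega_mul n ^^ Suc d) (hw_vec a l)) = fscale (of_nat (Suc d)) ((omega_mul n ^^ d) (hw_vec (Suc a) l))"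
proof (induction d)
  case 0
  have "an (True, bar n 0) (hw_vec a l) = 0" using n by (intro an_hw_vec) (auto simp: bar_def)
  then show ?case using n by (simp add: an_omega_mul omega_mul_lin hw_vec_Suc)
next
  case (Suc d)
  have cr: "(omega_mul n ^^ d) (cr (False, 0) f) = cr (False, 0) ((omega_mul n ^^ d) f)" for d f
    by (induction d) (simp_all add: omega_mul_cr)
  have "an (True, bar n 0) ((omega_mul n ^^ Suc (Suc d)) (hw_vec a l)) =
     omega_mul n (an (True, bar n 0) ((omega_mul n ^^ Suc d) (hw_vec a l))) + cr (False, 0) ((omega_mul n ^^ Suc d) (hw_vec a l))"
    using an_omega_mul[OF n, of "(omega_mul n ^^ Suc d) (hw_vec a l)"] by simp
  also have "\<dots> = fscale (of_nat (Suc d)) ((omega_mul n ^^ Suc d) (hw_vec (Suc a) l)) + (omega_mul n ^^ Suc d) (hw_vec (Suc a) l)"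
    unfolding Suc.IH by (simp add: omega_mul_lin hw_vec_Suc cr omega_mul_cr)
  finally show ?case by (simp add: pointwise algebra_simps)
qed

text \<open>
  Every highest weight polynomial is a combination of
  $\omega^d\,(x_1y_2-x_2y_1)^{l-d}\,x_1^a$. The derivative by $y_{\bar 1}$ is of this form
  by induction on $l$, and it has an antiderivative of the same form, since $\partial\omega
  / \partial y_{\bar 1} = x_1$. The difference does not involve the last index.
\<close>

lemma hw_poly_classification:
  assumes n: "n \<ge> 2"
  shows "hw_poly n (a + l) l p \<Longrightarrow> \<exists>c. p = (\<Sum>d\<le>l. fscale (c d) ((omega_mul n ^^ d) (hw_vec a (l - d))))"
proof (induction l arbitrary: a p)
  case (0 a p)
  have T: "an (True, bar n 0) p = 0"
  proof (rule ccontr)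
    assume "an (True, bar n 0) p \<noteq> 0"
    moreover have "bideg n (int a) (- 1) (an (True, bar n 0) p)"
      using bideg_an[of n "int a" 0 p "bar n 0" True] 0(1) n by (simp add: hw_poly_def)
    ultimately show False using bideg_nonneg by fastforce
  qed
  have "an (False, bar n 0) p = 0"
    using long_root_relation[OF 0(1), of 0] n by - (rule cr_inj[of "(False, 0)"], simp add: gl_op_def T cr_lin)
  with T have "an (s, bar n 0) p = 0" for s by (cases s) simp_all
  then have "\<exists>c. p = fscale c (hw_vec a 0)"
    by (rule hw_poly_without_last_index[OF n 0(1)])
  then obtain c where "p = fscale c (hw_vec a 0)" ..
  then show ?case by (intro exI[of _ "\<lambda>_. c"]) simp
next
  case (Suc l a p)
  let ?y = "(True, bar n 0)"
  have "hw_poly n (Suc a + l) l (an ?y p)"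
    using hw_poly_an[of n "Suc a + l" l p "bar n 0"] Suc.prems n by (auto simp: ht_def bar_def split: if_splits)
  from Suc.IH[OF this] obtain c where c: "an ?y p = (\<Sum>d\<le>l. fscale (c d) ((omega_mul n ^^ d) (hw_vec (Suc a) (l - d))))"
    by blast
  \<comment> \<open>an antiderivative with respect to $y_{\bar 1}$\<close>
  define q where "q = (\<Sum>d\<le>l. fscale (c d / of_nat (Suc d)) ((omega_mul n ^^ Suc d) (hw_vec a (l - d))))"
  have qI: "hw_poly n (a + Suc l) (Suc l) q"
    unfolding q_def
  proof (intro hw_poly_sum hw_poly_scale)
    fix d assume "d \<in> {..l}"
    then show "hw_poly n (a + Suc l) (Suc l) ((omega_mul n ^^ Suc d) (hw_vec a (l - d)))"
      using hw_poly_omega_mul_pow[OF hw_poly_hw_vec[OF n, of a "l - d"], of "Suc d"] by simp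
  qed
  have "an ?y q = an ?y p"
    unfolding q_def c an_lin an_omega_mul_pow[OF n] fs.scale_scale
    by (rule sum.cong) (simp_all del: of_nat_Suc)
  then have T: "an ?y (p - q) = 0" by (simp add: an_lin)
  have I: "hw_poly n (a + Suc l) (Suc l) (p - q)" using Suc.prems qI by (rule hw_poly_diff)
  have "an (False, bar n 0) (p - q) = 0"
    using long_root_relation[OF I, of 0] n by - (rule cr_inj[of "(False, 0)"], simp add: gl_op_def T cr_lin)
  with T have "an (s, bar n 0) (p - q) = 0" for s by (cases s) simp_all
  then have "\<exists>c. p - q = fscale c (hw_vec a (Suc l))"
    by (rule hw_poly_without_last_index[OF n I])
  then obtain c0 where c0: "p - q = fscale c0 (hw_vec a (Suc l))" ..
  define c' where "c' d = (case d of 0 \<Rightarrow> c0 | Suc e \<Rightarrow> c e / of_nat (Suc e))" for d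
  have "(\<Sum>d\<le>Suc l. fscale (c' d) ((omega_mul n ^^ d) (hw_vec a (Suc l - d)))) = fscale c0 (hw_vec a (Suc l)) + q"
    unfolding sum.atMost_Suc_shift q_def by (simp add: c'_def)
  also have "\<dots> = p" unfolding c0[symmetric] by (simp add: pointwise)
  finally show ?case by (intro exI[of _ c']) (rule sym)
qed

text \<open>
  The part of the classification divisible by $\omega$ is annihilated by
  \<open>omega_diff\<close>, and so vanishes.
\<close>

theorem hw_poly_in_model:
  assumes n: "n \<ge> 2" and p: "hw_poly n (a + l) l p" and dp: "omega_diff n p = 0"
  shows "\<exists>c. p = fscale c (hw_vec a l)"
proof (cases l)
  case 0
  then show ?thesis using hw_poly_classification[OF n p] by auto
next
  case (Suc j)
  obtain c where c: "p = (\<Sum>d\<le>l. fscale (c d) ((omega_mul n ^^ d) (hw_vec a (l - d))))"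
    using hw_poly_classification[OF n p] by blast
  define q where "q = (\<Sum>d\<le>j. fscale (c (Suc d)) ((omega_mul n ^^ d) (hw_vec a (j - d))))"
  have pq: "p = fscale (c 0) (hw_vec a l) + omega_mul n q"
    unfolding c Suc sum.atMost_Suc_shift q_def omega_mul_lin by simp
  have "omega_diff n (omega_mul n q) = 0"
    using dp unfolding pq by (simp add: omega_diff_lin omega_diff_hw_vec[OF n])
  moreover have "bideg n (int (a + j)) (int j) q"
    unfolding q_def
  proof (intro bideg_sum bideg_scale)
    fix d assume "d \<in> {..j}"
    then show "bideg n (int (a + j)) (int j) ((omega_mul n ^^ d) (hw_vec a (j - d)))"
      using hw_poly_omega_mul_pow[OF hw_poly_hw_vec[OF n, of a "j - d"], of d] by (simp add: hw_poly_def)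
  qed
  ultimately have "omega_mul n q = 0" by (rule omega_diff_mul_zero[rotated])
  then show ?thesis using pq by (metis add.right_neutral)
qed

section \<open>The symplectic Lie algebra and its root vectors\<close>

lemma symp_form_index:
  "a < 2 * n \<Longrightarrow> b < 2 * n \<Longrightarrow> symp_form n $$ (a, b) = (if b = bar n a then sg n a else 0)"
  unfolding symp_form_def by (subst index_mat_four_block) (auto simp: bar_def sg_def)

lemma symp_form_carrier [simp]: "symp_form n \<in> carrier_mat (2 * n) (2 * n)"
  unfolding symp_form_def mult_2 by (intro four_block_carrier_mat) auto

text \<open>
  In terms of entries, $X$ lies in the symplectic Lie algebra iff it is fixed by the
  involution that sends $E_{ab}$ to $-s_a s_b E_{\bar b \bar a}$.
\<close>

lemma sp_iff:
  "X \<in> sp n \<longleftrightarrow> X \<in> carrier_mat (2 * n) (2 * n) \<and>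
     (\<forall>a<2*n. \<forall>b<2*n. X $$ (a, b) = - sg n a * sg n b * X $$ (bar n b, bar n a))"
proof (cases "X \<in> carrier_mat (2 * n) (2 * n)")
  case X: True
  have e: "(transpose_mat X * symp_form n + symp_form n * X) $$ (a, b) =
      sg n a * X $$ (bar n a, b) - sg n b * X $$ (bar n b, a)" if ab: "a < 2 * n" "b < 2 * n" for a b
  proof -
    have "(transpose_mat X * symp_form n) $$ (a, b) = (\<Sum>c<2*n. X $$ (c, a) * symp_form n $$ (c, b))"
      using X ab carrier_matD[OF symp_form_carrier[of n]] by (auto simp: scalar_prod_def atLeast0LessThan)
    also have "\<dots> = (\<Sum>c<2*n. if c = bar n b then - sg n b * X $$ (bar n b, a) else 0)"
      using ab by (intro sum.cong) (auto simp: symp_form_index bar_eq_iff)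
    finally have 1: "(transpose_mat X * symp_form n) $$ (a, b) = - sg n b * X $$ (bar n b, a)"
      using ab by simp
    have "(symp_form n * X) $$ (a, b) = (\<Sum>c<2*n. symp_form n $$ (a, c) * X $$ (c, b))"
      using X ab carrier_matD[OF symp_form_carrier[of n]] by (auto simp: scalar_prod_def atLeast0LessThan)
    also have "\<dots> = (\<Sum>c<2*n. if c = bar n a then sg n a * X $$ (bar n a, b) else 0)"
      using ab by (intro sum.cong) (auto simp: symp_form_index)
    finally have 2: "(symp_form n * X) $$ (a, b) = sg n a * X $$ (bar n a, b)"
      using ab by simp
    show ?thesis
      using X ab carrier_matD[OF symp_form_carrier[of n]] by (simp add: 1[simplified] 2[simplified])
  qed
  have "X \<in> sp n \<longleftrightarrow> (\<forall>a<2*n. \<forall>b<2*n. sg n a * X $$ (bar n a, b) = sg n b * X $$ (bar n b, a))"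
  proof
    assume "X \<in> sp n"
    then have z: "transpose_mat X * symp_form n + symp_form n * X = 0\<^sub>m (2 * n) (2 * n)" by (simp add: sp_def)
    show "\<forall>a<2*n. \<forall>b<2*n. sg n a * X $$ (bar n a, b) = sg n b * X $$ (bar n b, a)"
    proof (intro allI impI)
      fix a b assume "a < 2 * n" "b < 2 * n"
      then show "sg n a * X $$ (bar n a, b) = sg n b * X $$ (bar n b, a)"
        using e[of a b] unfolding z by simp
    qed
  next
    assume *: "\<forall>a<2*n. \<forall>b<2*n. sg n a * X $$ (bar n a, b) = sg n b * X $$ (bar n b, a)"
    have "transpose_mat X * symp_form n + symp_form n * X = 0\<^sub>m (2 * n) (2 * n)"
    proof (rule eq_matI)
      fix i j assume "i < dim_row (0\<^sub>m (2 * n) (2 * n))" "j < dim_col (0\<^sub>m (2 * n) (2 * n))"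
      then have "i < 2 * n" "j < 2 * n" by auto
      then show "(transpose_mat X * symp_form n + symp_form n * X) $$ (i, j) = 0\<^sub>m (2 * n) (2 * n) $$ (i, j)"
        using e[of i j] * by simp
    qed (use X carrier_matD[OF symp_form_carrier[of n]] in auto)
    then show "X \<in> sp n" using X by (simp add: sp_def)
  qed
  also have "\<dots> \<longleftrightarrow> (\<forall>a<2*n. \<forall>b<2*n. X $$ (a, b) = - sg n a * sg n b * X $$ (bar n b, bar n a))"
  proof (intro iffI allI impI)
    fix a b assume ab: "a < 2 * n" "b < 2 * n"
    { assume *: "\<forall>a<2*n. \<forall>b<2*n. sg n a * X $$ (bar n a, b) = sg n b * X $$ (bar n b, a)"
      have "- sg n a * X $$ (a, b) = sg n b * X $$ (bar n b, bar n a)"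
        using *[rule_format, OF bar_less[OF ab(1)] ab(2)] ab by simp
      then have "- sg n a * (- sg n a * X $$ (a, b)) = - sg n a * (sg n b * X $$ (bar n b, bar n a))" by simp
      then show "X $$ (a, b) = - sg n a * sg n b * X $$ (bar n b, bar n a)" by simp }
    { assume *: "\<forall>a<2*n. \<forall>b<2*n. X $$ (a, b) = - sg n a * sg n b * X $$ (bar n b, bar n a)"
      have "X $$ (bar n a, b) = sg n a * sg n b * X $$ (bar n b, a)"
        using *[rule_format, OF bar_less[OF ab(1)] ab(2)] ab by simp
      then show "sg n a * X $$ (bar n a, b) = sg n b * X $$ (bar n b, a)" by (simp add: mult.assoc) }
  qed
  finally show ?thesis using X by simp
qed (auto simp: sp_def)

lemma sp_entry:
  "X \<in> sp n \<Longrightarrow> a < 2 * n \<Longrightarrow> b < 2 * n \<Longrightarrow> X $$ (a, b) = - sg n a * sg n b * X $$ (bar n b, bar n a)"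
  unfolding sp_iff by blast

lemma sp_carrier: "X \<in> sp n \<Longrightarrow> X \<in> carrier_mat (2 * n) (2 * n)"
  by (simp add: sp_def)

lemma sp_add: assumes X: "X \<in> sp n" and Y: "Y \<in> sp n" shows "X + Y \<in> sp n"
proof (intro sp_iff[THEN iffD2] conjI allI impI)
  fix a b assume ab: "a < 2 * n" "b < 2 * n"
  have e: "(X + Y) $$ (i, j) = X $$ (i, j) + Y $$ (i, j)" if "i < 2 * n" "j < 2 * n" for i j
    using that sp_carrier[OF X] sp_carrier[OF Y] by simp
  show "(X + Y) $$ (a, b) = - sg n a * sg n b * (X + Y) $$ (bar n b, bar n a)"
    unfolding e[OF ab] e[OF bar_less[OF ab(2)] bar_less[OF ab(1)]] sp_entry[OF X ab] sp_entry[OF Y ab]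
    by (simp add: distrib_left)
qed (use sp_carrier[OF X] sp_carrier[OF Y] in simp)

lemma sp_smult: assumes X: "X \<in> sp n" shows "c \<cdot>\<^sub>m X \<in> sp n"
proof (intro sp_iff[THEN iffD2] conjI allI impI)
  fix a b assume ab: "a < 2 * n" "b < 2 * n"
  have e: "(c \<cdot>\<^sub>m X) $$ (i, j) = c * X $$ (i, j)" if "i < 2 * n" "j < 2 * n" for i j
    using that sp_carrier[OF X] by simp
  show "(c \<cdot>\<^sub>m X) $$ (a, b) = - sg n a * sg n b * (c \<cdot>\<^sub>m X) $$ (bar n b, bar n a)"
    unfolding e[OF ab] e[OF bar_less[OF ab(2)] bar_less[OF ab(1)]] sp_entry[OF X ab]
    by simp
qed (use sp_carrier[OF X] in simp)

lemma sp_bracket: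
  assumes X: "X \<in> sp n" and Y: "Y \<in> sp n" shows "bracket X Y \<in> sp n"
proof -
  let ?N = "2 * n"
  note cX = sp_carrier[OF X] and cY = sp_carrier[OF Y]
  have XY: "(X * Y) $$ (a, b) = sg n a * sg n b * (Y * X) $$ (bar n b, bar n a)"
    if ab: "a < ?N" "b < ?N" and cX: "X \<in> sp n" and cY: "Y \<in> sp n" for a b X Y
  proof -
    have "(X * Y) $$ (a, b) = (\<Sum>c<?N. X $$ (a, c) * Y $$ (c, b))"
      using sp_carrier[OF cX] sp_carrier[OF cY] ab by (auto simp: scalar_prod_def atLeast0LessThan)
    also have "\<dots> = (\<Sum>c<?N. sg n a * sg n b * (Y $$ (bar n b, bar n c) * X $$ (bar n c, bar n a)))"
    proof (intro sum.cong refl)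
      fix c assume c: "c \<in> {..<?N}"
      have eq: "X $$ (a, c) = - sg n a * sg n c * X $$ (bar n c, bar n a)"
        "Y $$ (c, b) = - sg n c * sg n b * Y $$ (bar n b, bar n c)"
        using cX cY ab c unfolding sp_iff by blast+
      show "X $$ (a, c) * Y $$ (c, b) = sg n a * sg n b * (Y $$ (bar n b, bar n c) * X $$ (bar n c, bar n a))"
        unfolding eq by (simp add: ac_simps)
    qed
    also have "\<dots> = sg n a * sg n b * (\<Sum>c<?N. Y $$ (bar n b, c) * X $$ (c, bar n a))"
      unfolding sum_distrib_left[symmetric] by (subst sum_bar[symmetric]) simp
    also have "(\<Sum>c<?N. Y $$ (bar n b, c) * X $$ (c, bar n a)) = (Y * X) $$ (bar n b, bar n a)"
      using sp_carrier[OF cX] sp_carrier[OF cY] bar_less[OF ab(1)] bar_less[OF ab(2)]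
      by (auto simp: scalar_prod_def atLeast0LessThan)
    finally show ?thesis .
  qed
  have e: "bracket X Y $$ (a, b) = (X * Y) $$ (a, b) - (Y * X) $$ (a, b)" if "a < ?N" "b < ?N" for a b
    using that cX cY by (simp add: bracket_def)
  have "bracket X Y $$ (a, b) = - sg n a * sg n b * bracket X Y $$ (bar n b, bar n a)" if ab: "a < ?N" "b < ?N" for a b
    unfolding e[OF ab] e[OF bar_less[OF ab(2)] bar_less[OF ab(1)]] XY[OF ab X Y] XY[OF ab Y X]
    by (simp add: right_diff_distrib)
  moreover have "bracket X Y \<in> carrier_mat ?N ?N"
    unfolding bracket_def using cX cY by (intro minus_carrier_mat mult_carrier_mat)
  ultimately show ?thesis
    unfolding sp_iff by blast
qed

definition sp_mat :: "nat \<Rightarrow> nat \<Rightarrow> nat \<Rightarrow> complex mat" where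
  "sp_mat n a b = mat (2 * n) (2 * n) (\<lambda>(i, j). (if i = a \<and> j = b then 1 else 0)
     - (if i = bar n b \<and> j = bar n a then sg n a * sg n b else 0))"

lemma sp_mat_carrier: "sp_mat n a b \<in> carrier_mat (2 * n) (2 * n)"
  by (simp add: sp_mat_def)

text \<open>
  The two entries of a root vector that the involution exchanges, with the coincidences of
  indices abstracted to \<open>P\<close> and \<open>Q\<close>.
\<close>

lemma swap_entry_aux:
  fixes s t A B :: complex
  assumes "A = (if P then 1 else 0) - (if Q then s else 0)" "B = (if Q then 1 else 0) - (if P then s else 0)"
    "P \<Longrightarrow> t = s" "Q \<Longrightarrow> t = s" "s * s = 1"
  shows "A = - t * B"
proof (cases "P \<or> Q")
  case True
  then have t: "t = s" using assms(3,4) by blast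
  show ?thesis
    unfolding t assms(1,2) using True assms(5) by (cases P; cases Q) (simp_all add: right_diff_distrib)
qed (simp add: assms(1,2))

lemma sp_mat_sp: assumes "a < 2 * n" "b < 2 * n" shows "sp_mat n a b \<in> sp n"
  unfolding sp_iff
proof (intro conjI allI impI)
  fix i j assume ij: "i < 2 * n" "j < 2 * n"
  \<comment> \<open>Both entries are governed by the same two conditions, in exchanged roles.\<close>
  have iff: "bar n j = a \<longleftrightarrow> j = bar n a" "bar n i = b \<longleftrightarrow> i = bar n b"
    "bar n j = bar n b \<longleftrightarrow> j = b" "bar n i = bar n a \<longleftrightarrow> i = a"
    using ij assms bar_eq_iff[of j n a] bar_eq_iff[of i n b] bar_eq_iff[of j n "bar n b"] bar_eq_iff[of i n "bar n a"]
    by (simp_all only: bar_less bar_bar)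
  show "sp_mat n a b $$ (i, j) = - sg n i * sg n j * sp_mat n a b $$ (bar n j, bar n i)"
    unfolding minus_mult_left[symmetric]
  proof (subst minus_mult_left, rule swap_entry_aux[where P = "i = a \<and> j = b" and Q = "i = bar n b \<and> j = bar n a" and s = "sg n a * sg n b"])
    show "sp_mat n a b $$ (i, j) = (if i = a \<and> j = b then 1 else 0) - (if i = bar n b \<and> j = bar n a then sg n a * sg n b else 0)"
      using ij by (simp add: sp_mat_def)
    have "sp_mat n a b $$ (bar n j, bar n i) = (if j = bar n a \<and> i = bar n b then 1 else 0) - (if j = b \<and> i = a then sg n a * sg n b else 0)"
      using ij by (simp add: sp_mat_def iff)
    then show "sp_mat n a b $$ (bar n j, bar n i) = (if i = bar n b \<and> j = bar n a then 1 else 0) - (if i = a \<and> j = b then sg n a * sg n b else 0)"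
      by (simp only: conj_commute)
    show "sg n i * sg n j = sg n a * sg n b" if "i = bar n b \<and> j = bar n a"
      using assms that by (simp add: mult.commute)
  qed (simp_all add: ac_simps)
qed (rule sp_mat_carrier)

lemma rho_sp_mat: assumes "a < 2 * n" "b < 2 * n" shows "rho n (sp_mat n a b) f = sp_op n a b f"
proof -
  have "rho n (sp_mat n a b) f = (\<Sum>i<2*n. \<Sum>j<2*n. (if j = b then (if i = a then gl_op a b f else 0) else 0)
     - (if j = bar n a then (if i = bar n b then fscale (sg n a * sg n b) (gl_op (bar n b) (bar n a) f) else 0) else 0))"
    unfolding rho_def
  proof (intro sum.cong refl)
    fix i j assume ij: "i \<in> {..<2*n}" "j \<in> {..<2*n}"
    let ?p = "if i = a \<and> j = b then 1 else 0" and ?q = "if i = bar n b \<and> j = bar n a then sg n a * sg n b else 0"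
    have "sp_mat n a b $$ (i, j) = ?p - ?q" using ij by (simp add: sp_mat_def)
    then have "fscale (sp_mat n a b $$ (i, j)) (gl_op i j f) = fscale ?p (gl_op i j f) - fscale ?q (gl_op i j f)"
      by (simp only: fs.scale_left_diff_distrib)
    moreover have "fscale ?p (gl_op i j f) = (if j = b then (if i = a then gl_op a b f else 0) else 0)" by simp
    moreover have "fscale ?q (gl_op i j f) = (if j = bar n a then (if i = bar n b then fscale (sg n a * sg n b) (gl_op (bar n b) (bar n a) f) else 0) else 0)"
      by simp
    ultimately show "fscale (sp_mat n a b $$ (i, j)) (gl_op i j f) = (if j = b then (if i = a then gl_op a b f else 0) else 0)
     - (if j = bar n a then (if i = bar n b then fscale (sg n a * sg n b) (gl_op (bar n b) (bar n a) f) else 0) else 0)"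
      by (simp only:)
  qed
  also have "\<dots> = sp_op n a b f"
    using assms by (simp add: sum_subtractf sp_op_def)
  finally show ?thesis .
qed

text \<open>
  An element of the Cartan subalgebra on which each positive root takes a positive integer
  value; its eigenvalues measure heights.
\<close>

definition height_mat :: "nat \<Rightarrow> complex mat" where
  "height_mat n = mat (2 * n) (2 * n) (\<lambda>(i, j). if i = j then of_int (ht n i) else 0)"

lemma height_mat_cartan: "height_mat n \<in> cartan n"
proof -
  have "height_mat n \<in> sp n" unfolding sp_iff by (auto simp: height_mat_def bar_eq_iff)
  then show ?thesis by (auto simp: cartan_def diagonal_mat_def height_mat_def)
qed

lemma sp_mat_cartan: "a < 2 * n \<Longrightarrow> sp_mat n a a \<in> cartan n"
  using sp_mat_sp[of a n a] by (auto simp: cartan_def diagonal_mat_def sp_mat_def)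

lemma cartan_bar: assumes "H \<in> cartan n" "c < 2 * n" shows "H $$ (bar n c, bar n c) = - H $$ (c, c)"
proof -
  have "H \<in> sp n" using assms by (simp add: cartan_def)
  then have "H $$ (bar n c, bar n c) = - sg n (bar n c) * sg n (bar n c) * H $$ (bar n (bar n c), bar n (bar n c))"
    unfolding sp_iff using bar_less[OF assms(2)] by blast
  then show ?thesis using assms(2) by simp
qed

lemma cartan_bracket:
  assumes H: "H \<in> cartan n" and ab: "a < 2 * n" "b < 2 * n"
  shows "bracket H (sp_mat n a b) = (H $$ (a, a) - H $$ (b, b)) \<cdot>\<^sub>m sp_mat n a b"
proof -
  have Hs: "H \<in> sp n" and d: "diagonal_mat H" using H by (auto simp: cartan_def)
  note cH = sp_carrier[OF Hs]
  let ?Y = "sp_mat n a b"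
  have Hd: "H $$ (i, c) = 0" if "i < 2 * n" "c < 2 * n" "i \<noteq> c" for i c
    using d cH that by (auto simp: diagonal_mat_def)
  note Hbar = cartan_bar[OF H]
  show ?thesis
  proof (rule eq_matI)
    fix i j assume "i < dim_row ((H $$ (a, a) - H $$ (b, b)) \<cdot>\<^sub>m ?Y)" "j < dim_col ((H $$ (a, a) - H $$ (b, b)) \<cdot>\<^sub>m ?Y)"
    then have ij: "i < 2 * n" "j < 2 * n" by (auto simp: sp_mat_def)
    have "(H * ?Y) $$ (i, j) = (\<Sum>c<2*n. H $$ (i, c) * ?Y $$ (c, j))"
      using cH sp_mat_carrier[of n a b] ij by (auto simp: scalar_prod_def atLeast0LessThan)
    also have "\<dots> = (\<Sum>c<2*n. if c = i then H $$ (i, i) * ?Y $$ (i, j) else 0)"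
      using ij by (intro sum.cong refl) (auto simp: Hd)
    finally have 1: "(H * ?Y) $$ (i, j) = H $$ (i, i) * ?Y $$ (i, j)" using ij by simp
    have "(?Y * H) $$ (i, j) = (\<Sum>c<2*n. ?Y $$ (i, c) * H $$ (c, j))"
      using cH sp_mat_carrier[of n a b] ij by (auto simp: scalar_prod_def atLeast0LessThan)
    also have "\<dots> = (\<Sum>c<2*n. if c = j then ?Y $$ (i, j) * H $$ (j, j) else 0)"
      using ij by (intro sum.cong refl) (auto simp: Hd)
    finally have 2: "(?Y * H) $$ (i, j) = ?Y $$ (i, j) * H $$ (j, j)" using ij by simp
    have "bracket H ?Y $$ (i, j) = (H $$ (i, i) - H $$ (j, j)) * ?Y $$ (i, j)"
      using ij cH sp_mat_carrier[of n a b] 1 2 by (simp add: bracket_def algebra_simps)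
    also have "\<dots> = (H $$ (a, a) - H $$ (b, b)) * ?Y $$ (i, j)"
    proof (cases "i = a \<and> j = b")
      case False
      show ?thesis
      proof (cases "i = bar n b \<and> j = bar n a")
        case True
        then have "H $$ (i, i) = - H $$ (b, b)" "H $$ (j, j) = - H $$ (a, a)"
          using Hbar[OF ab(1)] Hbar[OF ab(2)] by (simp_all only:)
        then show ?thesis by simp
      next
        case F: False
        have "?Y $$ (i, j) = (if i = a \<and> j = b then 1 else 0) - (if i = bar n b \<and> j = bar n a then sg n a * sg n b else 0)"
          using ij by (simp add: sp_mat_def)
        then have "?Y $$ (i, j) = 0" unfolding if_not_P[OF False] if_not_P[OF F] by simp
        then show ?thesis by simp
      qed
    qed simp
    finally show "bracket H ?Y $$ (i, j) = ((H $$ (a, a) - H $$ (b, b)) \<cdot>\<^sub>m ?Y) $$ (i, j)"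
      using ij sp_mat_carrier[of n a b] by simp
  qed (use cH sp_mat_carrier[of n a b] in \<open>auto simp: bracket_def\<close>)
qed

lemma positive_root_vector:
  assumes ab: "a < 2 * n" "b < 2 * n" and h: "ht n a > ht n b"
  shows "\<exists>\<alpha>\<in>positive_roots n. sp_mat n a b \<in> root_space n \<alpha>"
proof -
  have "\<exists>\<alpha>\<in>positive_roots n. \<forall>H\<in>cartan n. H $$ (a, a) - H $$ (b, b) = \<alpha> H"
  proof (cases "a < n")
    case a: True
    show ?thesis
    proof (cases "b < n")
      case True
      then have "a < b" using a h by (simp add: ht_def)
      with True have "(\<lambda>H. eps (a + 1) H - eps (b + 1) H) \<in> positive_roots n"
        unfolding positive_roots_def by (intro UnI1 UnI2 CollectI exI[of _ "a + 1"] exI[of _ "b + 1"]) auto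
      then show ?thesis by (rule bexI[rotated]) (simp add: eps_def)
    next
      case False
      define j where "j = b - n"
      have j: "j < n" "b = bar n j" using ab False by (auto simp: j_def bar_def)
      have H: "H $$ (b, b) = - H $$ (j, j)" if "H \<in> cartan n" for H
        using cartan_bar[OF that, of j] j by simp
      consider "a < j" | "a = j" | "j < a" by linarith
      then show ?thesis
      proof cases
        case 1
        with j have "(\<lambda>H. eps (a + 1) H + eps (j + 1) H) \<in> positive_roots n"
          unfolding positive_roots_def by (intro UnI1 CollectI exI[of _ "a + 1"] exI[of _ "j + 1"]) auto
        then show ?thesis by (rule bexI[rotated]) (simp add: eps_def H)
      next
        case 2
        with j have "(\<lambda>H. 2 * eps (a + 1) H) \<in> positive_roots n"
          unfolding positive_roots_def by (intro UnI2 CollectI exI[of _ "a + 1"]) auto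
        then show ?thesis by (rule bexI[rotated]) (simp add: eps_def H 2)
      next
        case 3
        with a have "(\<lambda>H. eps (j + 1) H + eps (a + 1) H) \<in> positive_roots n"
          unfolding positive_roots_def by (intro UnI1 CollectI exI[of _ "j + 1"] exI[of _ "a + 1"]) auto
        then show ?thesis by (rule bexI[rotated]) (simp add: eps_def H)
      qed
    qed
  next
    case a: False
    then have b: "\<not> b < n" using h ab by (auto simp: ht_def)
    define i j where "i = a - n" and "j = b - n"
    have ij: "i < n" "a = bar n i" "j < n" "b = bar n j" using ab a b by (auto simp: i_def j_def bar_def)
    then have "j < i" using h by simp (simp add: ht_def)
    with ij have "(\<lambda>H. eps (j + 1) H - eps (i + 1) H) \<in> positive_roots n"
      unfolding positive_roots_def by (intro UnI1 UnI2 CollectI exI[of _ "j + 1"] exI[of _ "i + 1"]) auto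
    moreover have "H $$ (b, b) = - H $$ (j, j)" "H $$ (a, a) = - H $$ (i, i)" if "H \<in> cartan n" for H
      using cartan_bar[OF that] ij by simp_all
    ultimately show ?thesis by (intro bexI[of _ "\<lambda>H. eps (j + 1) H - eps (i + 1) H"]) (simp_all add: eps_def)
  qed
  then obtain \<alpha> where \<alpha>: "\<alpha> \<in> positive_roots n" "\<And>H. H \<in> cartan n \<Longrightarrow> H $$ (a, a) - H $$ (b, b) = \<alpha> H" by blast
  then have "sp_mat n a b \<in> root_space n \<alpha>"
    unfolding root_space_def using sp_mat_sp[OF ab] cartan_bracket[OF _ ab] by auto
  with \<alpha> show ?thesis by blast
qed

text \<open>
  Averaging over the involution writes every element of the Lie algebra in terms of the
  spanning root vectors; the same is done below for an abstract representation.
\<close>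

lemma sp_decomp: assumes X: "X \<in> sp n" shows "rho n X f = (\<Sum>a<2*n. \<Sum>b<2*n. fscale (X $$ (a, b) / 2) (sp_op n a b f))"
proof -
  have "(\<Sum>a<2*n. \<Sum>b<2*n. fscale (X $$ (a, b) / 2) (sp_op n a b f)) =
     (\<Sum>a<2*n. \<Sum>b<2*n. fscale (X $$ (a, b) / 2) (gl_op a b f)) -
     (\<Sum>a<2*n. \<Sum>b<2*n. fscale (X $$ (a, b) / 2 * (sg n a * sg n b)) (gl_op (bar n b) (bar n a) f))"
    by (simp only: sp_op_def fs.scale_right_diff_distrib fs.scale_scale sum_subtractf)
  also have "(\<Sum>a<2*n. \<Sum>b<2*n. fscale (X $$ (a, b) / 2 * (sg n a * sg n b)) (gl_op (bar n b) (bar n a) f)) =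
     (\<Sum>a<2*n. \<Sum>b<2*n. fscale (- X $$ (bar n b, bar n a) / 2) (gl_op (bar n b) (bar n a) f))"
  proof (intro sum.cong refl)
    fix a b assume ab: "a \<in> {..<2*n}" "b \<in> {..<2*n}"
    have "X $$ (a, b) = - sg n a * sg n b * X $$ (bar n b, bar n a)"
      using sp_entry[OF X, of a b] ab by simp
    then have "X $$ (a, b) / 2 * (sg n a * sg n b) = - (sg n a * (sg n a * (sg n b * (sg n b * X $$ (bar n b, bar n a))))) / 2"
      by (simp only:) (simp add: ac_simps)
    then show "fscale (X $$ (a, b) / 2 * (sg n a * sg n b)) (gl_op (bar n b) (bar n a) f) =
        fscale (- X $$ (bar n b, bar n a) / 2) (gl_op (bar n b) (bar n a) f)"
      by (simp only: sg_sg2)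
  qed
  also have "\<dots> = (\<Sum>a<2*n. \<Sum>b<2*n. fscale (- X $$ (b, bar n a) / 2) (gl_op b (bar n a) f))"
    by (rule sum.cong[OF refl], rule sum_bar[of "\<lambda>b. fscale (- X $$ (b, bar n a) / 2) (gl_op b (bar n a) f)" for a])
  also have "\<dots> = (\<Sum>a<2*n. \<Sum>b<2*n. fscale (- X $$ (b, a) / 2) (gl_op b a f))"
    by (rule sum_bar[of "\<lambda>a. \<Sum>b<2*n. fscale (- X $$ (b, a) / 2) (gl_op b a f)"])
  also have "\<dots> = - (\<Sum>a<2*n. \<Sum>b<2*n. fscale (X $$ (a, b) / 2) (gl_op a b f))"
    by (subst sum.swap) (simp add: sum_negf)
  finally show ?thesis
    by (simp add: rho_def sum.distrib[symmetric] fs.scale_left_distrib[symmetric])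
qed

context sp_rep begin

lemma rep_zero: assumes "X \<in> sp n" shows "\<pi> (0 \<cdot>\<^sub>m X) v = 0"
  using rep_smult[OF assms, of 0 v] by simp

text \<open>
  Finite sums of matrices of a given size are built entry by entry, since matrices of all
  sizes share one type.
\<close>

lemma rep_decomp:
  assumes X: "X \<in> sp n"
  shows "\<pi> X v = (\<Sum>(a, b)\<in>{..<2*n}\<times>{..<2*n}. scale (X $$ (a, b) / 2) (\<pi> (sp_mat n a b) v))"
proof -
  define M where "M S = mat (2 * n) (2 * n) (\<lambda>(i, j). \<Sum>(a, b)\<in>S. X $$ (a, b) / 2 * sp_mat n a b $$ (i, j))" for S
  have M: "M S \<in> sp n \<and> \<pi> (M S) v = (\<Sum>(a, b)\<in>S. scale (X $$ (a, b) / 2) (\<pi> (sp_mat n a b) v))"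
    if "S \<subseteq> {..<2*n}\<times>{..<2*n}" "finite S" for S
    using that(2,1)
  proof (induction S rule: finite_induct)
    case empty
    have "M {} = 0 \<cdot>\<^sub>m X" unfolding M_def using sp_carrier[OF X] by (intro eq_matI) auto
    then show ?case using sp_smult[OF X] rep_zero[OF X] by simp
  next
    case (insert p S)
    obtain a b where p: "p = (a, b)" "a < 2 * n" "b < 2 * n" using insert.prems by (cases p) auto
    let ?Z = "(X $$ (a, b) / 2) \<cdot>\<^sub>m sp_mat n a b"
    have "M (insert p S) = ?Z + M S"
      unfolding M_def using insert.hyps p by (intro eq_matI) (auto simp: sp_mat_def)
    moreover have "?Z \<in> sp n" using sp_mat_sp[OF p(2,3)] by (rule sp_smult)
    moreover have "\<pi> ?Z v = scale (X $$ (a, b) / 2) (\<pi> (sp_mat n a b) v)"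
      by (rule rep_smult[OF sp_mat_sp[OF p(2,3)]])
    ultimately show ?case using insert p sp_add rep_add[of ?Z "M S" v] by auto
  qed
  have "M ({..<2*n}\<times>{..<2*n}) = X"
  proof (rule eq_matI)
    fix i j assume "i < dim_row X" "j < dim_col X"
    then have ij: "i < 2 * n" "j < 2 * n" using sp_carrier[OF X] by auto
    have "M ({..<2*n}\<times>{..<2*n}) $$ (i, j) = (\<Sum>a<2*n. \<Sum>b<2*n. X $$ (a, b) / 2 * sp_mat n a b $$ (i, j))"
      using ij by (simp add: M_def sum.cartesian_product)
    also have "\<dots> = (\<Sum>a<2*n. \<Sum>b<2*n. (if b = j then (if a = i then X $$ (i, j) / 2 else 0) else 0)
        - (if b = bar n i then (if a = bar n j then X $$ (a, b) / 2 * (sg n a * sg n b) else 0) else 0))"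
    proof (intro sum.cong refl)
      fix a b assume ab: "a \<in> {..<2*n}" "b \<in> {..<2*n}"
      let ?p = "if i = a \<and> j = b then 1 else 0" and ?q = "if i = bar n b \<and> j = bar n a then sg n a * sg n b else 0"
      have "X $$ (a, b) / 2 * sp_mat n a b $$ (i, j) = X $$ (a, b) / 2 * ?p - X $$ (a, b) / 2 * ?q"
        using ij by (simp add: sp_mat_def right_diff_distrib)
      moreover have "X $$ (a, b) / 2 * ?p = (if b = j then (if a = i then X $$ (i, j) / 2 else 0) else 0)" by simp
      moreover have "i = bar n b \<longleftrightarrow> b = bar n i" "j = bar n a \<longleftrightarrow> a = bar n j"
        using ij ab bar_eq_iff[of b n i] bar_eq_iff[of a n j] by (metis lessThan_iff)+
      then have "X $$ (a, b) / 2 * ?q = (if b = bar n i then (if a = bar n j then X $$ (a, b) / 2 * (sg n a * sg n b) else 0) else 0)"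
        by simp
      ultimately show "X $$ (a, b) / 2 * sp_mat n a b $$ (i, j) = (if b = j then (if a = i then X $$ (i, j) / 2 else 0) else 0)
        - (if b = bar n i then (if a = bar n j then X $$ (a, b) / 2 * (sg n a * sg n b) else 0) else 0)"
        by (simp only:)
    qed
    also have "\<dots> = X $$ (i, j) / 2 - X $$ (bar n j, bar n i) / 2 * (sg n j * sg n i)"
      using ij by (simp add: sum_subtractf)
    also have "X $$ (bar n j, bar n i) = - sg n j * sg n i * X $$ (i, j)"
      using sp_entry[OF X, of "bar n j" "bar n i"] ij by simp
    finally show "M ({..<2*n}\<times>{..<2*n}) $$ (i, j) = X $$ (i, j)"
      by (simp add: ac_simps)
  qed (use sp_carrier[OF X] in \<open>auto simp: M_def\<close>)
  then show ?thesis using M[of "{..<2*n}\<times>{..<2*n}"] by simp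
qed

end

section \<open>Irreducibility of the model\<close>

text \<open>
  For $k \ge l$ this is the irreducible representation with highest weight $k\varepsilon_1 +
  l\varepsilon_2$; it is invariant because both operators commute with the symplectic Lie
  algebra.
\<close>

definition model :: "nat \<Rightarrow> nat \<Rightarrow> nat \<Rightarrow> poly2 set" where
  "model n k l = {f. bideg n (int k) (int l) f \<and> up_op n f = 0 \<and> omega_diff n f = 0}"

lemma subspace_model: "fs.subspace (model n k l)"
  unfolding fs.subspace_def model_def by (simp add: bideg_add bideg_scale up_op_lin omega_diff_lin)

lemma model_sp_op: "f \<in> model n k l \<Longrightarrow> a < 2 * n \<Longrightarrow> b < 2 * n \<Longrightarrow> sp_op n a b f \<in> model n k l"
  unfolding model_def by (simp add: bideg_sp_op up_op_sp_op sp_op_omega_diff[symmetric] sp_op_lin)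

definition mono_vec :: "(bool \<times> nat \<Rightarrow> nat) \<Rightarrow> poly2" where "mono_vec m = (\<lambda>m'. if m' = m then 1 else 0)"

lemma supp_span:
  assumes "finite M" "\<And>m. f m \<noteq> 0 \<Longrightarrow> m \<in> M" shows "f \<in> fs.span (mono_vec ` M)"
proof -
  have "f = (\<Sum>m\<in>M. fscale (f m) (mono_vec m))"
  proof (rule ext)
    fix x
    have "(\<Sum>m\<in>M. fscale (f m) (mono_vec m)) x = (\<Sum>m\<in>M. if m = x then f x else 0)"
      unfolding sum_apply by (intro sum.cong) (auto simp: fscale_apply mono_vec_def)
    also have "\<dots> = f x" using assms by auto
    finally show "f x = (\<Sum>m\<in>M. fscale (f m) (mono_vec m)) x" by simp
  qed
  moreover have "(\<Sum>m\<in>M. fscale (f m) (mono_vec m)) \<in> fs.span (mono_vec ` M)"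
    by (intro fs.span_sum fs.span_scale fs.span_base imageI)
  ultimately show ?thesis by metis
qed

lemma bideg_span: "bideg n k l f \<Longrightarrow> f \<in> fs.span (mono_vec ` deg_monos n (nat (k + l)))"
  by (rule supp_span) (auto intro: bideg_deg_monos)

definition height :: "nat \<Rightarrow> (bool \<times> nat \<Rightarrow> nat) \<Rightarrow> int" where
  "height n m = (\<Sum>v\<in>vars n. ht n (snd v) * int (m v))"

text \<open>
  Root vectors of positive roots strictly increase the height of every monomial, and the
  heights of monomials of bounded degree are bounded.
\<close>

definition height_ge :: "nat \<Rightarrow> int \<Rightarrow> poly2 \<Rightarrow> bool" where
  "height_ge n t f \<longleftrightarrow> (\<forall>m. f m \<noteq> 0 \<longrightarrow> t \<le> height n m)"

lemma height_upd: assumes "v \<in> vars n" shows "height n (m(v := m v + 1)) = height n m + ht n (snd v)"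
proof -
  have "height n (m(v := m v + 1)) = (\<Sum>u\<in>vars n. ht n (snd u) * int (m u) + (if u = v then ht n (snd v) else 0))"
    unfolding height_def by (intro sum.cong) (auto simp: algebra_simps)
  then show ?thesis using assms by (simp add: sum.distrib height_def)
qed

lemma height_ge_cr: assumes "height_ge n t f" "a < 2 * n" shows "height_ge n (t + ht n a) (cr (s, a) f)"
  unfolding height_ge_def
proof (intro allI impI)
  fix m assume *: "cr (s, a) f m \<noteq> 0"
  let ?m = "m((s, a) := m (s, a) - 1)"
  have 1: "m (s, a) \<noteq> 0" "f ?m \<noteq> 0" using * by (auto simp: cr_def split: if_splits)
  have "?m((s, a) := ?m (s, a) + 1) = m" using 1 by auto
  then have "height n m = height n ?m + ht n a" using height_upd[of "(s, a)" n ?m] assms(2) by simp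
  then show "t + ht n a \<le> height n m" using 1(2) assms(1) unfolding height_ge_def by fastforce
qed

lemma height_ge_an: assumes "height_ge n t f" "a < 2 * n" shows "height_ge n (t - ht n a) (an (s, a) f)"
  unfolding height_ge_def
proof (intro allI impI)
  fix m assume *: "an (s, a) f m \<noteq> 0"
  let ?m = "m((s, a) := m (s, a) + 1)"
  have "f ?m \<noteq> 0" using * by (auto simp: an_def)
  then have "t \<le> height n ?m" using assms(1) unfolding height_ge_def by blast
  then show "t - ht n a \<le> height n m" using height_upd[of "(s, a)" n m] assms(2) by simp
qed

lemma height_ge_add: "height_ge n t f \<Longrightarrow> height_ge n t g \<Longrightarrow> height_ge n t (f + g)"
  unfolding height_ge_def by (metis add.right_neutral plus_fun_apply)
lemma height_ge_scale: "height_ge n t f \<Longrightarrow> height_ge n t (fscale c f)"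
  unfolding height_ge_def by (auto simp: fscale_apply)
lemma height_ge_mono: "height_ge n t f \<Longrightarrow> t' \<le> t \<Longrightarrow> height_ge n t' f"
  unfolding height_ge_def by force

lemma height_ge_gl_op: "height_ge n t f \<Longrightarrow> a < 2 * n \<Longrightarrow> b < 2 * n \<Longrightarrow> height_ge n (t + (ht n a - ht n b)) (gl_op a b f)"
  unfolding gl_op_def using height_ge_cr[OF height_ge_an, of n t f b a] by (intro height_ge_add) (simp_all add: algebra_simps)

lemma height_ge_sp_op:
  assumes "height_ge n t f" "a < 2 * n" "b < 2 * n" "ht n b < ht n a" shows "height_ge n (t + 1) (sp_op n a b f)"
proof -
  have "height_ge n (t + (ht n a - ht n b)) (sp_op n a b f)"
    using height_ge_add[OF height_ge_gl_op[OF assms(1-3)] height_ge_scale[of _ _ _ "- (sg n a * sg n b)"]]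
      height_ge_gl_op[OF assms(1) bar_less[OF assms(3)] bar_less[OF assms(2)]] assms(2,3)
    by (simp add: sp_op_def fs.scale_minus_left algebra_simps)
  then show ?thesis by (rule height_ge_mono) (use assms in simp)
qed

lemma height_bound: assumes "m \<in> deg_monos n d" shows "\<bar>height n m\<bar> \<le> int n * int d"
proof -
  have "\<bar>height n m\<bar> \<le> (\<Sum>v\<in>vars n. \<bar>ht n (snd v) * int (m v)\<bar>)" unfolding height_def by (rule sum_abs)
  also have "\<dots> \<le> (\<Sum>v\<in>vars n. int n * int (m v))"
  proof (intro sum_mono)
    fix v assume v: "v \<in> vars n"
    have "\<bar>ht n (snd v)\<bar> \<le> int n" using v by (auto simp: vars_def ht_def)
    then show "\<bar>ht n (snd v) * int (m v)\<bar> \<le> int n * int (m v)"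
      by (simp add: abs_mult mult_right_mono)
  qed
  also have "\<dots> = int n * int d" using assms by (simp add: deg_monos_def sum_distrib_left[symmetric] of_nat_sum[symmetric] del: of_nat_sum)
  finally show ?thesis .
qed

text \<open>
  Otherwise a nonzero vector of the subspace could be raised again and again without ever
  becoming zero: a vector that all positive root vectors annihilate is a multiple of
  \<open>hw_vec\<close>.
\<close>

lemma model_contains_hw:
  assumes n: "n \<ge> 2" and U: "fs.subspace U" "U \<subseteq> model n (a + l) l" "U \<noteq> {0}"
    and stable: "\<And>f b c. f \<in> U \<Longrightarrow> b < 2 * n \<Longrightarrow> c < 2 * n \<Longrightarrow> sp_op n b c f \<in> U"
  shows "hw_vec a l \<in> U"
proof (rule ccontr)
  assume w: "hw_vec a l \<notin> U"
  let ?d = "nat (int (a + l) + int l)"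
  have step: "\<exists>g\<in>U. g \<noteq> 0 \<and> height_ge n (t + 1) g" if f: "f \<in> U" "f \<noteq> 0" "height_ge n t f" for f t
  proof (rule ccontr)
    assume no: "\<not> (\<exists>g\<in>U. g \<noteq> 0 \<and> height_ge n (t + 1) g)"
    have "sp_op n b c f = 0" if "b < 2 * n" "c < 2 * n" "ht n c < ht n b" for b c
      using no stable[OF f(1) that(1,2)] height_ge_sp_op[OF f(3) that] by blast
    then have "hw_poly n (a + l) l f" and "omega_diff n f = 0" using f(1) U(2) by (auto simp: hw_poly_def model_def)
    then obtain c where c: "f = fscale c (hw_vec a l)" using hw_poly_in_model[OF n] by blast
    then have "c \<noteq> 0" using f(2) by auto
    have "fscale (1 / c) f \<in> U" using U(1) f(1) by (rule fs.subspace_scale)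
    then show False using w c \<open>c \<noteq> 0\<close> by simp
  qed
  obtain f0 where f0: "f0 \<in> U" "f0 \<noteq> 0" using U(1,3) fs.subspace_0 by blast
  have deg_monos: "m \<in> deg_monos n ?d" if "f \<in> U" "f m \<noteq> 0" for f m
    using bideg_deg_monos[of n "int (a + l)" "int l" f m] that U(2) by (auto simp: model_def)
  let ?B = "int n * int ?d"
  have "height_ge n (- ?B) f0" unfolding height_ge_def using height_bound[OF deg_monos[OF f0(1)]] by fastforce
  then have ex: "\<exists>f\<in>U. f \<noteq> 0 \<and> height_ge n (- ?B + int j) f" for j
  proof (induction j)
    case (Suc j)
    then obtain f where "f \<in> U" "f \<noteq> 0" "height_ge n (- ?B + int j) f" by blast
    from step[OF this] show ?case by (simp add: algebra_simps)
  qed (use f0 in auto)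
  obtain f where f: "f \<in> U" "f \<noteq> 0" "height_ge n (- ?B + int (nat (2 * ?B + 1))) f" using ex by blast
  obtain m where m: "f m \<noteq> 0" using f(2) by (metis ext zero_fun_apply)
  have "?B \<ge> 0" by simp
  then have "?B + 1 \<le> height n m" using f(3) m unfolding height_ge_def by fastforce
  then show False using height_bound[OF deg_monos[OF f(1) m]] by linarith
qed

text \<open>
  The orthogonal complement of an invariant subspace is invariant, because transposed root
  vectors are adjoint. It meets the line of highest weight vectors trivially, so it is zero.
\<close>

lemma model_generated:
  assumes n: "n \<ge> 2" and U: "fs.subspace U" "U \<subseteq> model n (a + l) l" "hw_vec a l \<in> U"
    and stable: "\<And>f b c. f \<in> U \<Longrightarrow> b < 2 * n \<Longrightarrow> c < 2 * n \<Longrightarrow> sp_op n b c f \<in> U"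
  shows "U = model n (a + l) l"
proof (rule antisym[OF U(2)], rule subsetI, rule ccontr)
  fix f assume f: "f \<in> model n (a + l) l" "f \<notin> U"
  let ?k = "int (a + l)" and ?l = "int l"
  let ?d = "nat (?k + ?l)"
  have "U \<subseteq> fs.span (mono_vec ` deg_monos n ?d)"
  proof
    fix x assume "x \<in> U"
    then have "bideg n ?k ?l x" using U(2) unfolding model_def by blast
    then show "x \<in> fs.span (mono_vec ` deg_monos n ?d)" by (rule bideg_span)
  qed
  then obtain B where B: "finite B" "fs.span B = U" "B \<subseteq> U"
    using fs.finite_dim_subspace[OF U(1), of "mono_vec ` deg_monos n ?d"] by (metis finite_deg_monos finite_imageI)
  have "\<exists>u\<in>fs.span B. bideg n ?k ?l u \<and> (\<forall>b\<in>fs.span B. fischer n ?d b (f - u) = 0)"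
    using B U(2) f(1) by (intro orth_proj) (auto simp: model_def)
  then obtain u where u: "u \<in> U" "\<And>b. b \<in> U \<Longrightarrow> fischer n ?d b (f - u) = 0" using B by auto
  \<comment> \<open>the orthogonal complement of the invariant subspace within the model\<close>
  define P where "P = {g \<in> model n (a + l) l. \<forall>b\<in>U. fischer n ?d b g = 0}"
  have "fs.subspace P"
    using subspace_model[of n "a + l" l] unfolding fs.subspace_def P_def by (auto simp: fischer_lin)
  moreover have "f - u \<in> P"
    unfolding P_def using f(1) u U(2) fs.subspace_diff[OF subspace_model[of n "a + l" l]] by auto
  then have "P \<noteq> {0}" using f(2) u(1) by auto
  moreover have "sp_op n b c g \<in> P" if "g \<in> P" "b < 2 * n" "c < 2 * n" for g b c
  proof -
    have g: "g \<in> model n (a + l) l" "\<And>x. x \<in> U \<Longrightarrow> fischer n ?d x g = 0" using that(1) by (auto simp: P_def)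
    have "fischer n ?d x (sp_op n b c g) = 0" if "x \<in> U" for x
      using fischer_sp_op[OF \<open>c < 2 * n\<close> \<open>b < 2 * n\<close>, of ?d x g] g(2)[OF stable[OF that \<open>c < 2 * n\<close> \<open>b < 2 * n\<close>]]
      by (simp only:)
    then show ?thesis unfolding P_def using model_sp_op[OF g(1) that(2,3)] by blast
  qed
  ultimately have "hw_vec a l \<in> P"
    by (intro model_contains_hw[OF n]) (auto simp: P_def)
  then have "fischer n ?d (hw_vec a l) (hw_vec a l) = 0" using U(3) unfolding P_def by blast
  then have "hw_vec a l = 0" by (rule fischer_definite[OF bideg_hw_vec[OF n]])
  then show False using hw_vec_nonzero by blast
qed

lemma rho_cartan: assumes "H \<in> cartan n" shows "rho n H f = (\<Sum>a<2*n. fscale (H $$ (a, a)) (gl_op a a f))"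
proof -
  have d: "diagonal_mat H" "H \<in> carrier_mat (2 * n) (2 * n)" using assms by (auto simp: cartan_def sp_carrier)
  have z: "H $$ (a, b) = 0" if "a < 2 * n" "b < 2 * n" "a \<noteq> b" for a b
    using d that by (auto simp: diagonal_mat_def)
  have "(\<Sum>b<2*n. fscale (H $$ (a, b)) (gl_op a b f)) = fscale (H $$ (a, a)) (gl_op a a f)" if "a < 2 * n" for a
  proof -
    have "(\<Sum>b<2*n. fscale (H $$ (a, b)) (gl_op a b f)) = (\<Sum>b\<in>{a}. fscale (H $$ (a, b)) (gl_op a b f))"
      using that z[OF that] by (intro sum.mono_neutral_right) auto
    then show ?thesis by simp
  qed
  then show ?thesis unfolding rho_def by (intro sum.cong) auto
qed

lemma rho_cartan_cr:
  assumes "H \<in> cartan n" "c < 2 * n"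
  shows "rho n H (cr (s, c) f) = cr (s, c) (rho n H f) + fscale (H $$ (c, c)) (cr (s, c) f)"
proof -
  have "fscale (H $$ (a, a)) (gl_op a a (cr (s, c) f)) = cr (s, c) (fscale (H $$ (a, a)) (gl_op a a f))
      + (if a = c then fscale (H $$ (c, c)) (cr (s, c) f) else 0)" for a
    by (auto simp: gl_op_cr cr_lin fs.scale_right_distrib)
  then show ?thesis using assms by (simp add: rho_cartan sum.distrib cr_lin)
qed

lemma rho_hw_vec:
  assumes n: "n \<ge> 2" and H: "H \<in> cartan n"
  shows "rho n H (hw_vec a l) = fscale (of_nat (a + l) * eps 1 H + of_nat l * eps 2 H) (hw_vec a l)"
proof (induction l)
  case 0
  show ?case
  proof (induction a)
    case 0
    show ?case by (simp add: rho_cartan[OF H] gl_op_def an_vac cr_lin)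
  next
    case (Suc a)
    have "rho n H (hw_vec (Suc a) 0) = cr (False, 0) (rho n H (hw_vec a 0)) + fscale (H $$ (0, 0)) (hw_vec (Suc a) 0)"
      using rho_cartan_cr[OF H, of 0 False "hw_vec a 0"] n by simp
    then show ?case unfolding Suc.IH by (simp add: cr_lin eps_def fs.scale_left_distrib algebra_simps)
  qed
next
  case (Suc l)
  have "rho n H (minor_mul f) = minor_mul (rho n H f) + fscale (H $$ (0, 0) + H $$ (1, 1)) (minor_mul f)" for f
    using n by (simp add: minor_mul_def rho_lin rho_cartan_cr[OF H] cr_lin fs.scale_left_distrib
        fs.scale_right_distrib fs.scale_right_diff_distrib algebra_simps)
  then have "rho n H (hw_vec a (Suc l)) = minor_mul (rho n H (hw_vec a l)) + fscale (H $$ (0, 0) + H $$ (1, 1)) (hw_vec a (Suc l))"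
    by simp
  then show ?case unfolding Suc.IH by (simp add: minor_mul_lin eps_def fs.scale_left_distrib algebra_simps)
qed

section \<open>Eigenvalues below a given one\<close>

text \<open>The operator $(T - (c-1)) (T - (c-2)) \cdots (T - (c-M))$.\<close>

primrec kill_op :: "(complex \<Rightarrow> 'v \<Rightarrow> 'v) \<Rightarrow> ('v \<Rightarrow> 'v) \<Rightarrow> complex \<Rightarrow> nat \<Rightarrow> 'v \<Rightarrow> 'v::ab_group_add" where
  "kill_op s T c 0 u = u"
| "kill_op s T c (Suc M) u = T (kill_op s T c M u) - s (c - of_nat (Suc M)) (kill_op s T c M u)"

definition lower_eigen :: "(complex \<Rightarrow> 'v \<Rightarrow> 'v) \<Rightarrow> ('v \<Rightarrow> 'v) \<Rightarrow> complex \<Rightarrow> 'v::ab_group_add set" where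
  "lower_eigen s T c = {x. \<exists>j\<ge>1. T x = s (c - of_nat j) x}"

context
  fixes s :: "complex \<Rightarrow> 'v \<Rightarrow> 'v::ab_group_add" and T :: "'v \<Rightarrow> 'v"
  assumes lin: "Vector_Spaces.linear s s T"
begin

interpretation T: Vector_Spaces.linear s s T by (rule lin)

lemma kill_op_eigen:
  assumes "T x = s (c - of_nat j) x"
  shows "kill_op s T c M x = s (\<Prod>i<M. of_nat (Suc i) - of_nat j) x"
proof (induction M)
  case 0
  show ?case by simp
next
  case (Suc M)
  have "kill_op s T c (Suc M) x = s ((\<Prod>i<M. of_nat (Suc i) - of_nat j) * (c - of_nat j) - (c - of_nat (Suc M)) * (\<Prod>i<M. of_nat (Suc i) - of_nat j)) x"
    unfolding T.vs1.scale_left_diff_distrib[of "_ * _"]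
    by (simp only: kill_op.simps Suc.IH T.scale assms T.vs1.scale_scale)
  also have "(\<Prod>i<M. of_nat (Suc i) - of_nat j) * (c - of_nat j) - (c - of_nat (Suc M)) * (\<Prod>i<M. of_nat (Suc i) - of_nat j)
      = (\<Prod>i<Suc M. of_nat (Suc i) - of_nat j)"
    unfolding prod.lessThan_Suc by (simp only: algebra_simps)
  finally show ?case .
qed

text \<open>
  A sum of eigenvectors for eigenvalues $c - j$ with $j \ge 1$ is annihilated by
  \<open>kill_op\<close> for all large $M$, while an eigenvector for $c$ is only multiplied
  by $M!$.
\<close>

lemma lower_eigen_independent:
  assumes u: "u \<in> T.vs1.span (lower_eigen s T c)" and e: "T u = s c u" shows "u = 0"
proof -
  let ?K = "kill_op s T c"
  have add: "?K M (x + y) = ?K M x + ?K M y" for M x y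
    by (induction M) (simp_all add: T.add T.vs1.scale_right_distrib)
  have scl: "?K M (s a x) = s a (?K M x)" for M a x
    by (induction M) (simp_all add: T.scale T.vs1.scale_right_diff_distrib mult.commute)
  have "\<exists>N. \<forall>M\<ge>N. ?K M u = 0"
    using u
  proof (induction rule: T.vs1.span_induct)
    case base
    show ?case
    proof (rule T.vs1.subspaceI)
      show "0 \<in> {x. \<exists>N. \<forall>M\<ge>N. ?K M x = 0}" using scl[of _ 0 0] by simp
      show "x + y \<in> {x. \<exists>N. \<forall>M\<ge>N. ?K M x = 0}" if xy: "x \<in> {x. \<exists>N. \<forall>M\<ge>N. ?K M x = 0}" "y \<in> {x. \<exists>N. \<forall>M\<ge>N. ?K M x = 0}" for x y
      proof -
        obtain N1 N2 where "\<forall>M\<ge>N1. ?K M x = 0" "\<forall>M\<ge>N2. ?K M y = 0" using xy by blast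
        then have "\<forall>M\<ge>max N1 N2. ?K M (x + y) = 0" by (simp add: add)
        then show ?thesis by blast
      qed
      show "s a x \<in> {x. \<exists>N. \<forall>M\<ge>N. ?K M x = 0}" if "x \<in> {x. \<exists>N. \<forall>M\<ge>N. ?K M x = 0}" for x a
        using that by (auto simp: scl)
    qed
  next
    case (step x)
    then obtain j where j: "j \<ge> 1" "T x = s (c - of_nat j) x" by (auto simp: lower_eigen_def)
    have "?K M x = 0" if "M \<ge> j" for M
    proof -
      have "(\<Prod>i<M. of_nat (Suc i) - of_nat j :: complex) = 0"
        using j(1) that by (intro prod_zero bexI[of _ "j - 1"]) auto
      then show ?thesis by (simp add: kill_op_eigen[OF j(2)])
    qed
    then show ?case by blast
  qed
  then obtain N where "?K N u = 0" by blast
  moreover have "?K N u = s (\<Prod>i<N. of_nat (Suc i)) u"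
    using kill_op_eigen[of u c 0 N] e by simp
  moreover have "(\<Prod>i<N. of_nat (Suc i)) \<noteq> (0 :: complex)" by (simp del: of_nat_Suc)
  ultimately show ?thesis by (simp add: T.vs1.scale_eq_0_iff)
qed

text \<open>A negative root vector shifts eigenvalues down by a positive integer.\<close>

lemma lower_eigen_step:
  assumes Y: "Vector_Spaces.linear s s Y" and m: "m \<ge> 1"
    and comm: "\<And>x. T (Y x) = Y (T x) - s (of_nat m) (Y x)"
    and u: "u \<in> T.vs1.span (insert z (lower_eigen s T c))" and z: "T z = s c z"
  shows "Y u \<in> T.vs1.span (lower_eigen s T c)"
proof -
  interpret Y: Vector_Spaces.linear s s Y by (rule Y)
  have gen: "Y x \<in> lower_eigen s T c" if "T x = s (c - of_nat j) x" for x j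
  proof -
    have "T (Y x) = s (c - of_nat (j + m)) (Y x)"
      unfolding comm that Y.scale T.vs1.scale_left_diff_distrib[symmetric] of_nat_add diff_diff_add ..
    then show ?thesis using m unfolding lower_eigen_def by (intro CollectI exI[of _ "j + m"]) auto
  qed
  have "Y ` insert z (lower_eigen s T c) \<subseteq> lower_eigen s T c"
    using gen[of z 0] gen z by (auto simp: lower_eigen_def)
  moreover have "Y u \<in> T.vs1.span (Y ` insert z (lower_eigen s T c))"
    using u Y.span_image[of "insert z (lower_eigen s T c)"] by blast
  ultimately show ?thesis using T.vs1.span_mono by blast
qed

end

section \<open>The model is isomorphic to the given representation\<close>

lemma rho_sp_op_height_mat:
  assumes "a < 2 * n" "b < 2 * n"
  shows "rho n (height_mat n) (sp_op n a b f) = sp_op n a b (rho n (height_mat n) f) - fscale (of_int (ht n b - ht n a)) (sp_op n a b f)"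
proof -
  have "bracket (height_mat n) (sp_mat n a b) = of_int (ht n a - ht n b) \<cdot>\<^sub>m sp_mat n a b"
    using cartan_bracket[OF height_mat_cartan assms] assms by (simp add: height_mat_def)
  then have 1: "rho n (of_int (ht n a - ht n b) \<cdot>\<^sub>m sp_mat n a b) f = rho n (height_mat n) (sp_op n a b f) - sp_op n a b (rho n (height_mat n) f)"
    using rho_bracket[of "height_mat n" n "sp_mat n a b" f] assms
    by (simp add: rho_sp_mat sp_mat_carrier height_mat_def)
  have 2: "rho n (of_int (ht n a - ht n b) \<cdot>\<^sub>m sp_mat n a b) f = fscale (of_int (ht n a - ht n b)) (sp_op n a b f)"
    using assms by (simp add: rho_sp_mat[symmetric]) (simp add: rho_def sp_mat_def fs.scale_sum_right)
  have "rho n (height_mat n) (sp_op n a b f) m - sp_op n a b (rho n (height_mat n) f) m = of_int (ht n a - ht n b) * sp_op n a b f m" for m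
    using fun_cong[OF 1, of m] unfolding 2 by (simp only: pointwise)
  then show ?thesis by (simp add: pointwise algebra_simps)
qed

context sp_rep begin

text \<open>
  The subspace of the direct sum of a representation and of the polynomials that is
  generated from the pair of highest weight vectors by negative root vectors only. Being a
  relation, it needs no type for the direct sum.
\<close>

inductive linked :: "'v \<Rightarrow> poly2 \<Rightarrow> 'v \<Rightarrow> poly2 \<Rightarrow> bool" for v w where
  base: "linked v w v w"
| add: "linked v w u u' \<Longrightarrow> linked v w x x' \<Longrightarrow> linked v w (u + x) (u' + x')"
| scal: "linked v w u u' \<Longrightarrow> linked v w (scale c u) (fscale c u')"
| low: "linked v w u u' \<Longrightarrow> a < 2 * n \<Longrightarrow> b < 2 * n \<Longrightarrow> ht n a < ht n b \<Longrightarrow>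
    linked v w (\<pi> (sp_mat n a b) u) (sp_op n a b u')"

lemma linked_0: "linked v w 0 0"
  using linked.scal[OF linked.base, of v w 0] by simp

lemma linked_sum: "finite A \<Longrightarrow> (\<And>p. p \<in> A \<Longrightarrow> linked v w (f p) (g p)) \<Longrightarrow> linked v w (\<Sum>p\<in>A. f p) (\<Sum>p\<in>A. g p)"
  by (induction A rule: finite_induct) (auto intro: linked_0 linked.add)

lemma linked_diff: assumes "linked v w u u'" "linked v w x x'" shows "linked v w (u - x) (u' - x')"
  using linked.add[OF assms(1) linked.scal[OF assms(2), of "-1"]]
  by (simp add: scale_minus_left fs.scale_minus_left)

lemma ht_inj: "a < 2 * n \<Longrightarrow> b < 2 * n \<Longrightarrow> ht n a = ht n b \<Longrightarrow> a = b"
  by (auto simp: ht_def split: if_splits)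

lemma rep_lin:
  assumes "X \<in> sp n"
  shows "\<pi> X (u + x) = \<pi> X u + \<pi> X x" "\<pi> X (scale c u) = scale c (\<pi> X u)" "\<pi> X 0 = 0" "\<pi> X (u - x) = \<pi> X u - \<pi> X x"
proof -
  interpret L: Vector_Spaces.linear scale scale "\<pi> X" by (rule rep_linear[OF assms])
  show "\<pi> X (u + x) = \<pi> X u + \<pi> X x" "\<pi> X (scale c u) = scale c (\<pi> X u)" "\<pi> X 0 = 0" "\<pi> X (u - x) = \<pi> X u - \<pi> X x"
    by (simp_all add: L.add L.scale L.diff)
qed

context
  fixes v :: 'v and w :: poly2 and lam :: "complex mat \<Rightarrow> complex"
  assumes v: "v \<in> weight_space lam" and vpos: "\<And>a b. a < 2 * n \<Longrightarrow> b < 2 * n \<Longrightarrow> ht n b < ht n a \<Longrightarrow> \<pi> (sp_mat n a b) v = 0"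
    and w: "\<And>H. H \<in> cartan n \<Longrightarrow> rho n H w = fscale (lam H) w"
    and wpos: "\<And>a b. a < 2 * n \<Longrightarrow> b < 2 * n \<Longrightarrow> ht n b < ht n a \<Longrightarrow> sp_op n a b w = 0"
begin

abbreviation "lowV \<equiv> span (lower_eigen scale (\<pi> (height_mat n)) (lam (height_mat n)))"
abbreviation "lowP \<equiv> fs.span (lower_eigen fscale (rho n (height_mat n)) (lam (height_mat n)))"

text \<open>
  The generated subspace is invariant under the whole Lie algebra. Writing $X Y u = Y X u +
  [X,Y] u$ for a negative root vector $Y$ moves any $X$ towards the highest weight vectors;
  this takes the place of the Poincare--Birkhoff--Witt theorem.
\<close>

lemma linked_sp: "linked v w u u' \<Longrightarrow> X \<in> sp n \<Longrightarrow> linked v w (\<pi> X u) (rho n X u')"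
proof (induction arbitrary: X rule: linked.induct)
  case base
  have "linked v w (\<pi> (sp_mat n a b) v) (sp_op n a b w)" if ab: "a < 2 * n" "b < 2 * n" for a b
  proof -
    consider "ht n a < ht n b" | "ht n b < ht n a" | "a = b" using ht_inj[OF ab] by linarith
    then show ?thesis
    proof cases
      case 1 then show ?thesis using ab by (intro linked.low linked.base)
    next
      case 2 then show ?thesis using vpos[OF ab] wpos[OF ab] linked_0 by simp
    next
      case 3
      have H: "sp_mat n a a \<in> cartan n" using sp_mat_cartan[OF ab(1)] .
      have "\<pi> (sp_mat n a a) v = scale (lam (sp_mat n a a)) v" using v H by (simp add: weight_space_def)
      moreover have "sp_op n a a w = fscale (lam (sp_mat n a a)) w"
        using w[OF H] rho_sp_mat[OF ab(1) ab(1), of w] by simp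
      ultimately show ?thesis using 3 linked.scal[OF linked.base] by simp
    qed
  qed
  then have "linked v w (\<Sum>p\<in>{..<2*n}\<times>{..<2*n}. case p of (a, b) \<Rightarrow> scale (X $$ (a, b) / 2) (\<pi> (sp_mat n a b) v))
     (\<Sum>p\<in>{..<2*n}\<times>{..<2*n}. case p of (a, b) \<Rightarrow> fscale (X $$ (a, b) / 2) (sp_op n a b w))"
    by (intro linked_sum) (auto intro: linked.scal)
  then show ?case
    using rep_decomp[OF base, of v] sp_decomp[OF base, of w] by (simp add: sum.cartesian_product)
next
  case (add u u' x x')
  then show ?case by (simp add: rep_lin rho_lin linked.add)
next
  case (scal u u' c)
  then show ?case by (simp add: rep_lin rho_lin linked.scal)
next
  case (low u u' a b)
  let ?Y = "sp_mat n a b"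
  have Y: "?Y \<in> sp n" using low by (simp add: sp_mat_sp)
  have "\<pi> X (\<pi> ?Y u) = \<pi> ?Y (\<pi> X u) + \<pi> (bracket X ?Y) u"
    using rep_bracket[OF low.prems Y, of u] by simp
  moreover have "rho n X (sp_op n a b u') = sp_op n a b (rho n X u') + rho n (bracket X ?Y) u'"
    using rho_bracket[OF sp_carrier[OF low.prems] sp_carrier[OF Y], of u'] low.hyps
    by (simp add: rho_sp_mat)
  moreover have "linked v w (\<pi> ?Y (\<pi> X u)) (sp_op n a b (rho n X u'))"
    by (rule linked.low[OF low.IH[OF low.prems] low.hyps(2-4)])
  moreover have "linked v w (\<pi> (bracket X ?Y) u) (rho n (bracket X ?Y) u')"
    by (rule low.IH[OF sp_bracket[OF low.prems Y]])
  ultimately show ?case by (simp add: linked.add)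
qed

text \<open>
  Each linked pair is one common multiple of the two highest weight vectors plus vectors of
  strictly smaller height.
\<close>

lemma linked_modulo_lower:
  "linked v w u u' \<Longrightarrow> \<exists>t. u - scale t v \<in> lowV
     \<and> u' - fscale t w \<in> lowP"
proof (induction rule: linked.induct)
  case base
  then show ?case by (intro exI[of _ 1]) (simp add: span_zero fs.span_zero)
next
  case (add u u' x x')
  then obtain t r where "u - scale t v \<in> lowV"
    "u' - fscale t w \<in> lowP"
    "x - scale r v \<in> lowV"
    "x' - fscale r w \<in> lowP" by blast
  then have "(u - scale t v) + (x - scale r v) \<in> lowV"
    "(u' - fscale t w) + (x' - fscale r w) \<in> lowP"
    by (auto intro: span_add fs.span_add)
  then show ?case
    by (intro exI[of _ "t + r"]) (simp add: scale_left_distrib fs.scale_left_distrib algebra_simps)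
next
  case (scal u u' c)
  then obtain t where "u - scale t v \<in> lowV"
    "u' - fscale t w \<in> lowP" by blast
  then have "scale c (u - scale t v) \<in> lowV"
    "fscale c (u' - fscale t w) \<in> lowP"
    by (auto intro: span_scale fs.span_scale)
  then show ?case
    by (intro exI[of _ "c * t"]) (simp add: scale_right_diff_distrib fs.scale_right_diff_distrib)
next
  case (low u u' a b)
  let ?L = "lower_eigen scale (\<pi> (height_mat n)) (lam (height_mat n))" and ?L' = "lower_eigen fscale (rho n (height_mat n)) (lam (height_mat n))"
  obtain t where t: "u - scale t v \<in> span ?L" "u' - fscale t w \<in> fs.span ?L'" using low.IH by blast
  have hs: "height_mat n \<in> sp n" using height_mat_cartan by (simp add: cartan_def)
  have Y: "sp_mat n a b \<in> sp n" using low by (simp add: sp_mat_sp)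
  define m where "m = nat (ht n b - ht n a)"
  have m: "m \<ge> 1" "int m = ht n b - ht n a" using low.hyps by (auto simp: m_def)
  have "u = (u - scale t v) + scale t v" "u' = (u' - fscale t w) + fscale t w" by (simp_all add: pointwise)
  then have u: "u \<in> span (insert v ?L)" "u' \<in> fs.span (insert w ?L')"
    using t span_mono[of ?L "insert v ?L"] fs.span_mono[of ?L' "insert w ?L'"]
      span_add[OF _ span_scale[OF span_base], of "u - scale t v" "insert v ?L" v t]
      fs.span_add[OF _ fs.span_scale[OF fs.span_base], of "u' - fscale t w" "insert w ?L'" w t] by auto
  have "\<pi> (sp_mat n a b) u \<in> span ?L"
  proof (rule lower_eigen_step[OF rep_linear[OF hs] rep_linear[OF Y] m(1) _ u(1)])
    show "\<pi> (height_mat n) v = scale (lam (height_mat n)) v" using v height_mat_cartan by (simp add: weight_space_def)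
    fix x
    have "bracket (height_mat n) (sp_mat n a b) = of_int (ht n a - ht n b) \<cdot>\<^sub>m sp_mat n a b"
      using cartan_bracket[OF height_mat_cartan low.hyps(2,3)] low.hyps by (simp add: height_mat_def)
    then have "\<pi> (height_mat n) (\<pi> (sp_mat n a b) x) = \<pi> (sp_mat n a b) (\<pi> (height_mat n) x) + scale (of_int (ht n a - ht n b)) (\<pi> (sp_mat n a b) x)"
      using rep_bracket[OF hs Y, of x] rep_smult[OF Y] by simp
    also have "of_int (ht n a - ht n b) = (- of_nat m :: complex)"
      using m(2) by (metis minus_diff_eq of_int_minus of_int_of_nat_eq)
    finally show "\<pi> (height_mat n) (\<pi> (sp_mat n a b) x) = \<pi> (sp_mat n a b) (\<pi> (height_mat n) x) - scale (of_nat m) (\<pi> (sp_mat n a b) x)"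
      by (simp add: scale_minus_left)
  qed
  moreover have "sp_op n a b u' \<in> fs.span ?L'"
  proof (rule lower_eigen_step[OF lin_rho lin_sp_op m(1) _ u(2) w[OF height_mat_cartan]])
    fix x show "rho n (height_mat n) (sp_op n a b x) = sp_op n a b (rho n (height_mat n) x) - fscale (of_nat m) (sp_op n a b x)"
      using rho_sp_op_height_mat[OF low.hyps(2,3), of x] m(2) by (metis of_int_of_nat_eq)
  qed
  ultimately show ?case by (intro exI[of _ 0]) simp
qed

text \<open>
  The highest weight occurs only once in the generated subspace, namely along the pair of
  highest weight vectors.
\<close>

lemma linked_independent:
  assumes "v \<noteq> 0" "w \<noteq> 0" shows "\<not> linked v w v 0" "\<not> linked v w 0 w"
proof -
  have hs: "height_mat n \<in> sp n" using height_mat_cartan by (simp add: cartan_def)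
  have eigv: "\<pi> (height_mat n) (scale c v) = scale (lam (height_mat n)) (scale c v)" for c
    using v height_mat_cartan rep_lin(2)[OF hs] by (simp add: weight_space_def scale_left_commute)
  have eigw: "rho n (height_mat n) (fscale c w) = fscale (lam (height_mat n)) (fscale c w)" for c
    using w[OF height_mat_cartan] by (simp add: rho_lin mult.commute)
  have zv: "c = 0" if "scale c v \<in> lowV" for c
    using lower_eigen_independent[OF rep_linear[OF hs] that eigv] assms by simp
  have zw: "c = 0" if "fscale c w \<in> lowP" for c
    using lower_eigen_independent[OF lin_rho that eigw] assms by simp
  show "\<not> linked v w v 0"
  proof
    assume "linked v w v 0"
    from linked_modulo_lower[OF this] obtain t where t: "v - scale t v \<in> lowV"
      "0 - fscale t w \<in> lowP" by blast
    have "- t = 0" by (rule zw) (use t(2) in \<open>simp add: fs.scale_minus_left\<close>)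
    moreover have "1 - t = 0" by (rule zv) (use t(1) in \<open>simp add: scale_left_diff_distrib\<close>)
    ultimately show False by simp
  qed
  show "\<not> linked v w 0 w"
  proof
    assume "linked v w 0 w"
    from linked_modulo_lower[OF this] obtain t where t: "0 - scale t v \<in> lowV"
      "w - fscale t w \<in> lowP" by blast
    have "- t = 0" by (rule zv) (use t(1) in \<open>simp add: scale_minus_left\<close>)
    moreover have "1 - t = 0" by (rule zw) (use t(2) in \<open>simp add: fs.scale_left_diff_distrib\<close>)
    ultimately show False by simp
  qed
qed

end

end

context irreducible_sp_rep begin

text \<open>
  The linked pairs form the graph of an isomorphism. Its kernel on either side is an
  invariant subspace without the highest weight vector, and its projections to both sides
  are surjective, by irreducibility of both representations.
\<close>

theorem multiplicity_eq_dim_model: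
  assumes n: "n \<ge> 2"
    and hw: "has_highest_weight (\<lambda>H. of_nat (a + l) * eps 1 H + of_nat l * eps 2 H)"
  shows "multiplicity \<mu> = fs.dim {f \<in> model n (a + l) l. \<forall>H\<in>cartan n. rho n H f = fscale (\<mu> H) f}"
proof -
  define lam where "lam = (\<lambda>H. of_nat (a + l) * eps 1 H + of_nat l * eps 2 H)"
  obtain v where v: "v \<in> weight_space lam" "v \<noteq> 0"
    and ann: "\<And>\<alpha> X. \<alpha> \<in> positive_roots n \<Longrightarrow> X \<in> root_space n \<alpha> \<Longrightarrow> \<pi> X v = 0"
    using hw unfolding has_highest_weight_def lam_def by blast
  define w where "w = hw_vec a l"
  have w: "w \<in> model n (a + l) l" "w \<noteq> 0"
    using bideg_hw_vec[OF n, of a l] up_op_hw_vec[OF n] omega_diff_hw_vec[OF n] hw_vec_nonzero by (auto simp: w_def model_def)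
  have vpos: "\<pi> (sp_mat n x y) v = 0" if "x < 2 * n" "y < 2 * n" "ht n y < ht n x" for x y
    using positive_root_vector[OF that] ann by blast
  have wl: "rho n H w = fscale (lam H) w" if "H \<in> cartan n" for H
    using rho_hw_vec[OF n that] by (simp add: w_def lam_def)
  have wpos: "sp_op n x y w = 0" if "x < 2 * n" "y < 2 * n" "ht n y < ht n x" for x y
    using sp_op_hw_vec[OF n that] by (simp add: w_def)
  let ?S = "linked v w"
  have S_sp: "?S (\<pi> X u) (rho n X u')" if "?S u u'" "X \<in> sp n" for u u' X
    by (rule linked_sp[OF v(1) _ _ _ that]) (rule vpos wl wpos; assumption)+
  have S_no: "\<not> ?S v 0" "\<not> ?S 0 w"
    by (rule linked_independent[OF v(1) _ _ _ v(2) w(2)]; rule vpos wl wpos; assumption)+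
  have S_W: "?S u u' \<Longrightarrow> u' \<in> model n (a + l) l" for u u'
    by (induction rule: linked.induct)
       (use w(1) fs.subspace_add[OF subspace_model] fs.subspace_scale[OF subspace_model] model_sp_op in blast)+
  have S_y: "?S (\<pi> (sp_mat n x y) u) (sp_op n x y u')" if "?S u u'" "x < 2 * n" "y < 2 * n" for u u' x y
    using S_sp[OF that(1) sp_mat_sp[OF that(2,3)]] rho_sp_mat[OF that(2,3), of u'] by simp
  have left: "u = 0" if "?S u 0" for u
  proof -
    have "subspace {u. ?S u 0}"
      unfolding subspace_def using linked_0 linked.add[of v w _ 0 _ 0] linked.scal[of v w _ 0] by auto
    moreover have "\<pi> X u \<in> {u. ?S u 0}" if "X \<in> sp n" "u \<in> {u. ?S u 0}" for X u
      using S_sp[OF _ that(1), of u 0] that(2) by (simp add: rho_lin)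
    ultimately have "{u. ?S u 0} = {0} \<or> {u. ?S u 0} = UNIV" by (rule irreducible)
    then show ?thesis using S_no(1) that by blast
  qed
  \<comment> \<open>On the side of the polynomials irreducibility is available only as \<open>model_contains_hw\<close>.\<close>
  have right: "u' = 0" if "?S 0 u'" for u'
  proof (rule ccontr)
    assume "u' \<noteq> 0"
    have "hw_vec a l \<in> {u'. ?S 0 u'}"
    proof (rule model_contains_hw[OF n])
      show "fs.subspace {u'. ?S 0 u'}"
        unfolding fs.subspace_def using linked_0 linked.add[of v w 0 _ 0] linked.scal[of v w 0] by auto
      show "{u'. ?S 0 u'} \<subseteq> model n (a + l) l" using S_W by blast
      show "{u'. ?S 0 u'} \<noteq> {0}" using that \<open>u' \<noteq> 0\<close> by blast
      show "sp_op n b c f \<in> {u'. ?S 0 u'}" if "f \<in> {u'. ?S 0 u'}" "b < 2 * n" "c < 2 * n" for f b c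
        using S_y[of 0 f b c] that rep_lin(3)[OF sp_mat_sp[OF that(2,3)]] by simp
    qed
    then show False using S_no(2) by (simp add: w_def)
  qed
  have total: "\<exists>u'. ?S u u'" for u
  proof -
    have "subspace {u. \<exists>u'. ?S u u'}"
      unfolding subspace_def using linked_0 linked.add linked.scal by blast
    moreover have "\<pi> X u \<in> {u. \<exists>u'. ?S u u'}" if "X \<in> sp n" "u \<in> {u. \<exists>u'. ?S u u'}" for X u
      using S_sp[OF _ that(1), of u] that(2) by blast
    ultimately have "{u. \<exists>u'. ?S u u'} = {0} \<or> {u. \<exists>u'. ?S u u'} = UNIV" by (rule irreducible)
    then show ?thesis using v(2) linked.base[of v w] by blast
  qed
  have surj: "\<exists>u. ?S u u'" if "u' \<in> model n (a + l) l" for u'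
  proof -
    have "{u'. \<exists>u. ?S u u'} = model n (a + l) l"
    proof (rule model_generated[OF n])
      show "fs.subspace {u'. \<exists>u. ?S u u'}"
        unfolding fs.subspace_def using linked_0 linked.add linked.scal by blast
      show "hw_vec a l \<in> {u'. \<exists>u. ?S u u'}" using linked.base[of v w] by (auto simp: w_def)
    qed (use S_W S_y in blast)+
    then show ?thesis using that by blast
  qed
  have uniq: "x = y" if "?S u x" "?S u y" for u x y
    using right[of "x - y"] linked_diff[OF that] by simp
  define \<phi> where "\<phi> u = (THE u'. ?S u u')" for u
  have S\<phi>: "?S u (\<phi> u)" for u
    unfolding \<phi>_def using total uniq by (metis theI)
  have \<phi>I: "\<phi> u = u'" if "?S u u'" for u u' using uniq[OF S\<phi> that] .
  have lin\<phi>: "Vector_Spaces.linear scale fscale \<phi>"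
    unfolding Vector_Spaces.linear_iff
    using vector_space_axioms fs.vector_space_axioms \<phi>I[OF linked.add[OF S\<phi> S\<phi>]] \<phi>I[OF linked.scal[OF S\<phi>]] by blast
  have \<phi>sp: "\<phi> (\<pi> X u) = rho n X (\<phi> u)" if "X \<in> sp n" for X u
    using \<phi>I[OF S_sp[OF S\<phi> that]] by blast
  have \<phi>0: "u = 0" if "\<phi> u = 0" for u using left[of u] S\<phi>[of u] that by simp
  interpret L: Vector_Spaces.linear scale fscale \<phi> by (rule lin\<phi>)
  have inj: "x = y" if "\<phi> x = \<phi> y" for x y using \<phi>0[of "x - y"] that by (simp add: L.diff)
  have cs: "H \<in> cartan n \<Longrightarrow> H \<in> sp n" for H by (simp add: cartan_def)
  have ws: "u \<in> weight_space \<mu> \<longleftrightarrow> (\<forall>H\<in>cartan n. rho n H (\<phi> u) = fscale (\<mu> H) (\<phi> u))" for u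
  proof -
    have "\<pi> H u = scale (\<mu> H) u \<longleftrightarrow> rho n H (\<phi> u) = fscale (\<mu> H) (\<phi> u)" if "H \<in> cartan n" for H
      using \<phi>sp[OF cs[OF that], of u] L.scale[of "\<mu> H" u] inj by metis
    then show ?thesis by (simp add: weight_space_def)
  qed
  have img: "\<phi> ` weight_space \<mu> = {f \<in> model n (a + l) l. \<forall>H\<in>cartan n. rho n H f = fscale (\<mu> H) f}"
  proof (rule equalityI; rule subsetI)
    fix f assume "f \<in> {f \<in> model n (a + l) l. \<forall>H\<in>cartan n. rho n H f = fscale (\<mu> H) f}"
    then obtain u where "?S u f" "\<forall>H\<in>cartan n. rho n H f = fscale (\<mu> H) f" using surj by blast
    then show "f \<in> \<phi> ` weight_space \<mu>" using \<phi>I[of u f] ws[of u] by blast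
  next
    fix f assume "f \<in> \<phi> ` weight_space \<mu>"
    then obtain u where "u \<in> weight_space \<mu>" "f = \<phi> u" by blast
    then show "f \<in> {f \<in> model n (a + l) l. \<forall>H\<in>cartan n. rho n H f = fscale (\<mu> H) f}"
      using ws[of u] S_W[OF S\<phi>[of u]] by blast
  qed
  have sub: "subspace (weight_space \<mu>)"
    unfolding subspace_def weight_space_def
    using cs rep_lin by (auto simp: scale_right_distrib scale_left_commute)
  obtain B where B: "finite B" "span B = UNIV" using finite_dim by blast
  interpret vp: vector_space_pair scale "fscale :: complex \<Rightarrow> poly2 \<Rightarrow> poly2" by unfold_locales
  have "fs.dim (\<phi> ` weight_space \<mu>) = dim (weight_space \<mu>)"
    by (rule vp.dim_image_inj[OF lin\<phi> sub _ B(1)]) (use B(2) \<phi>0 in auto)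
  then show ?thesis by (simp add: multiplicity_def img)
qed

end

section \<open>Dimensions of the weight spaces of the model\<close>

text \<open>The coefficient of $\varepsilon_{i+1}$ in the weight of a variable.\<close>

definition wt_coef :: "nat \<Rightarrow> nat \<Rightarrow> bool \<times> nat \<Rightarrow> int" where
  "wt_coef n i v = (if snd v = i then 1 else if snd v = n + i then - 1 else 0)"

definition wt_monos :: "nat \<Rightarrow> (nat \<Rightarrow> int) \<Rightarrow> int \<Rightarrow> int \<Rightarrow> (bool \<times> nat \<Rightarrow> nat) set" where
  "wt_monos n \<mu> k l = {m. (\<forall>v. v \<notin> vars n \<longrightarrow> m v = 0) \<and> (\<Sum>v\<in>vars n. degx v * int (m v)) = k \<and>
     (\<Sum>v\<in>vars n. degy v * int (m v)) = l \<and> (\<forall>i<n. (\<Sum>v\<in>vars n. wt_coef n i v * int (m v)) = \<mu> (i + 1))}"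

definition wt_polys :: "nat \<Rightarrow> (nat \<Rightarrow> int) \<Rightarrow> int \<Rightarrow> int \<Rightarrow> poly2 set" where
  "wt_polys n \<mu> k l = {f. bideg n k l f \<and> (\<forall>i<n. graded n (wt_coef n i) (\<mu> (i + 1)) f)}"

lemma wt_polys_iff: "f \<in> wt_polys n \<mu> k l \<longleftrightarrow> (\<forall>m. f m \<noteq> 0 \<longrightarrow> m \<in> wt_monos n \<mu> k l)"
  unfolding wt_polys_def wt_monos_def bideg_def graded_def by blast

lemma subspace_wt_polys: "fs.subspace (wt_polys n \<mu> k l)"
  unfolding fs.subspace_def wt_polys_def by (simp add: bideg_add bideg_scale graded_add graded_scale)

lemma mono_vec_wt_polys: "m \<in> wt_monos n \<mu> k l \<Longrightarrow> mono_vec m \<in> wt_polys n \<mu> k l"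
  unfolding wt_polys_iff mono_vec_def by simp

lemma finite_wt_monos: "finite (wt_monos n \<mu> k l)"
proof (rule finite_subset)
  show "wt_monos n \<mu> k l \<subseteq> deg_monos n (nat (k + l))"
  proof
    fix m assume "m \<in> wt_monos n \<mu> k l"
    then have "mono_vec m \<in> wt_polys n \<mu> k l" by (rule mono_vec_wt_polys)
    moreover have "mono_vec m m \<noteq> 0" by (simp add: mono_vec_def)
    ultimately show "m \<in> deg_monos n (nat (k + l))" using bideg_deg_monos unfolding wt_polys_def by blast
  qed
qed simp

lemma mono_vec_independent: assumes "finite M" shows "fs.independent (mono_vec ` M)" "card (mono_vec ` M) = card M"
proof -
  have inj: "inj_on mono_vec M" unfolding inj_on_def mono_vec_def by (metis zero_neq_one)
  then show "card (mono_vec ` M) = card M" by (rule card_image)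
  show "fs.independent (mono_vec ` M)"
  proof
    assume "fs.dependent (mono_vec ` M)"
    then obtain u where u: "\<exists>x\<in>mono_vec ` M. u x \<noteq> 0" "(\<Sum>x\<in>mono_vec ` M. fscale (u x) x) = 0"
      using assms by (subst (asm) fs.dependent_finite) auto
    then obtain m where m: "m \<in> M" "u (mono_vec m) \<noteq> 0" by blast
    have "(\<Sum>x\<in>mono_vec ` M. fscale (u x) x) = (\<Sum>m'\<in>M. fscale (u (mono_vec m')) (mono_vec m'))"
      using inj by (simp add: sum.reindex)
    then have "(\<Sum>m'\<in>M. fscale (u (mono_vec m')) (mono_vec m')) m = 0" using u(2) by (metis zero_fun_apply)
    moreover have "(\<Sum>m'\<in>M. fscale (u (mono_vec m')) (mono_vec m')) m = (\<Sum>m'\<in>M. if m' = m then u (mono_vec m) else 0)"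
      unfolding sum_apply by (intro sum.cong) (auto simp: fscale_apply mono_vec_def)
    ultimately show False using m assms by simp
  qed
qed

lemma wt_polys_span: "wt_polys n \<mu> k l \<subseteq> fs.span (mono_vec ` wt_monos n \<mu> k l)"
  using supp_span[OF finite_wt_monos] unfolding wt_polys_iff[abs_def] by (metis wt_polys_iff subsetI)

lemma dim_wt_polys: "fs.dim (wt_polys n \<mu> k l) = card (wt_monos n \<mu> k l)"
proof -
  have "card (mono_vec ` wt_monos n \<mu> k l) = fs.dim (wt_polys n \<mu> k l)"
    by (rule fs.basis_card_eq_dim[OF _ wt_polys_span mono_vec_independent(1)[OF finite_wt_monos]]) (use mono_vec_wt_polys in blast)
  then show ?thesis by (simp add: mono_vec_independent(2)[OF finite_wt_monos])
qed

lemma graded_up_down: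
  assumes "graded n c t f" "\<And>a. c (False, a) = c (True, a)"
  shows "graded n c t (up_op n f)" "graded n c t (down_op n f)"
proof -
  have "graded n c t (cr (s, a) (an (r, a) f))" if "a < 2 * n" for a s r
    using graded_cr[OF graded_an[OF assms(1), of "(r, a)"], of "(s, a)"] that assms(2) by (cases s; cases r) auto
  then show "graded n c t (up_op n f)" "graded n c t (down_op n f)"
    unfolding up_op_def down_op_def by (auto intro!: graded_sum)
qed

lemma graded_omega:
  assumes "graded n c t f" "\<And>a. a < 2 * n \<Longrightarrow> c (False, a) + c (True, bar n a) = 0"
  shows "graded n c t (omega_mul n f)" "graded n c t (omega_diff n f)"
proof -
  have "graded n c t (cr (False, a) (cr (True, bar n a) f))" "graded n c t (an (False, a) (an (True, bar n a) f))" if "a < 2 * n" for a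
  proof -
    have e: "t + c (True, bar n a) + c (False, a) = t" "t - c (True, bar n a) - c (False, a) = t"
      using assms(2)[OF that] by auto
    show "graded n c t (cr (False, a) (cr (True, bar n a) f))" "graded n c t (an (False, a) (an (True, bar n a) f))"
      using graded_cr[OF graded_cr[OF assms(1), of "(True, bar n a)"], of "(False, a)"]
        graded_an[OF graded_an[OF assms(1), of "(True, bar n a)"], of "(False, a)"] that unfolding e by simp_all
  qed
  then show "graded n c t (omega_mul n f)" "graded n c t (omega_diff n f)"
    unfolding omega_mul_def omega_diff_def by (auto intro!: graded_sum graded_scale)
qed

lemma wt_coef_bar: "i < n \<Longrightarrow> a < 2 * n \<Longrightarrow> wt_coef n i (False, a) + wt_coef n i (True, bar n a) = 0"
  by (auto simp: wt_coef_def bar_def)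

lemma wt_polys_ops:
  assumes "f \<in> wt_polys n \<mu> k l"
  shows "up_op n f \<in> wt_polys n \<mu> (k + 1) (l - 1)" "down_op n f \<in> wt_polys n \<mu> (k - 1) (l + 1)"
    "omega_mul n f \<in> wt_polys n \<mu> (k + 1) (l + 1)" "omega_diff n f \<in> wt_polys n \<mu> (k - 1) (l - 1)"
proof -
  have "graded n (wt_coef n i) t (up_op n f) \<and> graded n (wt_coef n i) t (down_op n f) \<and> graded n (wt_coef n i) t (omega_mul n f) \<and> graded n (wt_coef n i) t (omega_diff n f)"
    if "graded n (wt_coef n i) t f" "i < n" for i t
    using graded_up_down[OF that(1)] graded_omega[OF that(1)] wt_coef_bar[OF that(2)] by (simp add: wt_coef_def)
  then show "up_op n f \<in> wt_polys n \<mu> (k + 1) (l - 1)" "down_op n f \<in> wt_polys n \<mu> (k - 1) (l + 1)"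
    "omega_mul n f \<in> wt_polys n \<mu> (k + 1) (l + 1)" "omega_diff n f \<in> wt_polys n \<mu> (k - 1) (l - 1)"
    using assms bideg_up_op bideg_down_op bideg_omega_mul bideg_omega_diff unfolding wt_polys_def by auto
qed

text \<open>
  Among the monomials of $f$ take one with the highest total exponent in $x_1$ and $y_{\bar
  1}$; the product with $x_1 y_{\bar 1}$ cannot be cancelled by the other terms of $\omega$,
  which involve neither variable.
\<close>

lemma omega_mul_inj:
  assumes n: "n \<ge> 1" and f: "bideg n k l f" and 0: "omega_mul n f = 0" shows "f = 0"
proof (rule ccontr)
  assume "f \<noteq> 0"
  then obtain m0 where m0: "f m0 \<noteq> 0" by (metis ext zero_fun_apply)
  let ?u = "(False, 0)" and ?v = "(True, n)"
  let ?S = "{m. f m \<noteq> 0}"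
  have fin: "finite ?S" using bideg_deg_monos[OF f] by (auto intro: finite_subset[OF _ finite_deg_monos])
  define h where "h m = m ?u + m ?v" for m :: "bool \<times> nat \<Rightarrow> nat"
  have "Max (h ` ?S) \<in> h ` ?S" using fin m0 by (intro Max_in) auto
  then obtain m where m: "f m \<noteq> 0" "h m = Max (h ` ?S)" by auto
  have max: "f m' = 0" if "h m' > h m" for m'
    using that Max_ge[of "h ` ?S" "h m'"] fin m(2) by fastforce
  \<comment> \<open>the monomial whose coefficient in $\omega f$ survives\<close>
  define M where "M = m(?u := m ?u + 1, ?v := m ?v + 1)"
  have t0: "cr ?u (cr (True, bar n 0) f) M = f m"
  proof -
    have "M(?u := M ?u - 1, ?v := (M(?u := M ?u - 1)) ?v - 1) = m" by (auto simp: M_def)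
    moreover have "M ?u \<noteq> 0" "(M(?u := M ?u - 1)) ?v \<noteq> 0" by (auto simp: M_def)
    ultimately show ?thesis using n by (simp add: cr_def bar_def)
  qed
  have "fscale (sg n a) (cr (False, a) (cr (True, bar n a) f)) M = 0" if a: "a < 2 * n" "a \<noteq> 0" for a
  proof -
    let ?M = "M((False, a) := M (False, a) - 1)"
    let ?M' = "?M((True, bar n a) := ?M (True, bar n a) - 1)"
    have "bar n a \<noteq> n" using a n by (auto simp: bar_def)
    then have "h ?M' = h m + 2" using a by (auto simp: h_def M_def)
    then have "f ?M' = 0" by (intro max) simp
    then show ?thesis by (simp add: fscale_apply cr_def)
  qed
  then have "omega_mul n f M = (\<Sum>a\<in>{0}. fscale (sg n a) (cr (False, a) (cr (True, bar n a) f)) M)"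
    unfolding omega_mul_def sum_apply using n by (intro sum.mono_neutral_right) auto
  also have "\<dots> = f m" using n t0 by (simp add: fscale_apply sg_def)
  finally show False using m(1) 0 by (simp add: zero_fun_apply)
qed

text \<open>The orthogonal complement of the image is the kernel of the adjoint.\<close>

lemma surj_of_adjoint_inj:
  assumes A: "fs.subspace A" "\<And>f. f \<in> A \<Longrightarrow> bideg n k l f"
    and B: "fs.subspace B" "\<And>g. g \<in> B \<Longrightarrow> bideg n k' l' g"
    and T: "lin T" "\<And>f. f \<in> A \<Longrightarrow> T f \<in> B" and T': "\<And>g. g \<in> B \<Longrightarrow> T' g \<in> A"
    and inj: "\<And>g. g \<in> B \<Longrightarrow> T' g = 0 \<Longrightarrow> g = 0"
    and adj: "\<And>f g. k' \<ge> 0 \<Longrightarrow> l' \<ge> 0 \<Longrightarrow> fischer n (nat (k' + l')) (T f) g = fischer n (nat (k + l)) f (T' g)"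
  shows "T ` A = B"
proof (rule antisym, use T in blast, rule subsetI, rule ccontr)
  fix g assume g: "g \<in> B" "g \<notin> T ` A"
  have sub: "fs.subspace (T ` A)" using fsp.linear_subspace_image[OF T(1) A(1)] .
  have "T ` A \<subseteq> fs.span (mono_vec ` deg_monos n (nat (k' + l')))"
  proof
    fix x assume "x \<in> T ` A"
    then have "x \<in> B" using T by blast
    then show "x \<in> fs.span (mono_vec ` deg_monos n (nat (k' + l')))" by (rule bideg_span[OF B(2)])
  qed
  then obtain C where C: "finite C" "fs.span C = T ` A" "C \<subseteq> T ` A"
    using fs.finite_dim_subspace[OF sub, of "mono_vec ` deg_monos n (nat (k' + l'))"] by (metis finite_deg_monos finite_imageI)
  have "\<exists>u\<in>fs.span C. bideg n k' l' u \<and> (\<forall>b\<in>fs.span C. fischer n (nat (k' + l')) b (g - u) = 0)"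
  proof (rule orth_proj[OF C(1) _ B(2)[OF g(1)]])
    fix b assume "b \<in> C"
    then have "b \<in> B" using C(3) T by blast
    then show "bideg n k' l' b" by (rule B(2))
  qed
  then obtain u where u: "u \<in> T ` A" "\<And>b. b \<in> T ` A \<Longrightarrow> fischer n (nat (k' + l')) b (g - u) = 0"
    unfolding C(2) by blast
  have uB: "u \<in> B" using u(1) T by blast
  have gu: "g - u \<in> B" using fs.subspace_diff[OF B(1) g(1) uB] .
  have ne: "g - u \<noteq> 0" using g(2) u(1) by auto
  have pos: "k' \<ge> 0" "l' \<ge> 0" using bideg_nonneg[OF B(2)[OF gu] ne] by auto
  have "fischer n (nat (k + l)) (T' (g - u)) (T' (g - u)) = 0"
    unfolding adj[OF pos, symmetric] using u(2) T'[OF gu] by blast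
  then have "T' (g - u) = 0" by (rule fischer_definite[OF A(2)[OF T'[OF gu]]])
  then show False using inj[OF gu] ne by blast
qed

text \<open>
  The kernel of the first of the two operators that define the model, in a given weight.
\<close>

definition wt_polys_up0 :: "nat \<Rightarrow> (nat \<Rightarrow> int) \<Rightarrow> int \<Rightarrow> int \<Rightarrow> poly2 set" where
  "wt_polys_up0 n \<mu> k l = {f \<in> wt_polys n \<mu> k l. up_op n f = 0}"

lemma subspace_wt_polys_up0: "fs.subspace (wt_polys_up0 n \<mu> k l)"
  using subspace_wt_polys[of n \<mu> k l] unfolding fs.subspace_def wt_polys_up0_def by (simp add: up_op_lin)

lemma wt_polys_bideg: "f \<in> wt_polys n \<mu> k l \<Longrightarrow> bideg n k l f" by (simp add: wt_polys_def)
lemma wt_polys_up0_bideg: "f \<in> wt_polys_up0 n \<mu> k l \<Longrightarrow> bideg n k l f" by (simp add: wt_polys_up0_def wt_polys_def)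

text \<open>
  \<open>up_op\<close> is surjective here since its adjoint \<open>down_op\<close> is
  injective on bidegree $(k+1, l-1)$.
\<close>

lemma dim_wt_polys_up0:
  assumes "k \<ge> l"
  shows "int (fs.dim (wt_polys_up0 n \<mu> k l)) = int (card (wt_monos n \<mu> k l)) - int (card (wt_monos n \<mu> (k + 1) (l - 1)))"
proof -
  have "up_op n ` wt_polys n \<mu> k l = wt_polys n \<mu> (k + 1) (l - 1)"
  proof (rule surj_of_adjoint_inj[of _ n k l _ "k + 1" "l - 1" _ "down_op n"])
    show "down_op n g \<in> wt_polys n \<mu> k l" if "g \<in> wt_polys n \<mu> (k + 1) (l - 1)" for g using wt_polys_ops(2)[OF that] by simp
    show "g = 0" if "g \<in> wt_polys n \<mu> (k + 1) (l - 1)" "down_op n g = 0" for g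
      by (rule down_op_inj[OF wt_polys_bideg[OF that(1)] _ that(2)]) (use assms in simp)
  qed (simp_all add: subspace_wt_polys wt_polys_bideg lin_up_op wt_polys_ops fischer_up_op)
  moreover have "fs.dim (wt_polys n \<mu> k l) = fs.dim (up_op n ` wt_polys n \<mu> k l) + fs.dim {f\<in>wt_polys n \<mu> k l. up_op n f = 0}"
    by (rule fsp.rank_nullity[OF lin_up_op subspace_wt_polys wt_polys_span]) (simp add: finite_wt_monos)
  ultimately show ?thesis by (simp add: dim_wt_polys wt_polys_up0_def)
qed

text \<open>
  \<open>omega_diff\<close> is surjective between the two kernels since its adjoint
  \<open>omega_mul\<close> is injective and commutes with \<open>up_op\<close>.
\<close>

lemma dim_wt_polys_up0_omega_diff:
  assumes n: "n \<ge> 1"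
  shows "fs.dim (wt_polys_up0 n \<mu> k l) = fs.dim (wt_polys_up0 n \<mu> (k - 1) (l - 1)) + fs.dim {f\<in>wt_polys_up0 n \<mu> k l. omega_diff n f = 0}"
proof -
  have "omega_diff n ` wt_polys_up0 n \<mu> k l = wt_polys_up0 n \<mu> (k - 1) (l - 1)"
  proof (rule surj_of_adjoint_inj[of _ n k l _ "k - 1" "l - 1" _ "omega_mul n"])
    show "omega_mul n g \<in> wt_polys_up0 n \<mu> k l" if "g \<in> wt_polys_up0 n \<mu> (k - 1) (l - 1)" for g
      using wt_polys_ops(3)[of g n \<mu> "k - 1" "l - 1"] that by (simp add: wt_polys_up0_def up_op_omega_mul omega_mul_lin)
    show "omega_diff n f \<in> wt_polys_up0 n \<mu> (k - 1) (l - 1)" if "f \<in> wt_polys_up0 n \<mu> k l" for f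
      using wt_polys_ops(4)[of f n \<mu> k l] that by (simp add: wt_polys_up0_def up_op_omega_diff omega_diff_lin)
    show "g = 0" if "g \<in> wt_polys_up0 n \<mu> (k - 1) (l - 1)" "omega_mul n g = 0" for g
      using omega_mul_inj[OF n wt_polys_up0_bideg[OF that(1)] that(2)] .
    show "fischer n (nat (k - 1 + (l - 1))) (omega_diff n f) g = fischer n (nat (k + l)) f (omega_mul n g)" if "0 \<le> k - 1" "0 \<le> l - 1" for f g
    proof -
      have e: "nat (k + l) = Suc (Suc (nat (k - 1 + (l - 1))))" using that by simp
      show ?thesis unfolding e by (metis fischer_omega_mul fischer_cnj)
    qed
  qed (simp_all add: subspace_wt_polys_up0 wt_polys_up0_bideg lin_omega_diff)
  moreover have "fs.dim (wt_polys_up0 n \<mu> k l) = fs.dim (omega_diff n ` wt_polys_up0 n \<mu> k l) + fs.dim {f\<in>wt_polys_up0 n \<mu> k l. omega_diff n f = 0}"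
    by (rule fsp.rank_nullity[OF lin_omega_diff subspace_wt_polys_up0, where B = "mono_vec ` wt_monos n \<mu> k l"])
       (use wt_polys_span[of n \<mu> k l] finite_wt_monos in \<open>auto simp: wt_polys_up0_def\<close>)
  ultimately show ?thesis by simp
qed

lemma sum_wt_coef: assumes "i < n"
  shows "(\<Sum>v\<in>vars n. wt_coef n i v * int (m v)) = int (m (False, i)) - int (m (False, n + i)) + (int (m (True, i)) - int (m (True, n + i)))"
proof -
  have "(\<Sum>a<2*n. wt_coef n i (s, a) * int (m (s, a))) = int (m (s, i)) - int (m (s, n + i))" for s
  proof -
    have "(\<Sum>a<2*n. wt_coef n i (s, a) * int (m (s, a))) = (\<Sum>a<2*n. (if a = i then int (m (s, i)) else 0) - (if a = n + i then int (m (s, n + i)) else 0))"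
      using assms by (intro sum.cong) (auto simp: wt_coef_def)
    then show ?thesis using assms by (simp add: sum_subtractf)
  qed
  then show ?thesis by (simp add: sum_vars)
qed

lemma sp_op_diag: assumes "i < n" shows "sp_op n i i f m = of_int (\<Sum>v\<in>vars n. wt_coef n i v * int (m v)) * f m"
  unfolding sum_wt_coef[OF assms]
  using assms by (simp add: sp_op_def gl_op_def minus_apply plus_fun_apply fscale_apply cr_an_apply bar_def algebra_simps)

lemma sum_double: "(\<Sum>a<2*n. h a) = (\<Sum>i<n. h i) + (\<Sum>i<n. h (n + i))" for h :: "nat \<Rightarrow> 'a::comm_monoid_add"
  using sum.atLeastLessThan_concat[of 0 n "n + n" h] sum.shift_bounds_nat_ivl[of h 0 n n]
  by (simp add: lessThan_atLeast0 add.commute mult_2)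

text \<open>
  A Cartan element acts diagonally on monomials, so weight vectors are the polynomials
  homogeneous for the torus grading.
\<close>

lemma weight_graded:
  assumes "bideg n k l f"
  shows "(\<forall>H\<in>cartan n. rho n H f = fscale (weight_of n \<mu> H) f) \<longleftrightarrow> (\<forall>i<n. graded n (wt_coef n i) (\<mu> (i + 1)) f)"
proof
  assume *: "\<forall>H\<in>cartan n. rho n H f = fscale (weight_of n \<mu> H) f"
  show "\<forall>i<n. graded n (wt_coef n i) (\<mu> (i + 1)) f"
    unfolding graded_def
  proof (intro allI impI conjI)
    fix i m v assume i: "i < n" and m: "f m \<noteq> 0"
    show "m v = 0" if "v \<notin> vars n" using assms m that unfolding bideg_def graded_def by blast
    have "weight_of n \<mu> (sp_mat n i i) = (\<Sum>j=1..n. if j = i + 1 then of_int (\<mu> (i + 1)) else 0)"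
      unfolding weight_of_def
    proof (intro sum.cong refl)
      fix j assume "j \<in> {1..n}"
      then show "of_int (\<mu> j) * eps j (sp_mat n i i) = (if j = i + 1 then of_int (\<mu> (i + 1)) else 0)"
        using i by (cases j) (auto simp: eps_def sp_mat_def bar_def)
    qed
    then have "weight_of n \<mu> (sp_mat n i i) = of_int (\<mu> (i + 1))" using i by simp
    moreover have "rho n (sp_mat n i i) f = fscale (weight_of n \<mu> (sp_mat n i i)) f"
      using * sp_mat_cartan[of i n] i by simp
    ultimately have "sp_op n i i f m = of_int (\<mu> (i + 1)) * f m"
      using rho_sp_mat[of i n i f] i by (simp add: fscale_apply)
    then show "(\<Sum>v\<in>vars n. wt_coef n i v * int (m v)) = \<mu> (i + 1)"
      unfolding sp_op_diag[OF i] using m by (simp only: mult_cancel_right of_int_eq_iff) simp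
  qed
next
  assume *: "\<forall>i<n. graded n (wt_coef n i) (\<mu> (i + 1)) f"
  have y: "sp_op n i i f = fscale (of_int (\<mu> (i + 1))) f" if "i < n" for i
  proof (rule ext)
    fix m show "sp_op n i i f m = fscale (of_int (\<mu> (i + 1))) f m"
      using * that unfolding sp_op_diag[OF that] graded_def by (cases "f m = 0") (auto simp: fscale_apply)
  qed
  show "\<forall>H\<in>cartan n. rho n H f = fscale (weight_of n \<mu> H) f"
  proof
    fix H assume H: "H \<in> cartan n"
    have "rho n H f = (\<Sum>a<n + n. fscale (H $$ (a, a)) (gl_op a a f))"
      unfolding rho_cartan[OF H] mult_2 ..
    also have "\<dots> = (\<Sum>a<n. fscale (H $$ (a, a)) (gl_op a a f)) + (\<Sum>a<n. fscale (H $$ (n + a, n + a)) (gl_op (n + a) (n + a) f))"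
      unfolding mult_2[symmetric] by (rule sum_double)
    also have "\<dots> = (\<Sum>a<n. fscale (H $$ (a, a)) (sp_op n a a f))"
    proof -
      have "fscale (H $$ (a, a)) (gl_op a a f) + fscale (H $$ (n + a, n + a)) (gl_op (n + a) (n + a) f) = fscale (H $$ (a, a)) (sp_op n a a f)"
        if "a < n" for a
        using cartan_bar[OF H, of a] that
        by (simp add: sp_op_def bar_def fs.scale_right_diff_distrib fs.scale_minus_left add.commute)
      then show ?thesis by (simp add: sum.distrib[symmetric])
    qed
    also have "\<dots> = (\<Sum>a<n. fscale (H $$ (a, a) * of_int (\<mu> (a + 1))) f)"
      by (intro sum.cong) (simp_all add: y)
    also have "\<dots> = fscale (weight_of n \<mu> H) f"
      unfolding fs.scale_sum_left[symmetric] weight_of_def eps_def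
      by (rule arg_cong[of _ _ "\<lambda>c. fscale c f"],
          rule sum.reindex_bij_witness[of _ "\<lambda>i. i - 1" Suc]) (auto simp: mult.commute)
    finally show "rho n H f = fscale (weight_of n \<mu> H) f" .
  qed
qed

text \<open>
  Rank and nullity twice: for \<open>up_op\<close>, and for \<open>omega_diff\<close> on the
  kernel of \<open>up_op\<close>.
\<close>

theorem (in irreducible_sp_rep) multiplicity_count:
  assumes n: "n \<ge> 2" and "l \<le> k"
    and hw: "has_highest_weight (\<lambda>H. of_nat k * eps 1 H + of_nat l * eps 2 H)"
  shows "int (multiplicity (weight_of n \<mu>)) =
     int (card (wt_monos n \<mu> (int k) (int l))) - int (card (wt_monos n \<mu> (int k + 1) (int l - 1)))
     - int (card (wt_monos n \<mu> (int k - 1) (int l - 1))) + int (card (wt_monos n \<mu> (int k) (int l - 2)))"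
proof -
  define a where "a = k - l"
  have k: "k = a + l" using assms(2) by (simp add: a_def)
  have "{f \<in> model n (a + l) l. \<forall>H\<in>cartan n. rho n H f = fscale (weight_of n \<mu> H) f} = {f\<in>wt_polys_up0 n \<mu> (int k) (int l). omega_diff n f = 0}"
    unfolding model_def wt_polys_up0_def wt_polys_def k using weight_graded by blast
  then have m: "multiplicity (weight_of n \<mu>) = fs.dim {f\<in>wt_polys_up0 n \<mu> (int k) (int l). omega_diff n f = 0}"
    using multiplicity_eq_dim_model[OF n hw[unfolded k]] by simp
  have "int (fs.dim (wt_polys_up0 n \<mu> (int k - 1) (int l - 1))) = int (card (wt_monos n \<mu> (int k - 1) (int l - 1))) - int (card (wt_monos n \<mu> (int k) (int l - 2)))"
    using dim_wt_polys_up0[of "int l - 1" "int k - 1" n \<mu>] assms(2) by simp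
  moreover have "int (fs.dim (wt_polys_up0 n \<mu> (int k) (int l))) = int (card (wt_monos n \<mu> (int k) (int l))) - int (card (wt_monos n \<mu> (int k + 1) (int l - 1)))"
    using dim_wt_polys_up0[of "int l" "int k" n \<mu>] assms(2) by simp
  ultimately show ?thesis using dim_wt_polys_up0_omega_diff[of n \<mu> "int k" "int l"] n m by simp
qed

section \<open>Counting monomials of a given weight\<close>

text \<open>
  The exponents of the monomials of degree $k$ and weight $\nu$ in one copy of the
  variables; \<open>n + i\<close> is the index opposite to \<open>i\<close>.
\<close>

definition row_monos :: "nat \<Rightarrow> (nat \<Rightarrow> int) \<Rightarrow> int \<Rightarrow> (nat \<Rightarrow> nat) set" where
  "row_monos n \<nu> k = {g. (\<forall>a. \<not> a < 2 * n \<longrightarrow> g a = 0) \<and> (\<Sum>a<2*n. int (g a)) = k \<and>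
     (\<forall>i<n. int (g i) - int (g (n + i)) = \<nu> (i + 1))}"

lemma norm1_shift: "norm1 n a = (\<Sum>i<n. \<bar>a (i + 1)\<bar>)"
  unfolding norm1_def by (rule sum.reindex_bij_witness[of _ "\<lambda>i. i + 1" "\<lambda>i. i - 1"]) auto

text \<open>
  Cancelling each pair of opposite variables as often as possible leaves $|\nu_i|$ variables
  for each $i$.
\<close>

lemma row_monos_sum:
  assumes "g \<in> row_monos n \<nu> k"
  shows "k = norm1 n \<nu> + 2 * (\<Sum>i<n. int (min (g i) (g (n + i))))"
proof -
  have "k = (\<Sum>i<n. int (g i) + int (g (n + i)))"
    using assms by (simp add: row_monos_def sum_double sum.distrib)
  also have "\<dots> = (\<Sum>i<n. \<bar>\<nu> (i + 1)\<bar> + 2 * int (min (g i) (g (n + i))))"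
  proof (intro sum.cong refl)
    fix i assume "i \<in> {..<n}"
    then have "int (g i) - int (g (n + i)) = \<nu> (i + 1)" using assms by (simp add: row_monos_def)
    then show "int (g i) + int (g (n + i)) = \<bar>\<nu> (i + 1)\<bar> + 2 * int (min (g i) (g (n + i)))" by (simp add: min_def)
  qed
  finally show ?thesis by (simp add: norm1_shift sum.distrib sum_distrib_left)
qed

text \<open>
  The cancelled pairs form an arbitrary vector of natural numbers with given sum, and stars
  and bars counts these.
\<close>

lemma card_row_monos:
  assumes n: "n \<ge> 1"
  shows "int (card (row_monos n \<nu> k)) = (if even (k - norm1 n \<nu>) then binom ((k - norm1 n \<nu>) div 2 + int n - 1) (int n - 1) else 0)"
proof (cases "even (k - norm1 n \<nu>) \<and> k - norm1 n \<nu> \<ge> 0")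
  case False
  have "row_monos n \<nu> k = {}"
  proof (rule ccontr)
    assume "row_monos n \<nu> k \<noteq> {}"
    then obtain g where "k = norm1 n \<nu> + 2 * (\<Sum>i<n. int (min (g i) (g (n + i))))" using row_monos_sum by blast
    moreover have "(\<Sum>i<n. int (min (g i) (g (n + i)))) \<ge> 0" by (intro sum_nonneg) simp
    ultimately show False using False by simp
  qed
  then show ?thesis using False by (auto simp: binom_def)
next
  case True
  define t where "t = nat ((k - norm1 n \<nu>) div 2)"
  have t: "k = norm1 n \<nu> + 2 * int t" using True by (auto simp: t_def elim!: evenE)
  define L where "L = {xs::nat list. length xs = n \<and> sum_list xs = t}"
  have sl: "sum_list xs = (\<Sum>i<length xs. xs ! i)" for xs :: "nat list"
    by (simp add: sum_list_sum_nth lessThan_atLeast0)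
  let ?mins = "\<lambda>g. map (\<lambda>i. min (g i) (g (n + i))) [0..<n]"
  let ?back = "\<lambda>xs a. if a < n then xs ! a + nat (\<nu> (a + 1))
      else if a < 2 * n then xs ! (a - n) + nat (- \<nu> (a - n + 1)) else 0"
  have "bij_betw ?mins (row_monos n \<nu> k) L"
  proof (rule bij_betw_byWitness[where f' = ?back])
    show "\<forall>g\<in>row_monos n \<nu> k. ?back (?mins g) = g"
    proof (intro ballI ext)
      fix g a assume g: "g \<in> row_monos n \<nu> k"
      have e: "int (g i) - int (g (n + i)) = \<nu> (i + 1)" if "i < n" for i using g that by (simp add: row_monos_def)
      consider "a < n" | "\<not> a < n" "a < 2 * n" | "\<not> a < 2 * n" by linarith
      then show "?back (?mins g) a = g a"
      proof cases
        case 1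
        then show ?thesis using e[of a] by simp
      next
        case 2
        then have "a - n < n" "n + (a - n) = a" by auto
        then show ?thesis using 2 e[of "a - n"] by simp linarith
      next
        case 3
        then show ?thesis using g by (simp add: row_monos_def)
      qed
    qed
    show "\<forall>xs\<in>L. ?mins (?back xs) = xs"
      by (auto simp: L_def intro!: nth_equalityI)
    show "?mins ` row_monos n \<nu> k \<subseteq> L"
    proof (rule image_subsetI)
      fix g assume g: "g \<in> row_monos n \<nu> k"
      have "2 * int t = 2 * (\<Sum>i<n. int (min (g i) (g (n + i))))" using row_monos_sum[OF g] t by linarith
      then have "int (\<Sum>i<n. min (g i) (g (n + i))) = int t" by (simp only: of_nat_sum)
      then have "(\<Sum>i<n. min (g i) (g (n + i))) = t" by (simp only: of_nat_eq_iff)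
      then show "?mins g \<in> L" unfolding L_def sl by simp
    qed
    show "?back ` L \<subseteq> row_monos n \<nu> k"
    proof (rule image_subsetI)
      fix xs assume xs: "xs \<in> L"
      have "length xs = n" "(\<Sum>i<length xs. xs ! i) = t" using xs unfolding L_def sl by blast+
      then have "(\<Sum>i<n. xs ! i) = t" by (simp only:)
      then have "(\<Sum>i<n. int (xs ! i)) = int t" by (metis of_nat_sum)
      moreover have "(\<Sum>i<n. int (xs ! i + nat (\<nu> (i + 1)))) + (\<Sum>i<n. int (xs ! i + nat (- \<nu> (i + 1)))) =
          (\<Sum>i<n. \<bar>\<nu> (i + 1)\<bar> + 2 * int (xs ! i))"
        unfolding sum.distrib[symmetric] by (intro sum.cong) auto
      ultimately have "(\<Sum>i<n. int (xs ! i + nat (\<nu> (i + 1)))) + (\<Sum>i<n. int (xs ! i + nat (- \<nu> (i + 1)))) = k"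
        using t by (simp only: sum.distrib sum_distrib_left[symmetric] norm1_shift)
      then show "?back xs \<in> row_monos n \<nu> k"
        unfolding row_monos_def sum_double by auto
    qed
  qed
  then have "card (row_monos n \<nu> k) = card L" by (rule bij_betw_same_card)
  also have "\<dots> = (t + n - 1) choose t" unfolding L_def by (rule card_length_sum_list)
  also have "\<dots> = (t + n - 1) choose (n - 1)" using n by (subst binomial_symmetric) auto
  finally have "int (card (row_monos n \<nu> k)) = int ((t + n - 1) choose (n - 1))" by simp
  moreover have "(k - norm1 n \<nu>) div 2 = int t" using t by simp
  moreover have "nat (int t + int n - 1) = t + n - 1" "nat (int n - 1) = n - 1" using n by auto
  ultimately show ?thesis using True n by (simp add: binom_def)
qed

lemma finite_row_monos: "finite (row_monos n \<nu> k)"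
proof (rule finite_subset)
  show "finite {g. \<forall>a. (a \<in> {..<2*n} \<longrightarrow> g a \<in> {..nat k}) \<and> (a \<notin> {..<2*n} \<longrightarrow> g a = 0)}"
    by (rule finite_set_of_finite_funs) auto
  have "g a \<le> nat k" if "g \<in> row_monos n \<nu> k" "a < 2 * n" for g a
    using member_le_sum[of a "{..<2*n}" "\<lambda>a. int (g a)"] that by (auto simp: row_monos_def)
  then show "row_monos n \<nu> k \<subseteq> {g. \<forall>a. (a \<in> {..<2*n} \<longrightarrow> g a \<in> {..nat k}) \<and> (a \<notin> {..<2*n} \<longrightarrow> g a = 0)}"
    by (auto simp: row_monos_def)
qed

definition int_vecs :: "nat \<Rightarrow> nat \<Rightarrow> (nat \<Rightarrow> int) set" where
  "int_vecs n N = {\<eta> \<in> {1..n} \<rightarrow>\<^sub>E UNIV. norm1 n \<eta> = int N}"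

lemma finite_int_vecs: "finite (int_vecs n N)"
proof (rule finite_subset)
  show "finite ({1..n} \<rightarrow>\<^sub>E {- int N..int N})" by (intro finite_PiE) auto
  show "int_vecs n N \<subseteq> {1..n} \<rightarrow>\<^sub>E {- int N..int N}"
  proof
    fix \<eta> assume \<eta>: "\<eta> \<in> int_vecs n N"
    have "\<bar>\<eta> i\<bar> \<le> int N" if "i \<in> {1..n}" for i
      using member_le_sum[of i "{1..n}" "\<lambda>i. \<bar>\<eta> i\<bar>"] that \<eta> by (auto simp: int_vecs_def norm1_def)
    then have "\<eta> i \<in> {- int N..int N}" if "i \<in> {1..n}" for i
      using that unfolding abs_le_iff atLeastAtMost_iff by (metis minus_le_iff)
    with \<eta> show "\<eta> \<in> {1..n} \<rightarrow>\<^sub>E {- int N..int N}" by (simp add: int_vecs_def PiE_iff)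
  qed
qed

lemma norm1_nonneg: "norm1 n a \<ge> 0" by (simp add: norm1_def sum_nonneg)

lemma wt_monos_iff:
  "m \<in> wt_monos n \<mu> k l \<longleftrightarrow> (\<forall>s a. \<not> a < 2 * n \<longrightarrow> m (s, a) = 0) \<and> (\<Sum>a<2*n. int (m (False, a))) = k \<and>
     (\<Sum>a<2*n. int (m (True, a))) = l \<and> (\<forall>i<n. int (m (False, i)) - int (m (False, n + i)) + (int (m (True, i)) - int (m (True, n + i))) = \<mu> (i + 1))"
proof -
  have "(\<forall>i<n. (\<Sum>v\<in>vars n. wt_coef n i v * int (m v)) = \<mu> (i + 1)) \<longleftrightarrow>
    (\<forall>i<n. int (m (False, i)) - int (m (False, n + i)) + (int (m (True, i)) - int (m (True, n + i))) = \<mu> (i + 1))"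
    by (simp only: sum_wt_coef cong: imp_cong)
  then show ?thesis unfolding wt_monos_def mem_Collect_eq by (simp add: sum_vars degx_def degy_def)
qed

text \<open>The weight of the $y$-part of a monomial runs over all integer vectors.\<close>

lemma card_wt_monos_split:
  "int (card (wt_monos n \<mu> k l)) = (\<Sum>N\<in>{N. int N \<le> l}. \<Sum>\<eta>\<in>int_vecs n N.
     int (card (row_monos n (\<lambda>i. \<mu> i - \<eta> i) k)) * int (card (row_monos n \<eta> l)))"
proof -
  \<comment> \<open>The norm is carried along as a separate index, to match the outer sum of the formula.\<close>
  define I where "I = Sigma {N. int N \<le> l} (int_vecs n)"
  define B where "B p = row_monos n (\<lambda>i. \<mu> i - snd p i) k \<times> row_monos n (snd p) l" for p :: "nat \<times> (nat \<Rightarrow> int)"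
  define W where "W m = (\<lambda>i\<in>{1..n}. int (m (True, i - 1)) - int (m (True, n + i - 1)))" for m :: "bool \<times> nat \<Rightarrow> nat"
  have W1: "W m (i + 1) = int (m (True, i)) - int (m (True, n + i))" if "i < n" for m i
    using that by (simp add: W_def)
  have NW: "norm1 n (W m) \<le> l" if "m \<in> wt_monos n \<mu> k l" for m
  proof -
    have "norm1 n (W m) \<le> (\<Sum>i<n. int (m (True, i)) + int (m (True, n + i)))"
      unfolding norm1_shift
    proof (intro sum_mono)
      fix i assume "i \<in> {..<n}"
      then show "\<bar>W m (i + 1)\<bar> \<le> int (m (True, i)) + int (m (True, n + i))" using W1[of i m] by simp
    qed
    then show ?thesis using that by (simp add: wt_monos_iff sum_double sum.distrib)
  qed
  have fin: "finite {N. int N \<le> l}" by (rule finite_subset[of _ "{..nat l}"]) auto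
  let ?fw = "\<lambda>m. ((nat (norm1 n (W m)), W m), (\<lambda>a. m (False, a)), (\<lambda>a. m (True, a)))"
  let ?back = "\<lambda>(p, g, h) (s, a). if s then h a else g a"
  have "bij_betw ?fw (wt_monos n \<mu> k l) (Sigma I B)"
  proof (rule bij_betw_byWitness[where f' = ?back])
    show "\<forall>m\<in>wt_monos n \<mu> k l. ?back (?fw m) = m"
      by (auto simp: fun_eq_iff)
    show "\<forall>y\<in>Sigma I B. ?fw (?back y) = y"
    proof
      fix y assume "y \<in> Sigma I B"
      then obtain N \<eta> g h where y: "y = ((N, \<eta>), g, h)" "\<eta> \<in> int_vecs n N" "h \<in> row_monos n \<eta> l" by (auto simp: I_def B_def)
      have "W (\<lambda>(s, a). if s then h a else g a) = \<eta>"
      proof (rule PiE_ext[of _ "{1..n}" "\<lambda>_. UNIV"])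
        show "\<eta> \<in> {1..n} \<rightarrow>\<^sub>E UNIV" using y(2) by (simp add: int_vecs_def)
        show "W (\<lambda>(s, a). if s then h a else g a) \<in> {1..n} \<rightarrow>\<^sub>E UNIV" by (simp add: W_def)
        fix i assume i: "i \<in> {1..n}"
        then have "i - 1 < n" by auto
        then have "int (h (i - 1)) - int (h (n + (i - 1))) = \<eta> (i - 1 + 1)" using y(3) unfolding row_monos_def by blast
        then show "W (\<lambda>(s, a). if s then h a else g a) i = \<eta> i" using i by (simp add: W_def)
      qed
      then show "?fw (?back y) = y"
        using y by (simp add: int_vecs_def)
    qed
    show "?fw ` wt_monos n \<mu> k l \<subseteq> Sigma I B"
    proof (rule image_subsetI)
      fix m assume m: "m \<in> wt_monos n \<mu> k l"
      have "(nat (norm1 n (W m)), W m) \<in> I"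
        using NW[OF m] norm1_nonneg[of n "W m"] by (simp add: I_def int_vecs_def) (simp add: W_def)
      moreover have "(\<lambda>a. m (True, a)) \<in> row_monos n (W m) l"
        using m W1[of _ m] by (simp add: row_monos_def wt_monos_iff)
      moreover have "(\<lambda>a. m (False, a)) \<in> row_monos n (\<lambda>i. \<mu> i - W m i) k"
      proof -
        have "int (m (False, i)) - int (m (False, n + i)) = \<mu> (i + 1) - W m (i + 1)" if "i < n" for i
        proof -
          have "int (m (False, i)) - int (m (False, n + i)) + (int (m (True, i)) - int (m (True, n + i))) = \<mu> (i + 1)"
            using m that unfolding wt_monos_iff by blast
          then show ?thesis unfolding W1[OF that] by linarith
        qed
        then show ?thesis using m unfolding row_monos_def wt_monos_iff by blast
      qed
      ultimately show "?fw m \<in> Sigma I B"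
        by (simp add: B_def)
    qed
    show "?back ` Sigma I B \<subseteq> wt_monos n \<mu> k l"
    proof (rule image_subsetI)
      fix y assume "y \<in> Sigma I B"
      then obtain N \<eta> g h where y: "y = ((N, \<eta>), g, h)" "g \<in> row_monos n (\<lambda>i. \<mu> i - \<eta> i) k" "h \<in> row_monos n \<eta> l" by (auto simp: I_def B_def)
      have "int (g i) - int (g (n + i)) + (int (h i) - int (h (n + i))) = \<mu> (i + 1)" if "i < n" for i
        using y(2,3) that by (simp add: row_monos_def)
      then show "?back y \<in> wt_monos n \<mu> k l"
        using y unfolding wt_monos_iff by (auto simp: row_monos_def)
    qed
  qed
  then have "card (wt_monos n \<mu> k l) = card (Sigma I B)" by (rule bij_betw_same_card)
  also have "\<dots> = (\<Sum>p\<in>I. card (B p))"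
    using fin by (intro card_SigmaI) (auto simp: I_def B_def finite_int_vecs finite_row_monos)
  also have "\<dots> = (\<Sum>N\<in>{N. int N \<le> l}. \<Sum>\<eta>\<in>int_vecs n N. card (B (N, \<eta>)))"
    unfolding I_def by (subst sum.Sigma) (auto simp: fin finite_int_vecs)
  finally show ?thesis by (simp add: B_def card_cartesian_product)
qed

section \<open>Counting subsets class by class\<close>

lemma card_split:
  assumes "finite I" "finite X" "\<And>i. i \<in> I \<Longrightarrow> P i \<Longrightarrow> f i \<in> X"
  shows "card {i\<in>I. P i} = (\<Sum>x\<in>X. card {i\<in>I. f i = x \<and> P i})"
proof -
  have "card {i\<in>I. P i} = (\<Sum>i\<in>{i\<in>I. P i}. 1)" by simp
  also have "\<dots> = (\<Sum>x\<in>X. \<Sum>i\<in>{i\<in>{i\<in>I. P i}. f i = x}. 1)"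
    by (rule sum.group[symmetric]) (use assms in auto)
  also have "\<dots> = (\<Sum>x\<in>X. card {i\<in>I. f i = x \<and> P i})"
    by (intro sum.cong refl) (simp add: conj_ac)
  finally show ?thesis .
qed

lemma card_subset_product:
  assumes I: "finite I" and disj: "\<And>s t. s \<in> I \<Longrightarrow> t \<in> I \<Longrightarrow> s \<noteq> t \<Longrightarrow> C s \<inter> C t = {}"
    and F: "\<And>t. t \<in> I \<Longrightarrow> F t \<subseteq> Pow (C t)"
  shows "card {S. S \<subseteq> (\<Union>t\<in>I. C t) \<and> (\<forall>t\<in>I. S \<inter> C t \<in> F t)} = (\<Prod>t\<in>I. card (F t))"
proof -
  have "bij_betw (\<lambda>S. \<lambda>t\<in>I. S \<inter> C t) {S. S \<subseteq> (\<Union>t\<in>I. C t) \<and> (\<forall>t\<in>I. S \<inter> C t \<in> F t)} (PiE I F)"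
  proof (rule bij_betw_byWitness[where f' = "\<lambda>f. \<Union>t\<in>I. f t"])
    have inter: "(\<Union>s\<in>I. f s) \<inter> C t = f t" if "f \<in> PiE I F" "t \<in> I" for f t
    proof -
      have "f s \<subseteq> C s" if "s \<in> I" for s using F that \<open>f \<in> PiE I F\<close> by (auto simp: PiE_iff)
      then show ?thesis using disj that(2) by blast
    qed
    show "\<forall>f\<in>PiE I F. (\<lambda>t\<in>I. (\<Union>s\<in>I. f s) \<inter> C t) = f"
    proof
      fix f assume f: "f \<in> PiE I F"
      show "(\<lambda>t\<in>I. (\<Union>s\<in>I. f s) \<inter> C t) = f"
      proof (rule ext)
        fix t show "(\<lambda>t\<in>I. (\<Union>s\<in>I. f s) \<inter> C t) t = f t"
          using inter[OF f, of t] PiE_arb[OF f, of t] by (cases "t \<in> I") auto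
      qed
    qed
    show "(\<lambda>f. \<Union>t\<in>I. f t) ` PiE I F \<subseteq> {S. S \<subseteq> (\<Union>t\<in>I. C t) \<and> (\<forall>t\<in>I. S \<inter> C t \<in> F t)}"
    proof (rule image_subsetI, rule CollectI, rule conjI)
      fix f assume f: "f \<in> PiE I F"
      show "(\<Union>t\<in>I. f t) \<subseteq> (\<Union>t\<in>I. C t)" using F f by (fastforce simp: PiE_iff)
      show "\<forall>t\<in>I. (\<Union>t\<in>I. f t) \<inter> C t \<in> F t" using inter[OF f] f by (auto simp: PiE_iff)
    qed
  qed auto
  then have "card {S. S \<subseteq> (\<Union>t\<in>I. C t) \<and> (\<forall>t\<in>I. S \<inter> C t \<in> F t)} = card (PiE I F)" by (rule bij_betw_same_card)
  then show ?thesis using I by (simp add: card_PiE)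
qed

text \<open>
  Class 0 will be the positions where $\mu$ vanishes. There the sign is arbitrary, hence the
  power of two; in the other classes the number of positions with the preferred sign is
  prescribed.
\<close>

lemma card_subset_pairs:
  fixes C :: "nat \<Rightarrow> 'a set"
  assumes fin: "\<And>t. t \<le> J \<Longrightarrow> finite (C t)"
    and disj: "\<And>s t. s \<le> J \<Longrightarrow> t \<le> J \<Longrightarrow> s \<noteq> t \<Longrightarrow> C s \<inter> C t = {}"
  shows "card {(S, Q). S \<subseteq> (\<Union>t\<le>J. C t) \<and> Q \<subseteq> S \<and> (\<forall>t\<le>J. card (S \<inter> C t) = b t) \<and> (\<forall>t\<in>{1..J}. card (Q \<inter> C t) = a t)}
    = 2 ^ b 0 * (\<Prod>t\<le>J. card (C t) choose b t) * (\<Prod>t=1..J. b t choose a t)"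
proof -
  let ?U = "\<Union>t\<le>J. C t"
  define SS where "SS = {S. S \<subseteq> ?U \<and> (\<forall>t\<in>{..J}. S \<inter> C t \<in> {T. T \<subseteq> C t \<and> card T = b t})}"
  define QS where "QS S = {Q. Q \<subseteq> S \<and> (\<forall>t\<in>{1..J}. card (Q \<inter> C t) = a t)}" for S
  have finU: "finite ?U" using fin by auto
  have finS: "finite SS" unfolding SS_def by (rule finite_subset[of _ "Pow ?U"]) (use finU in auto)
  have cS: "card SS = (\<Prod>t\<le>J. card (C t) choose b t)"
    unfolding SS_def using fin disj
    by (subst card_subset_product) (auto simp: n_subsets)
  have cQ: "card (QS S) = 2 ^ b 0 * (\<Prod>t=1..J. b t choose a t)" if S: "S \<in> SS" for S
  proof -
    define F where "F t = (if t = 0 then Pow (S \<inter> C 0) else {T. T \<subseteq> S \<inter> C t \<and> card T = a t})" for t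
    have SU: "S = (\<Union>t\<le>J. S \<inter> C t)" using S by (auto simp: SS_def)
    have "QS S = {Q. Q \<subseteq> (\<Union>t\<le>J. S \<inter> C t) \<and> (\<forall>t\<in>{..J}. Q \<inter> (S \<inter> C t) \<in> F t)}"
    proof (rule equalityI; rule subsetI)
      fix Q assume Q: "Q \<in> QS S"
      have "Q \<inter> (S \<inter> C t) = Q \<inter> C t" for t using Q by (auto simp: QS_def)
      then show "Q \<in> {Q. Q \<subseteq> (\<Union>t\<le>J. S \<inter> C t) \<and> (\<forall>t\<in>{..J}. Q \<inter> (S \<inter> C t) \<in> F t)}"
        using Q SU unfolding QS_def F_def by auto
    next
      fix Q assume Q: "Q \<in> {Q. Q \<subseteq> (\<Union>t\<le>J. S \<inter> C t) \<and> (\<forall>t\<in>{..J}. Q \<inter> (S \<inter> C t) \<in> F t)}"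
      then have "Q \<subseteq> S" using SU by auto
      then have "Q \<inter> (S \<inter> C t) = Q \<inter> C t" for t by auto
      moreover have "Q \<inter> (S \<inter> C t) \<in> F t" if "t \<in> {1..J}" for t using Q that by auto
      ultimately have "Q \<inter> C t \<in> F t" if "t \<in> {1..J}" for t using that by (simp only:)
      then have "card (Q \<inter> C t) = a t" if "t \<in> {1..J}" for t using that unfolding F_def by force
      then show "Q \<in> QS S" using \<open>Q \<subseteq> S\<close> unfolding QS_def by blast
    qed
    also have "card \<dots> = (\<Prod>t\<le>J. card (F t))"
      using disj by (intro card_subset_product) (auto simp: F_def)
    also have "\<dots> = card (F 0) * (\<Prod>t=1..J. card (F t))"
      by (simp add: atMost_atLeast0 prod.atLeast_Suc_atMost)
    also have "card (F 0) = 2 ^ b 0"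
    proof -
      have "F 0 = Pow (S \<inter> C 0)" by (simp add: F_def)
      moreover have "finite (S \<inter> C 0)" "card (S \<inter> C 0) = b 0" using S fin[of 0] by (auto simp: SS_def)
      ultimately show ?thesis by (simp only: card_Pow)
    qed
    also have "(\<Prod>t=1..J. card (F t)) = (\<Prod>t=1..J. b t choose a t)"
    proof (intro prod.cong refl)
      fix t assume t: "t \<in> {1..J}"
      then have "card (S \<inter> C t) = b t" "finite (S \<inter> C t)" using S fin[of t] by (auto simp: SS_def)
      moreover have "F t = {T. T \<subseteq> S \<inter> C t \<and> card T = a t}" using t by (simp add: F_def)
      ultimately show "card (F t) = b t choose a t" by (simp only: n_subsets)
    qed
    finally show ?thesis .
  qed
  have "{(S, Q). S \<subseteq> ?U \<and> Q \<subseteq> S \<and> (\<forall>t\<le>J. card (S \<inter> C t) = b t) \<and> (\<forall>t\<in>{1..J}. card (Q \<inter> C t) = a t)} = Sigma SS QS"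
  proof (rule equalityI; rule subsetI)
    fix x assume "x \<in> {(S, Q). S \<subseteq> ?U \<and> Q \<subseteq> S \<and> (\<forall>t\<le>J. card (S \<inter> C t) = b t) \<and> (\<forall>t\<in>{1..J}. card (Q \<inter> C t) = a t)}"
    then show "x \<in> Sigma SS QS" by (cases x) (simp add: SS_def QS_def)
  next
    fix x assume "x \<in> Sigma SS QS"
    then show "x \<in> {(S, Q). S \<subseteq> ?U \<and> Q \<subseteq> S \<and> (\<forall>t\<le>J. card (S \<inter> C t) = b t) \<and> (\<forall>t\<in>{1..J}. card (Q \<inter> C t) = a t)}"
      by (cases x) (simp add: SS_def QS_def)
  qed
  moreover have "finite (QS S)" if "S \<in> SS" for S
  proof -
    have "S \<subseteq> ?U" using that unfolding SS_def by blast
    then have "finite (Pow S)" using finU finite_subset by blast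
    moreover have "QS S \<subseteq> Pow S" unfolding QS_def by blast
    ultimately show ?thesis by (rule rev_finite_subset)
  qed
  ultimately show ?thesis using finS by (simp add: cQ cS)
qed

section \<open>Vectors with prescribed level counts\<close>

text \<open>
  The class $t$ of a position $i$ relative to the level $j = |\eta_i|$. If $\mu_i$ and
  $\eta_i$ have the same sign, the cancellation in $\mu_i - \eta_i$ is exactly $j + 1 - t$
  in each class.
\<close>

definition mu_cls :: "(nat \<Rightarrow> int) \<Rightarrow> nat \<Rightarrow> nat \<Rightarrow> nat \<Rightarrow> bool" where
  "mu_cls \<mu> j t i \<longleftrightarrow> (if t = 1 then int j \<le> \<bar>\<mu> i\<bar> else \<bar>\<mu> i\<bar> = int j - int t + 1)"

text \<open>
  The numbers $\beta^j_t$ and $\alpha^j_t$ of an integer vector, and the number of entries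
  of absolute value $j$ at zeros of $\mu$.
\<close>

definition cnt_cls where "cnt_cls n \<mu> \<eta> j t = int (card {i\<in>{1..n}. \<bar>\<eta> i\<bar> = int j \<and> mu_cls \<mu> j t i})"
definition cnt_pos where "cnt_pos n \<mu> \<eta> j t = int (card {i\<in>{1..n}. \<bar>\<eta> i\<bar> = int j \<and> mu_cls \<mu> j t i \<and> \<eta> i * \<mu> i > 0})"
definition cnt_zero where "cnt_zero n \<mu> \<eta> j = int (card {i\<in>{1..n}. \<bar>\<eta> i\<bar> = int j \<and> \<mu> i = 0})"

definition level_counts where
  "level_counts n \<mu> z \<beta> \<alpha> \<eta> j \<longleftrightarrow> cnt_zero n \<mu> \<eta> j = z j \<and> (\<forall>t\<in>{1..j}. cnt_cls n \<mu> \<eta> j t = \<beta> j t \<and> cnt_pos n \<mu> \<eta> j t = \<alpha> j t)"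

text \<open>
  Integer vectors whose nonzero entries have absolute values between $J$ and $N$, with
  prescribed counts at each of these levels.
\<close>

definition partial_vecs :: "nat \<Rightarrow> (nat \<Rightarrow> int) \<Rightarrow> nat \<Rightarrow> (nat \<Rightarrow> int) \<Rightarrow> (nat \<Rightarrow> nat \<Rightarrow> int) \<Rightarrow> (nat \<Rightarrow> nat \<Rightarrow> int) \<Rightarrow> nat \<Rightarrow> (nat \<Rightarrow> int) set" where
  "partial_vecs n \<mu> N z \<beta> \<alpha> J = {\<eta> \<in> {1..n} \<rightarrow>\<^sub>E UNIV. (\<forall>i\<in>{1..n}. \<eta> i = 0 \<or> (int J \<le> \<bar>\<eta> i\<bar> \<and> \<bar>\<eta> i\<bar> \<le> int N)) \<and>
     (\<forall>j\<in>{J..N}. level_counts n \<mu> z \<beta> \<alpha> \<eta> j)}"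

text \<open>
  The factor with index $j$ of the product in $C_n$, where $z_j = s_j - \sum_t \beta^j_t$.
\<close>

definition level_factor where
  "level_factor n L N z \<beta> \<alpha> j = 2 ^ nat (z j) * binom (\<beta> j 1) (\<alpha> j 1) *
     binom (int n - (\<Sum>t=0..j-1. L t) - (\<Sum>r'=j+1..N. \<Sum>s=1..r'-j+1. \<beta> r' s)) (\<beta> j 1) *
     binom (L 0 - (\<Sum>h=j+1..N. z h)) (z j) *
     (\<Prod>i=2..j. binom (L (j - i + 1) - (\<Sum>t=1..N-j. \<beta> (j + t) (i + t))) (\<beta> j i) * binom (\<beta> j i) (\<alpha> j i))"

lemma level_counts_cong:
  assumes "\<And>i. i \<in> {1..n} \<Longrightarrow> \<bar>\<eta> i\<bar> = int j \<or> \<bar>\<eta>' i\<bar> = int j \<Longrightarrow> \<eta> i = \<eta>' i"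
  shows "level_counts n \<mu> z \<beta> \<alpha> \<eta> j \<longleftrightarrow> level_counts n \<mu> z \<beta> \<alpha> \<eta>' j"
proof -
  have eq: "{i\<in>{1..n}. \<bar>\<eta> i\<bar> = int j \<and> P i (\<eta> i)} = {i\<in>{1..n}. \<bar>\<eta>' i\<bar> = int j \<and> P i (\<eta>' i)}" for P
  proof (rule Collect_cong)
    fix i show "(i \<in> {1..n} \<and> \<bar>\<eta> i\<bar> = int j \<and> P i (\<eta> i)) = (i \<in> {1..n} \<and> \<bar>\<eta>' i\<bar> = int j \<and> P i (\<eta>' i))"
    proof (cases "i \<in> {1..n} \<and> (\<bar>\<eta> i\<bar> = int j \<or> \<bar>\<eta>' i\<bar> = int j)")
      case True
      then have "\<eta> i = \<eta>' i" using assms by blast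
      then show ?thesis by (simp only:)
    next
      case False
      then show ?thesis by blast
    qed
  qed
  have "cnt_zero n \<mu> \<eta> j = cnt_zero n \<mu> \<eta>' j"
    unfolding cnt_zero_def by (simp only: eq[of "\<lambda>i _. \<mu> i = 0"])
  moreover have "cnt_cls n \<mu> \<eta> j t = cnt_cls n \<mu> \<eta>' j t" for t
    unfolding cnt_cls_def by (simp only: eq[of "\<lambda>i _. mu_cls \<mu> j t i"])
  moreover have "cnt_pos n \<mu> \<eta> j t = cnt_pos n \<mu> \<eta>' j t" for t
    unfolding cnt_pos_def by (simp only: eq[of "\<lambda>i e. mu_cls \<mu> j t i \<and> e * \<mu> i > 0"])
  ultimately show ?thesis unfolding level_counts_def by (simp only:)
qed

lemma finite_partial_vecs: "finite (partial_vecs n \<mu> N z \<beta> \<alpha> J)"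
proof (rule finite_subset)
  show "finite ({1..n} \<rightarrow>\<^sub>E {- int N..int N})" by (intro finite_PiE) auto
  show "partial_vecs n \<mu> N z \<beta> \<alpha> J \<subseteq> {1..n} \<rightarrow>\<^sub>E {- int N..int N}"
  proof
    fix \<eta> assume \<eta>: "\<eta> \<in> partial_vecs n \<mu> N z \<beta> \<alpha> J"
    have "\<eta> i \<in> {- int N..int N}" if "i \<in> {1..n}" for i
    proof -
      have "\<eta> i = 0 \<or> (int J \<le> \<bar>\<eta> i\<bar> \<and> \<bar>\<eta> i\<bar> \<le> int N)" using \<eta> that unfolding partial_vecs_def by blast
      then show ?thesis by auto
    qed
    moreover have "\<eta> \<in> {1..n} \<rightarrow>\<^sub>E UNIV" using \<eta> unfolding partial_vecs_def by blast
    ultimately show "\<eta> \<in> {1..n} \<rightarrow>\<^sub>E {- int N..int N}" by (simp add: PiE_iff)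
  qed
qed

lemma binom_of_nat: "binom (int a) (int b) = int (a choose b)"
  by (auto simp: binom_def)

definition size_cls :: "nat \<Rightarrow> (nat \<Rightarrow> int) \<Rightarrow> nat \<Rightarrow> nat \<Rightarrow> nat set" where
  "size_cls n \<mu> J t = {i\<in>{1..n}. if t = 0 then \<mu> i = 0 else mu_cls \<mu> J t i}"

lemma size_cls_disj: assumes "J \<ge> 1" "s \<le> J" "t \<le> J" "s \<noteq> t" shows "size_cls n \<mu> J s \<inter> size_cls n \<mu> J t = {}"
  using assms by (auto simp: size_cls_def mu_cls_def split: if_splits)

lemma size_cls_cover: assumes "J \<ge> 1" "i \<in> {1..n}" shows "\<exists>t\<le>J. i \<in> size_cls n \<mu> J t"
proof (cases "\<mu> i = 0 \<or> int J \<le> \<bar>\<mu> i\<bar>")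
  case True
  then show ?thesis
  proof
    assume "\<mu> i = 0" then show ?thesis using assms by (intro exI[of _ 0]) (auto simp: size_cls_def)
  next
    assume "int J \<le> \<bar>\<mu> i\<bar>" then show ?thesis using assms by (intro exI[of _ 1]) (auto simp: size_cls_def mu_cls_def)
  qed
next
  case False
  then show ?thesis using assms
    by (intro exI[of _ "nat (int J - \<bar>\<mu> i\<bar> + 1)"]) (auto simp: size_cls_def mu_cls_def)
qed

text \<open>
  The upper entries of the binomial coefficients: the number of positions in a class
  relative to $J$ that the levels above $J$ have not used. Class $1$ relative to $J$
  consists of the classes $1, \dots, h - J + 1$ relative to any higher level $h$; a class $i
  \ge 2$ relative to $J$ is the class $i + t$ relative to $J + t$.
\<close>

lemma free_count:
  assumes J: "1 \<le> J" "J \<le> N" and \<eta>: "\<eta> \<in> partial_vecs n \<mu> N z \<beta> \<alpha> (Suc J)"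
  shows "int (card ({i\<in>{1..n}. \<eta> i = 0} \<inter> size_cls n \<mu> J 0)) = ell n \<mu> 0 - (\<Sum>h=J+1..N. z h)"
    "int (card ({i\<in>{1..n}. \<eta> i = 0} \<inter> size_cls n \<mu> J 1)) = int n - (\<Sum>t=0..J-1. ell n \<mu> t) - (\<Sum>r'=J+1..N. \<Sum>s=1..r'-J+1. \<beta> r' s)"
    "\<And>i. i \<in> {2..J} \<Longrightarrow> int (card ({i\<in>{1..n}. \<eta> i = 0} \<inter> size_cls n \<mu> J i)) = ell n \<mu> (J - i + 1) - (\<Sum>t=1..N-J. \<beta> (J + t) (i + t))"
proof -
  have rng: "\<eta> i = 0 \<or> (int J < \<bar>\<eta> i\<bar> \<and> \<bar>\<eta> i\<bar> \<le> int N)" if "i \<in> {1..n}" for i using \<eta> that by (force simp: partial_vecs_def)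
  have lv: "cnt_zero n \<mu> \<eta> h = z h" "t \<in> {1..h} \<Longrightarrow> cnt_cls n \<mu> \<eta> h t = \<beta> h t" if "h \<in> {J+1..N}" for h t
    using \<eta> that by (auto simp: partial_vecs_def level_counts_def)
  have free: "int (card ({i\<in>{1..n}. \<eta> i = 0} \<inter> {i\<in>{1..n}. P i})) =
      int (card {i\<in>{1..n}. P i}) - (\<Sum>h=J+1..N. int (card {i\<in>{1..n}. \<bar>\<eta> i\<bar> = int h \<and> P i}))" for P
  proof -
    have "card {i\<in>{1..n}. P i} = (\<Sum>h\<in>insert 0 {J+1..N}. card {i\<in>{1..n}. nat \<bar>\<eta> i\<bar> = h \<and> P i})"
    proof (rule card_split)
      fix i assume "i \<in> {1..n}"
      from rng[OF this] show "nat \<bar>\<eta> i\<bar> \<in> insert 0 {J+1..N}" by auto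
    qed simp_all
    also have "\<dots> = card {i\<in>{1..n}. nat \<bar>\<eta> i\<bar> = 0 \<and> P i} + (\<Sum>h=J+1..N. card {i\<in>{1..n}. nat \<bar>\<eta> i\<bar> = h \<and> P i})"
      by (subst sum.insert) auto
    also have "{i\<in>{1..n}. nat \<bar>\<eta> i\<bar> = 0 \<and> P i} = {i\<in>{1..n}. \<eta> i = 0} \<inter> {i\<in>{1..n}. P i}" by auto
    also have "(\<Sum>h=J+1..N. card {i\<in>{1..n}. nat \<bar>\<eta> i\<bar> = h \<and> P i}) = (\<Sum>h=J+1..N. card {i\<in>{1..n}. \<bar>\<eta> i\<bar> = int h \<and> P i})"
      by (intro sum.cong refl arg_cong[of _ _ card]) auto
    finally show ?thesis by simp
  qed
  show "int (card ({i\<in>{1..n}. \<eta> i = 0} \<inter> size_cls n \<mu> J 0)) = ell n \<mu> 0 - (\<Sum>h=J+1..N. z h)"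
  proof -
    have "(\<Sum>h=J+1..N. int (card {i\<in>{1..n}. \<bar>\<eta> i\<bar> = int h \<and> \<mu> i = 0})) = (\<Sum>h=J+1..N. z h)"
      by (rule sum.cong[OF refl], rule lv(1)[unfolded cnt_zero_def])
    then show ?thesis using free[of "\<lambda>i. \<mu> i = 0"] by (simp add: size_cls_def ell_def)
  qed
  show "int (card ({i\<in>{1..n}. \<eta> i = 0} \<inter> size_cls n \<mu> J i)) = ell n \<mu> (J - i + 1) - (\<Sum>t=1..N-J. \<beta> (J + t) (i + t))"
    if i: "i \<in> {2..J}" for i
  proof -
    have "size_cls n \<mu> J i = {x\<in>{1..n}. \<bar>\<mu> x\<bar> = int (J - i + 1)}" using i by (auto simp: size_cls_def mu_cls_def)
    moreover have "(\<Sum>h=J+1..N. int (card {x\<in>{1..n}. \<bar>\<eta> x\<bar> = int h \<and> \<bar>\<mu> x\<bar> = int (J - i + 1)})) = (\<Sum>t=1..N-J. \<beta> (J + t) (i + t))"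
    proof (rule sum.reindex_bij_witness[of _ "\<lambda>t. J + t" "\<lambda>h. h - J"])
      fix h assume h: "h \<in> {J+1..N}"
      have "mu_cls \<mu> h (i + (h - J)) x \<longleftrightarrow> \<bar>\<mu> x\<bar> = int (J - i + 1)" for x using i h by (auto simp: mu_cls_def)
      then show "\<beta> (J + (h - J)) (i + (h - J)) = int (card {x\<in>{1..n}. \<bar>\<eta> x\<bar> = int h \<and> \<bar>\<mu> x\<bar> = int (J - i + 1)})"
      proof -
        have "i + (h - J) \<in> {1..h}" using i h by auto
        then have "cnt_cls n \<mu> \<eta> h (i + (h - J)) = \<beta> h (i + (h - J))" by (rule lv(2)[OF h])
        moreover have "J + (h - J) = h" using h by auto
        ultimately show ?thesis unfolding cnt_cls_def \<open>\<And>x. mu_cls \<mu> h (i + (h - J)) x \<longleftrightarrow> \<bar>\<mu> x\<bar> = int (J - i + 1)\<close>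
          by (simp only:)
      qed
    qed auto
    ultimately show ?thesis using free[of "\<lambda>x. \<bar>\<mu> x\<bar> = int (J - i + 1)"] by (simp add: ell_def)
  qed
  show "int (card ({i\<in>{1..n}. \<eta> i = 0} \<inter> size_cls n \<mu> J 1)) = int n - (\<Sum>t=0..J-1. ell n \<mu> t) - (\<Sum>r'=J+1..N. \<Sum>s=1..r'-J+1. \<beta> r' s)"
  proof -
    have K: "size_cls n \<mu> J 1 = {x\<in>{1..n}. int J \<le> \<bar>\<mu> x\<bar>}" by (auto simp: size_cls_def mu_cls_def)
    have "card {x\<in>{1..n}. True} = (\<Sum>h\<in>{0..J}. card {x\<in>{1..n}. min (nat \<bar>\<mu> x\<bar>) J = h \<and> True})"
      by (rule card_split) auto
    also have "\<dots> = (\<Sum>h\<in>insert J {0..J-1}. card {x\<in>{1..n}. min (nat \<bar>\<mu> x\<bar>) J = h})"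
      using J by (intro sum.cong) auto
    also have "\<dots> = card {x\<in>{1..n}. min (nat \<bar>\<mu> x\<bar>) J = J} + (\<Sum>h=0..J-1. card {x\<in>{1..n}. min (nat \<bar>\<mu> x\<bar>) J = h})"
      using J by (subst sum.insert) auto
    also have "{x\<in>{1..n}. min (nat \<bar>\<mu> x\<bar>) J = J} = {x\<in>{1..n}. int J \<le> \<bar>\<mu> x\<bar>}" by auto
    also have "(\<Sum>h=0..J-1. card {x\<in>{1..n}. min (nat \<bar>\<mu> x\<bar>) J = h}) = (\<Sum>h=0..J-1. card {x\<in>{1..n}. \<bar>\<mu> x\<bar> = int h})"
      using J by (intro sum.cong refl arg_cong[of _ _ card]) auto
    finally have c: "card {x\<in>{1..n}. True} = card {x\<in>{1..n}. int J \<le> \<bar>\<mu> x\<bar>} + (\<Sum>h=0..J-1. card {x\<in>{1..n}. \<bar>\<mu> x\<bar> = int h})" .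
    have "{x\<in>{1..n}. True} = {1..n}" by blast
    then have "card {x\<in>{1..n}. True} = n" by (simp only: card_atLeastAtMost diff_Suc_1)
    then have "int n = int (card {x\<in>{1..n}. int J \<le> \<bar>\<mu> x\<bar>}) + (\<Sum>h=0..J-1. int (card {x\<in>{1..n}. \<bar>\<mu> x\<bar> = int h}))"
      using arg_cong[OF c, of int] by (simp only: of_nat_add of_nat_sum)
    then have 1: "int (card {x\<in>{1..n}. int J \<le> \<bar>\<mu> x\<bar>}) = int n - (\<Sum>t=0..J-1. ell n \<mu> t)"
      unfolding ell_def by linarith
    have "(\<Sum>h=J+1..N. int (card {x\<in>{1..n}. \<bar>\<eta> x\<bar> = int h \<and> int J \<le> \<bar>\<mu> x\<bar>})) = (\<Sum>h=J+1..N. \<Sum>s=1..h-J+1. \<beta> h s)"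
    proof (intro sum.cong refl)
      fix h assume h: "h \<in> {J+1..N}"
      define f where "f x = (if int h \<le> \<bar>\<mu> x\<bar> then 1 else nat (int h - \<bar>\<mu> x\<bar> + 1))" for x
      have "card {x\<in>{1..n}. \<bar>\<eta> x\<bar> = int h \<and> int J \<le> \<bar>\<mu> x\<bar>} = (\<Sum>s\<in>{1..h-J+1}. card {x\<in>{1..n}. f x = s \<and> \<bar>\<eta> x\<bar> = int h \<and> int J \<le> \<bar>\<mu> x\<bar>})"
        by (rule card_split) (use h in \<open>auto simp: f_def\<close>)
      also have "\<dots> = (\<Sum>s\<in>{1..h-J+1}. card {x\<in>{1..n}. \<bar>\<eta> x\<bar> = int h \<and> mu_cls \<mu> h s x})"
      proof (rule sum.cong[OF refl])
        fix s assume s: "s \<in> {1..h-J+1}"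
        have "(f x = s \<and> int J \<le> \<bar>\<mu> x\<bar>) \<longleftrightarrow> mu_cls \<mu> h s x" for x
        proof (cases "int h \<le> \<bar>\<mu> x\<bar>")
          case True
          then show ?thesis using s h by (simp add: f_def mu_cls_def)
        next
          case False
          then show ?thesis using s h by (simp add: f_def mu_cls_def) linarith
        qed
        then have "{x\<in>{1..n}. f x = s \<and> \<bar>\<eta> x\<bar> = int h \<and> int J \<le> \<bar>\<mu> x\<bar>} = {x\<in>{1..n}. \<bar>\<eta> x\<bar> = int h \<and> mu_cls \<mu> h s x}"
          by blast
        then show "card {x\<in>{1..n}. f x = s \<and> \<bar>\<eta> x\<bar> = int h \<and> int J \<le> \<bar>\<mu> x\<bar>} = card {x\<in>{1..n}. \<bar>\<eta> x\<bar> = int h \<and> mu_cls \<mu> h s x}"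
          by (simp only:)
      qed
      finally have "int (card {x\<in>{1..n}. \<bar>\<eta> x\<bar> = int h \<and> int J \<le> \<bar>\<mu> x\<bar>}) = (\<Sum>s=1..h-J+1. cnt_cls n \<mu> \<eta> h s)"
        by (simp add: cnt_cls_def)
      also have "\<dots> = (\<Sum>s=1..h-J+1. \<beta> h s)" using h J by (intro sum.cong refl lv(2)) auto
      finally show "int (card {x\<in>{1..n}. \<bar>\<eta> x\<bar> = int h \<and> int J \<le> \<bar>\<mu> x\<bar>}) = (\<Sum>s=1..h-J+1. \<beta> h s)" .
    qed
    then show ?thesis using free[of "\<lambda>x. int J \<le> \<bar>\<mu> x\<bar>"] 1 unfolding K by simp
  qed
qed

text \<open>
  A sign that is also defined, as $+1$, at zeros of $\mu$, so that both choices of sign can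
  be treated alike there.
\<close>

definition sgn1 :: "int \<Rightarrow> int" where "sgn1 x = (if x < 0 then - 1 else 1)"

lemma sgn1_abs [simp]: "\<bar>sgn1 x\<bar> = 1" by (simp add: sgn1_def)

lemma level_counts_top:
  assumes J: "J \<ge> 1"
    and S: "S = {i\<in>{1..n}. \<bar>\<eta> i\<bar> = int J}" and Q: "Q = {i\<in>{1..n}. \<eta> i = int J * sgn1 (\<mu> i)}"
  shows "level_counts n \<mu> z \<beta> \<alpha> \<eta> J \<longleftrightarrow> int (card (S \<inter> size_cls n \<mu> J 0)) = z J \<and>
     (\<forall>t\<in>{1..J}. int (card (S \<inter> size_cls n \<mu> J t)) = \<beta> J t \<and> int (card (Q \<inter> size_cls n \<mu> J t)) = \<alpha> J t)"
proof -
  have "cnt_zero n \<mu> \<eta> J = int (card (S \<inter> size_cls n \<mu> J 0))"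
    unfolding cnt_zero_def S size_cls_def by (intro arg_cong[of _ _ int] arg_cong[of _ _ card]) auto
  moreover have "cnt_cls n \<mu> \<eta> J t = int (card (S \<inter> size_cls n \<mu> J t))" if "t \<in> {1..J}" for t
    unfolding cnt_cls_def S size_cls_def using that by (intro arg_cong[of _ _ int] arg_cong[of _ _ card]) auto
  moreover have "cnt_pos n \<mu> \<eta> J t = int (card (Q \<inter> size_cls n \<mu> J t))" if t: "t \<in> {1..J}" for t
  proof -
    have "(\<bar>\<eta> i\<bar> = int J \<and> mu_cls \<mu> J t i \<and> \<eta> i * \<mu> i > 0) \<longleftrightarrow> (\<eta> i = int J * sgn1 (\<mu> i) \<and> mu_cls \<mu> J t i)" for i
    proof (cases "mu_cls \<mu> J t i")
      case True
      then have "\<mu> i \<noteq> 0" using t by (auto simp: mu_cls_def split: if_splits)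
      then show ?thesis using True J
        by (cases "\<mu> i > 0") (auto simp: sgn1_def zero_less_mult_iff)
    qed simp
    then have "{i\<in>{1..n}. \<bar>\<eta> i\<bar> = int J \<and> mu_cls \<mu> J t i \<and> \<eta> i * \<mu> i > 0} = Q \<inter> size_cls n \<mu> J t"
      using t unfolding Q size_cls_def by auto
    then show ?thesis by (simp only: cnt_pos_def)
  qed
  ultimately show ?thesis unfolding level_counts_def by auto
qed

text \<open>
  A vector is determined by its entries of absolute value larger than $J$, by the set $S$ of
  positions with absolute value $J$, and by the subset $Q$ of those where the sign is that
  of $\mu$.
\<close>

lemma card_partial_vecs_step:
  assumes J: "1 \<le> J" "J \<le> N"
    and nn: "z J \<ge> 0" "\<And>t. t \<in> {1..J} \<Longrightarrow> \<beta> J t \<ge> 0" "\<And>t. t \<in> {1..J} \<Longrightarrow> \<alpha> J t \<ge> 0"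
  shows "int (card (partial_vecs n \<mu> N z \<beta> \<alpha> J)) = int (card (partial_vecs n \<mu> N z \<beta> \<alpha> (Suc J))) * level_factor n (ell n \<mu>) N z \<beta> \<alpha> J"
proof -
  let ?X = "partial_vecs n \<mu> N z \<beta> \<alpha>" and ?lev = "level_counts n \<mu> z \<beta> \<alpha>"
  define b where "b t = (if t = 0 then nat (z J) else nat (\<beta> J t))" for t
  define a where "a t = nat (\<alpha> J t)" for t
  define Av where "Av \<eta> = {i\<in>{1..n}. \<eta> i = 0}" for \<eta> :: "nat \<Rightarrow> int"
  define C where "C \<eta> t = Av \<eta> \<inter> size_cls n \<mu> J t" for \<eta> t
  define P where "P \<eta> = {(S, Q). S \<subseteq> (\<Union>t\<le>J. C \<eta> t) \<and> Q \<subseteq> S \<and> (\<forall>t\<le>J. card (S \<inter> C \<eta> t) = b t) \<and> (\<forall>t\<in>{1..J}. card (Q \<inter> C \<eta> t) = a t)}" for \<eta>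
  have CU: "(\<Union>t\<le>J. C \<eta> t) = Av \<eta>" for \<eta>
    using size_cls_cover[OF J(1)] by (fastforce simp: C_def Av_def)
  have Ci: "S \<inter> C \<eta> t = S \<inter> size_cls n \<mu> J t" if "S \<subseteq> Av \<eta>" for S \<eta> t using that by (auto simp: C_def)
  have P_iff: "(S, Q) \<in> P \<eta> \<longleftrightarrow> S \<subseteq> Av \<eta> \<and> Q \<subseteq> S \<and> int (card (S \<inter> size_cls n \<mu> J 0)) = z J \<and>
     (\<forall>t\<in>{1..J}. int (card (S \<inter> size_cls n \<mu> J t)) = \<beta> J t \<and> int (card (Q \<inter> size_cls n \<mu> J t)) = \<alpha> J t)" for S Q \<eta>
  proof (cases "S \<subseteq> Av \<eta> \<and> Q \<subseteq> S")
    case True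
    then have S: "S \<subseteq> Av \<eta>" and Q: "Q \<subseteq> Av \<eta>" by auto
    have "(\<forall>t\<le>J. card (S \<inter> size_cls n \<mu> J t) = b t) \<longleftrightarrow> card (S \<inter> size_cls n \<mu> J 0) = b 0 \<and> (\<forall>t\<in>{1..J}. card (S \<inter> size_cls n \<mu> J t) = b t)"
      by (metis atLeastAtMost_iff le0 less_one not_le)
    moreover have "card (S \<inter> size_cls n \<mu> J 0) = b 0 \<longleftrightarrow> int (card (S \<inter> size_cls n \<mu> J 0)) = z J"
      using nn(1) by (auto simp: b_def)
    moreover have "card (S \<inter> size_cls n \<mu> J t) = b t \<longleftrightarrow> int (card (S \<inter> size_cls n \<mu> J t)) = \<beta> J t" if "t \<in> {1..J}" for t
      using nn(2)[OF that] that by (auto simp: b_def)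
    moreover have "card (Q \<inter> size_cls n \<mu> J t) = a t \<longleftrightarrow> int (card (Q \<inter> size_cls n \<mu> J t)) = \<alpha> J t" if "t \<in> {1..J}" for t
      using nn(3)[OF that] by (auto simp: a_def)
    ultimately show ?thesis using True unfolding P_def CU by (simp add: Ci[OF S] Ci[OF Q]) blast
  next
    case False
    then show ?thesis unfolding P_def CU by blast
  qed
  define up where "up = (\<lambda>(\<eta>, S, Q). \<lambda>i\<in>{1..n}. if i \<in> S then (if i \<in> Q then int J else - int J) * sgn1 (\<mu> i) else \<eta> i :: int)"
  define dn where "dn \<eta> = ((\<lambda>i\<in>{1..n}. if \<bar>\<eta> i\<bar> = int J then 0 else \<eta> i), {i\<in>{1..n}. \<bar>\<eta> i\<bar> = int J}, {i\<in>{1..n}. \<eta> i = int J * sgn1 (\<mu> i)})"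
    for \<eta> :: "nat \<Rightarrow> int"
  have lvl: "{J..N} = insert J {Suc J..N}" using J by auto
  have "bij_betw up (Sigma (?X (Suc J)) P) (?X J)"
  proof (rule bij_betw_byWitness[where f' = dn])
    have upS: "dn (up (\<eta>, S, Q)) = (\<eta>, S, Q) \<and> up (\<eta>, S, Q) \<in> ?X J"
      if \<eta>: "\<eta> \<in> ?X (Suc J)" and SQ: "(S, Q) \<in> P \<eta>" for \<eta> S Q
    proof -
      have S: "S \<subseteq> Av \<eta>" "Q \<subseteq> S" and lJ: "int (card (S \<inter> size_cls n \<mu> J 0)) = z J \<and>
         (\<forall>t\<in>{1..J}. int (card (S \<inter> size_cls n \<mu> J t)) = \<beta> J t \<and> int (card (Q \<inter> size_cls n \<mu> J t)) = \<alpha> J t)"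
        using SQ unfolding P_iff by blast+
      have rng: "\<eta> i = 0 \<or> (int (Suc J) \<le> \<bar>\<eta> i\<bar> \<and> \<bar>\<eta> i\<bar> \<le> int N)" if "i \<in> {1..n}" for i using \<eta> that unfolding partial_vecs_def by blast
      have ext: "\<eta> \<in> {1..n} \<rightarrow>\<^sub>E UNIV" using \<eta> unfolding partial_vecs_def by blast
      have lo: "\<forall>j\<in>{Suc J..N}. ?lev \<eta> j" using \<eta> unfolding partial_vecs_def by blast
      let ?e = "up (\<eta>, S, Q)"
      have Sn: "i \<in> {1..n}" "\<eta> i = 0" if "i \<in> S" for i using S that by (auto simp: Av_def)
      have eS: "?e i = (if i \<in> Q then int J else - int J) * sgn1 (\<mu> i)" if "i \<in> S" for i using Sn[OF that] that by (simp add: up_def)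
      have eN: "?e i = \<eta> i" if "i \<notin> S" "i \<in> {1..n}" for i using that by (simp add: up_def)
      have absS: "\<bar>?e i\<bar> = int J" if "i \<in> S" for i by (simp add: eS[OF that] abs_mult)
      have absN: "\<bar>?e i\<bar> \<noteq> int J" if "i \<notin> S" "i \<in> {1..n}" for i
        using rng[OF that(2)] J(1) unfolding eN[OF that] by auto
      have S_eq: "S = {i\<in>{1..n}. \<bar>?e i\<bar> = int J}" using absS absN Sn by blast
      have Q_eq: "Q = {i\<in>{1..n}. ?e i = int J * sgn1 (\<mu> i)}"
      proof (rule equalityI; rule subsetI)
        fix i assume "i \<in> Q"
        then have "i \<in> S" using S by blast
        then show "i \<in> {i\<in>{1..n}. ?e i = int J * sgn1 (\<mu> i)}" using eS[of i] Sn[of i] \<open>i \<in> Q\<close> by simp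
      next
        fix i assume i: "i \<in> {i\<in>{1..n}. ?e i = int J * sgn1 (\<mu> i)}"
        then have "\<bar>?e i\<bar> = int J" by (simp add: abs_mult)
        then have "i \<in> S" using i S_eq by blast
        then show "i \<in> Q" using i eS[of i] J(1) by (auto simp: sgn1_def split: if_splits)
      qed
      have "(\<lambda>i\<in>{1..n}. if \<bar>?e i\<bar> = int J then 0 else ?e i) = \<eta>"
      proof (rule PiE_ext[OF _ ext])
        fix i assume i: "i \<in> {1..n}"
        show "(\<lambda>i\<in>{1..n}. if \<bar>?e i\<bar> = int J then 0 else ?e i) i = \<eta> i"
          using i absS[of i] absN[of i] Sn[of i] eN[of i] by (cases "i \<in> S") simp_all
      qed simp
      then have 1: "dn ?e = (\<eta>, S, Q)" unfolding dn_def using S_eq Q_eq by (simp only:)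
      have "?lev ?e j" if j: "j \<in> {Suc J..N}" for j
      proof -
        have "?lev ?e j \<longleftrightarrow> ?lev \<eta> j"
        proof (rule level_counts_cong)
          fix i assume i: "i \<in> {1..n}" "\<bar>?e i\<bar> = int j \<or> \<bar>\<eta> i\<bar> = int j"
          have "i \<notin> S" using absS[of i] Sn[of i] i j by auto
          then show "?e i = \<eta> i" using eN i by blast
        qed
        then show ?thesis using lo j by blast
      qed
      moreover have "?lev ?e J" using level_counts_top[OF J(1) S_eq Q_eq] lJ by blast
      moreover have "?e i = 0 \<or> (int J \<le> \<bar>?e i\<bar> \<and> \<bar>?e i\<bar> \<le> int N)" if "i \<in> {1..n}" for i
        using absS[of i] eN[OF _ that] rng[OF that] J by (cases "i \<in> S") auto
      moreover have "?e \<in> {1..n} \<rightarrow>\<^sub>E UNIV" by (simp add: up_def)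
      ultimately have "?e \<in> ?X J" unfolding partial_vecs_def lvl by blast
      with 1 show ?thesis ..
    qed
    then show "\<forall>x\<in>Sigma (?X (Suc J)) P. dn (up x) = x" by auto
    show "up ` Sigma (?X (Suc J)) P \<subseteq> ?X J" using upS by auto
    have dnS: "up (dn \<eta>) = \<eta> \<and> dn \<eta> \<in> Sigma (?X (Suc J)) P" if \<eta>: "\<eta> \<in> ?X J" for \<eta>
    proof -
      define e where "e = (\<lambda>i\<in>{1..n}. if \<bar>\<eta> i\<bar> = int J then 0 else \<eta> i)"
      define S where "S = {i\<in>{1..n}. \<bar>\<eta> i\<bar> = int J}"
      define Q where "Q = {i\<in>{1..n}. \<eta> i = int J * sgn1 (\<mu> i)}"
      have dn: "dn \<eta> = (e, S, Q)" by (simp add: dn_def e_def S_def Q_def)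
      have rng: "\<eta> i = 0 \<or> (int J \<le> \<bar>\<eta> i\<bar> \<and> \<bar>\<eta> i\<bar> \<le> int N)" if "i \<in> {1..n}" for i using \<eta> that unfolding partial_vecs_def by blast
      have ext: "\<eta> \<in> {1..n} \<rightarrow>\<^sub>E UNIV" using \<eta> unfolding partial_vecs_def by blast
      have lo: "\<forall>j\<in>insert J {Suc J..N}. ?lev \<eta> j" using \<eta> unfolding partial_vecs_def lvl by blast
      have "up (e, S, Q) = \<eta>"
      proof (rule PiE_ext[OF _ ext])
        show "up (e, S, Q) \<in> {1..n} \<rightarrow>\<^sub>E UNIV" by (simp add: up_def)
        fix i assume i: "i \<in> {1..n}"
        show "up (e, S, Q) i = \<eta> i"
          using i by (auto simp: up_def e_def S_def Q_def sgn1_def abs_if split: if_splits)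
      qed
      moreover have "(S, Q) \<in> P e"
      proof -
        have "S \<subseteq> Av e" by (auto simp: S_def Av_def e_def)
        moreover have "Q \<subseteq> S" by (auto simp: S_def Q_def abs_mult)
        moreover have "?lev \<eta> J" using lo by blast
        ultimately show ?thesis unfolding P_iff using level_counts_top[OF J(1) S_def Q_def] by blast
      qed
      moreover have "e \<in> ?X (Suc J)"
      proof -
        have "?lev e j" if j: "j \<in> {Suc J..N}" for j
        proof -
          have "?lev e j \<longleftrightarrow> ?lev \<eta> j"
            by (rule level_counts_cong) (use j in \<open>auto simp: e_def split: if_splits\<close>)
          then show ?thesis using lo j by blast
        qed
        moreover have "e i = 0 \<or> (int (Suc J) \<le> \<bar>e i\<bar> \<and> \<bar>e i\<bar> \<le> int N)" if "i \<in> {1..n}" for i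
          using rng[OF that] that by (auto simp: e_def)
        moreover have "e \<in> {1..n} \<rightarrow>\<^sub>E UNIV" by (simp add: e_def)
        ultimately show ?thesis unfolding partial_vecs_def by blast
      qed
      ultimately show ?thesis unfolding dn by blast
    qed
    then show "\<forall>\<eta>\<in>?X J. up (dn \<eta>) = \<eta>" by blast
    show "dn ` ?X J \<subseteq> Sigma (?X (Suc J)) P" using dnS by blast
  qed
  then have "card (?X J) = card (Sigma (?X (Suc J)) P)" by (metis bij_betw_same_card)
  also have "\<dots> = (\<Sum>\<eta>\<in>?X (Suc J). card (P \<eta>))"
  proof (rule card_SigmaI[OF finite_partial_vecs], rule ballI)
    fix \<eta>
    have "P \<eta> \<subseteq> Pow {1..n} \<times> Pow {1..n}"
    proof
      fix p assume "p \<in> P \<eta>"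
      then obtain S Q where "p = (S, Q)" "S \<subseteq> Av \<eta>" "Q \<subseteq> S" by (cases p) (auto simp: P_iff)
      moreover have "Av \<eta> \<subseteq> {1..n}" by (auto simp: Av_def)
      ultimately show "p \<in> Pow {1..n} \<times> Pow {1..n}" by auto
    qed
    then show "finite (P \<eta>)" by (rule finite_subset) simp
  qed
  finally have "int (card (?X J)) = (\<Sum>\<eta>\<in>?X (Suc J). int (card (P \<eta>)))" by simp
  also have "\<dots> = (\<Sum>\<eta>\<in>?X (Suc J). level_factor n (ell n \<mu>) N z \<beta> \<alpha> J)"
  proof (intro sum.cong refl)
    fix \<eta> assume \<eta>: "\<eta> \<in> ?X (Suc J)"
    have "card (P \<eta>) = 2 ^ b 0 * (\<Prod>t\<le>J. card (C \<eta> t) choose b t) * (\<Prod>t=1..J. b t choose a t)"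
      unfolding P_def
      by (rule card_subset_pairs) (use size_cls_disj[OF J(1), of _ _ n \<mu>] in \<open>auto simp: C_def Av_def\<close>)
    also have "(\<Prod>t\<le>J. card (C \<eta> t) choose b t) = (card (C \<eta> 0) choose b 0) * ((card (C \<eta> 1) choose b 1) * (\<Prod>t=2..J. card (C \<eta> t) choose b t))"
      using J(1) by (simp add: atMost_atLeast0 prod.atLeast_Suc_atMost numeral_2_eq_2)
    also have "(\<Prod>t=1..J. b t choose a t) = (b 1 choose a 1) * (\<Prod>t=2..J. b t choose a t)"
      using J(1) by (simp add: prod.atLeast_Suc_atMost numeral_2_eq_2)
    finally have c: "int (card (P \<eta>)) = 2 ^ b 0 * (binom (int (card (C \<eta> 0))) (int (b 0)) * (binom (int (card (C \<eta> 1))) (int (b 1)) *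
        (\<Prod>t=2..J. binom (int (card (C \<eta> t))) (int (b t))))) * (binom (int (b 1)) (int (a 1)) * (\<Prod>t=2..J. binom (int (b t)) (int (a t))))"
      by (simp add: binom_of_nat)
    have b: "int (b 0) = z J" "\<And>t. t \<in> {1..J} \<Longrightarrow> int (b t) = \<beta> J t" "\<And>t. t \<in> {1..J} \<Longrightarrow> int (a t) = \<alpha> J t"
      using nn by (auto simp: b_def a_def)
    have b1: "int (b 1) = \<beta> J 1" "int (a 1) = \<alpha> J 1" using b J(1) by auto
    have "(\<Prod>t=2..J. binom (int (b t)) (int (a t))) = (\<Prod>t=2..J. binom (\<beta> J t) (\<alpha> J t))"
      by (intro prod.cong refl) (use b in auto)
    moreover have "(\<Prod>t=2..J. binom (int (card (C \<eta> t))) (int (b t))) = (\<Prod>t=2..J. binom (ell n \<mu> (J - t + 1) - (\<Sum>s=1..N-J. \<beta> (J + s) (t + s))) (\<beta> J t))"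
    proof (intro prod.cong refl)
      fix t assume t: "t \<in> {2..J}"
      then show "binom (int (card (C \<eta> t))) (int (b t)) = binom (ell n \<mu> (J - t + 1) - (\<Sum>s=1..N-J. \<beta> (J + s) (t + s))) (\<beta> J t)"
        using free_count(3)[OF J \<eta> t] b(2)[of t] by (simp add: C_def Av_def)
    qed
    ultimately show "int (card (P \<eta>)) = level_factor n (ell n \<mu>) N z \<beta> \<alpha> J"
      unfolding c level_factor_def b(1) b1 prod.distrib
      using free_count(1,2)[OF J \<eta>] by (simp add: C_def Av_def b_def)
  qed
  finally show ?thesis by simp
qed

lemma card_partial_vecs:
  assumes nn: "\<And>j. j \<in> {1..N} \<Longrightarrow> z j \<ge> 0" "\<And>j t. j \<in> {1..N} \<Longrightarrow> t \<in> {1..j} \<Longrightarrow> \<beta> j t \<ge> 0"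
    "\<And>j t. j \<in> {1..N} \<Longrightarrow> t \<in> {1..j} \<Longrightarrow> \<alpha> j t \<ge> 0"
  shows "int (card (partial_vecs n \<mu> N z \<beta> \<alpha> 1)) = (\<Prod>j=1..N. level_factor n (ell n \<mu>) N z \<beta> \<alpha> j)"
proof -
  have "int (card (partial_vecs n \<mu> N z \<beta> \<alpha> (Suc N - d))) = (\<Prod>j=Suc N - d..N. level_factor n (ell n \<mu>) N z \<beta> \<alpha> j)" if "d \<le> N" for d
    using that
  proof (induction d)
    case 0
    have "partial_vecs n \<mu> N z \<beta> \<alpha> (Suc N) = {\<lambda>i\<in>{1..n}. 0}"
    proof (rule equalityI; rule subsetI)
      fix \<eta> assume \<eta>: "\<eta> \<in> partial_vecs n \<mu> N z \<beta> \<alpha> (Suc N)"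
      have "\<eta> i = 0" if "i \<in> {1..n}" for i using \<eta> that unfolding partial_vecs_def by force
      moreover have "\<eta> \<in> {1..n} \<rightarrow>\<^sub>E UNIV" using \<eta> unfolding partial_vecs_def by blast
      ultimately have "\<eta> = (\<lambda>i\<in>{1..n}. 0)" by (intro PiE_ext[of \<eta> "{1..n}" "\<lambda>_. UNIV"]) auto
      then show "\<eta> \<in> {\<lambda>i\<in>{1..n}. 0}" by simp
    qed (auto simp: partial_vecs_def)
    then show ?case by simp
  next
    case (Suc d)
    define J where "J = Suc N - Suc d"
    have J: "1 \<le> J" "J \<le> N" "Suc J = Suc N - d" using Suc.prems by (auto simp: J_def)
    have "int (card (partial_vecs n \<mu> N z \<beta> \<alpha> J)) = int (card (partial_vecs n \<mu> N z \<beta> \<alpha> (Suc J))) * level_factor n (ell n \<mu>) N z \<beta> \<alpha> J"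
      by (rule card_partial_vecs_step[OF J(1,2)]) (use nn J in auto)
    also have "int (card (partial_vecs n \<mu> N z \<beta> \<alpha> (Suc J))) = (\<Prod>j=Suc J..N. level_factor n (ell n \<mu>) N z \<beta> \<alpha> j)"
      unfolding J(3) using Suc by simp
    also have "\<dots> * level_factor n (ell n \<mu>) N z \<beta> \<alpha> J = (\<Prod>j=J..N. level_factor n (ell n \<mu>) N z \<beta> \<alpha> j)"
      using J by (simp add: prod.atLeast_Suc_atMost mult.commute)
    finally show ?case unfolding J_def .
  qed
  from this[of N] show ?thesis by simp
qed

section \<open>Sorting the absolute values\<close>

lemma sum_by_value:
  assumes "\<And>i. i \<in> {1..n} \<Longrightarrow> 0 \<le> g i \<and> g i \<le> int N"
  shows "(\<Sum>i=1..n. g i) = (\<Sum>j=1..N. int j * ss n g j)"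
proof -
  have "(\<Sum>j=1..N. int j * ss n g j) = (\<Sum>j=1..N. \<Sum>i=1..n. if g i = int j then int j else 0)"
  proof (rule sum.cong[OF refl])
    fix j
    have "(\<Sum>i=1..n. if g i = int j then int j else 0) = (\<Sum>i\<in>{i\<in>{1..n}. g i = int j}. int j)"
      by (rule sum.inter_filter[symmetric]) simp
    also have "\<dots> = int j * ss n g j" by (simp add: ss_def mult.commute)
    finally show "int j * ss n g j = (\<Sum>i=1..n. if g i = int j then int j else 0)" ..
  qed
  also have "\<dots> = (\<Sum>i=1..n. \<Sum>j=1..N. if g i = int j then int j else 0)" by (rule sum.swap)
  also have "\<dots> = (\<Sum>i=1..n. g i)"
  proof (rule sum.cong[OF refl])
    fix i assume i: "i \<in> {1..n}"
    have "(\<Sum>j=1..N. if g i = int j then int j else 0) = (\<Sum>j=1..N. if j = nat (g i) then g i else 0)"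
      using assms[OF i] by (intro sum.cong) auto
    then show "(\<Sum>j=1..N. if g i = int j then int j else 0) = g i"
      using assms[OF i] by (cases "g i = 0") auto
  qed
  finally show ?thesis by simp
qed

lemma QQ_bounds: assumes "q \<in> QQ n N" "i \<in> {1..n}" shows "0 \<le> q i \<and> q i \<le> int N"
proof -
  have pos: "q i \<ge> 0" if "i \<in> {1..n}" for i using assms(1) that by (auto simp: QQ_def PiE_iff)
  have "q i \<le> (\<Sum>i=1..n. q i)" using member_le_sum[of i "{1..n}" q] pos assms(2) by auto
  then show ?thesis using pos assms by (simp add: QQ_def)
qed

text \<open>The positions with $q_i \ge x$ form an initial segment, since $q$ is decreasing.\<close>

lemma QQ_ge_iff:
  assumes q: "q \<in> QQ n N" and i: "i \<in> {1..n}"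
  shows "x \<le> q i \<longleftrightarrow> i \<le> card {i\<in>{1..n}. x \<le> q i}"
proof -
  let ?A = "{i\<in>{1..n}. x \<le> q i}"
  have mono: "q b \<le> q a" if "a \<in> {1..n}" "b \<in> {1..n}" "a \<le> b" for a b using q that by (simp add: QQ_def)
  show ?thesis
  proof
    assume "x \<le> q i"
    then have "{1..i} \<subseteq> ?A" using mono[of _ i] i by fastforce
    then have "card {1..i} \<le> card ?A" by (intro card_mono) auto
    then show "i \<le> card ?A" by simp
  next
    assume *: "i \<le> card ?A"
    show "x \<le> q i"
    proof (rule ccontr)
      assume "\<not> x \<le> q i"
      then have "?A \<subseteq> {1..<i}" using mono[of i] i by (auto simp: not_less[symmetric]) (meson le_cases order_trans not_le)
      then have "card ?A \<le> card {1..<i}" by (intro card_mono) auto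
      then show False using * i by auto
    qed
  qed
qed

text \<open>A partition is determined by its conjugate.\<close>

lemma QQ_unique:
  assumes q: "q \<in> QQ n N" and q': "q' \<in> QQ n N" and eq: "\<And>j. j \<in> {1..N} \<Longrightarrow> ss n q j = ss n q' j"
  shows "q = q'"
proof -
  have c: "card {i\<in>{1..n}. int j \<le> p i} = (\<Sum>h=j..N. nat (ss n p h))" if "p \<in> QQ n N" for p j
  proof -
    have "card {i\<in>{1..n}. int j \<le> p i} = (\<Sum>h\<in>{j..N}. card {i\<in>{1..n}. nat (p i) = h \<and> int j \<le> p i})"
      by (rule card_split) (use QQ_bounds[OF that] in force)+
    also have "\<dots> = (\<Sum>h=j..N. nat (ss n p h))"
    proof (rule sum.cong[OF refl])
      fix h assume h: "h \<in> {j..N}"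
      have "{i\<in>{1..n}. nat (p i) = h \<and> int j \<le> p i} = {i\<in>{1..n}. p i = int h}"
        using h QQ_bounds[OF that] by auto
      then show "card {i\<in>{1..n}. nat (p i) = h \<and> int j \<le> p i} = nat (ss n p h)" by (simp add: ss_def)
    qed
    finally show ?thesis .
  qed
  have ge: "int j \<le> q i \<longleftrightarrow> int j \<le> q' i" if "j \<ge> 1" "i \<in> {1..n}" for i j
  proof -
    have "(\<Sum>h=j..N. nat (ss n q h)) = (\<Sum>h=j..N. nat (ss n q' h))"
      using that(1) by (intro sum.cong refl) (simp add: eq)
    then show ?thesis
      using QQ_ge_iff[OF q that(2), of "int j"] QQ_ge_iff[OF q' that(2), of "int j"] c[OF q, of j] c[OF q', of j] by simp
  qed
  have "q i = q' i" if i: "i \<in> {1..n}" for i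
  proof -
    have b: "0 \<le> q i" "0 \<le> q' i" using QQ_bounds[OF q i] QQ_bounds[OF q' i] by auto
    have "\<not> q i < q' i"
    proof
      assume lt: "q i < q' i"
      then have "nat (q' i) \<ge> 1" using b by linarith
      from ge[OF this i] show False using lt b by simp
    qed
    moreover have "\<not> q' i < q i"
    proof
      assume lt: "q' i < q i"
      then have "nat (q i) \<ge> 1" using b by linarith
      from ge[OF this i] show False using lt b by simp
    qed
    ultimately show ?thesis by simp
  qed
  moreover have "q \<in> {1..n} \<rightarrow>\<^sub>E UNIV" "q' \<in> {1..n} \<rightarrow>\<^sub>E UNIV" using q q' by (auto simp: QQ_def PiE_iff)
  ultimately show ?thesis by (intro PiE_ext)
qed

lemma QQ_exists:
  assumes g: "\<And>i. i \<in> {1..n} \<Longrightarrow> 0 \<le> g i" "(\<Sum>i=1..n. g i) = int N"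
  shows "\<exists>q\<in>QQ n N. \<forall>j. ss n q j = ss n g j"
proof -
  define ys where "ys = map g [1..<Suc n]"
  define xs where "xs = rev (sort ys)"
  define q where "q = (\<lambda>i\<in>{1..n}. xs ! (i - 1))"
  have len: "length ys = n" "length xs = n" by (simp_all add: ys_def xs_def)
  have ms: "mset xs = mset ys" by (simp add: xs_def)
  have yn: "ys ! (i - 1) = g i" if "i \<in> {1..n}" for i
  proof -
    have "[1..<Suc n] ! (i - 1) = 1 + (i - 1)" using that by (intro nth_upt) auto
    then show ?thesis using that by (auto simp: ys_def simp del: upt_Suc)
  qed
  have set: "set xs = set ys" using ms by (metis set_mset_mset)
  have xpos: "xs ! (i - 1) \<ge> 0" if "i \<in> {1..n}" for i
  proof -
    have "xs ! (i - 1) \<in> set ys" using that len set by (metis One_nat_def atLeastAtMost_iff diff_Suc_less le_zero_eq less_le_trans not_one_le_zero nth_mem neq0_conv)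
    then show ?thesis using g(1) by (auto simp: ys_def)
  qed
  have idx: "(\<Sum>i=1..n. h (zs ! (i - 1))) = sum_list (map h zs)" if "length zs = n" for zs :: "int list" and h :: "int \<Rightarrow> int"
  proof -
    have "(\<Sum>i=1..n. h (zs ! (i - 1))) = (\<Sum>i<n. h (zs ! i))"
      by (rule sum.reindex_bij_witness[of _ Suc "\<lambda>i. i - 1"]) auto
    then show ?thesis using that by (simp add: sum_list_sum_nth lessThan_atLeast0)
  qed
  have sl: "sum_list (map h xs) = sum_list (map h ys)" for h :: "int \<Rightarrow> int"
    using ms by (metis mset_map sum_mset_sum_list)
  have tr: "(\<Sum>i=1..n. h (q i)) = (\<Sum>i=1..n. h (g i))" for h :: "int \<Rightarrow> int"
  proof -
    have "(\<Sum>i=1..n. h (q i)) = (\<Sum>i=1..n. h (xs ! (i - 1)))" by (intro sum.cong) (auto simp: q_def)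
    also have "\<dots> = (\<Sum>i=1..n. h (ys ! (i - 1)))" using idx[OF len(1)] idx[OF len(2)] sl by simp
    also have "\<dots> = (\<Sum>i=1..n. h (g i))" by (intro sum.cong refl) (simp only: yn)
    finally show ?thesis .
  qed
  have ssum: "ss n p j = (\<Sum>i=1..n. if p i = int j then 1 else 0)" for p j
    by (simp add: ss_def sum.inter_filter[symmetric])
  have "ss n q j = ss n g j" for j using tr[of "\<lambda>x. if x = int j then 1 else 0"] by (simp only: ssum)
  moreover have "q \<in> QQ n N"
    unfolding QQ_def
  proof (intro CollectI conjI ballI impI)
    show "q \<in> {1..n} \<rightarrow>\<^sub>E {0..}" using xpos by (auto simp: q_def)
    show "(\<Sum>i=1..n. q i) = int N" using tr[of "\<lambda>x. x"] g(2) by simp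
    fix i j assume ij: "i \<in> {1..n}" "j \<in> {1..n}" "i \<le> j"
    have "xs ! (j - 1) \<le> xs ! (i - 1)"
      by (rule sorted_rev_nth_mono) (use ij len in \<open>auto simp: xs_def\<close>)
    then show "q j \<le> q i" using ij by (simp add: q_def)
  qed
  ultimately show ?thesis by blast
qed

section \<open>Grouping integer vectors by their counts\<close>

lemma level_count_split:
  assumes j: "j \<ge> 1"
  shows "ss n (\<lambda>i. \<bar>\<eta> i\<bar>) j = cnt_zero n \<mu> \<eta> j + (\<Sum>t=1..j. cnt_cls n \<mu> \<eta> j t)"
proof -
  define f where "f i = (if \<mu> i = 0 then 0 else if int j \<le> \<bar>\<mu> i\<bar> then 1 else nat (int j - \<bar>\<mu> i\<bar> + 1))" for i
  have "card {i\<in>{1..n}. \<bar>\<eta> i\<bar> = int j} = (\<Sum>t\<in>{0..j}. card {i\<in>{1..n}. f i = t \<and> \<bar>\<eta> i\<bar> = int j})"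
    by (rule card_split) (use j in \<open>auto simp: f_def\<close>)
  also have "\<dots> = card {i\<in>{1..n}. f i = 0 \<and> \<bar>\<eta> i\<bar> = int j} + (\<Sum>t=1..j. card {i\<in>{1..n}. f i = t \<and> \<bar>\<eta> i\<bar> = int j})"
    by (simp add: sum.atLeast_Suc_atMost)
  also have "{i\<in>{1..n}. f i = 0 \<and> \<bar>\<eta> i\<bar> = int j} = {i\<in>{1..n}. \<bar>\<eta> i\<bar> = int j \<and> \<mu> i = 0}"
    by (auto simp: f_def split: if_splits)
  also have "(\<Sum>t=1..j. card {i\<in>{1..n}. f i = t \<and> \<bar>\<eta> i\<bar> = int j}) = (\<Sum>t=1..j. card {i\<in>{1..n}. \<bar>\<eta> i\<bar> = int j \<and> mu_cls \<mu> j t i})"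
  proof (rule sum.cong[OF refl])
    fix t assume t: "t \<in> {1..j}"
    have "f i = t \<longleftrightarrow> mu_cls \<mu> j t i" for i
      using t by (auto simp: f_def mu_cls_def)
    then show "card {i\<in>{1..n}. f i = t \<and> \<bar>\<eta> i\<bar> = int j} = card {i\<in>{1..n}. \<bar>\<eta> i\<bar> = int j \<and> mu_cls \<mu> j t i}"
      by (simp only: conj_commute)
  qed
  finally show ?thesis by (simp add: ss_def cnt_zero_def cnt_cls_def)
qed

lemma cnt_pos_le_cnt_cls: "0 \<le> cnt_pos n \<mu> \<eta> j t \<and> cnt_pos n \<mu> \<eta> j t \<le> cnt_cls n \<mu> \<eta> j t"
  unfolding cnt_pos_def cnt_cls_def by (auto intro!: card_mono)

definition beta_of where "beta_of n \<mu> N \<eta> = (\<lambda>j\<in>{1..N}. \<lambda>t\<in>{1..j}. cnt_cls n \<mu> \<eta> j t)"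
definition alpha_of where "alpha_of n \<mu> N \<eta> = (\<lambda>j\<in>{1..N}. \<lambda>t\<in>{1..j}. cnt_pos n \<mu> \<eta> j t)"

text \<open>
  The decreasing rearrangement of $|\eta|$, described through the multiplicities of its
  positive values.
\<close>

definition q_of :: "nat \<Rightarrow> nat \<Rightarrow> (nat \<Rightarrow> int) \<Rightarrow> nat \<Rightarrow> int" where
  "q_of n N \<eta> = (THE q. q \<in> QQ n N \<and> (\<forall>j\<in>{1..N}. ss n q j = ss n (\<lambda>i. \<bar>\<eta> i\<bar>) j))"

lemma q_of:
  assumes "\<eta> \<in> int_vecs n N"
  shows "q_of n N \<eta> \<in> QQ n N" "j \<in> {1..N} \<Longrightarrow> ss n (q_of n N \<eta>) j = ss n (\<lambda>i. \<bar>\<eta> i\<bar>) j"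
proof -
  have "\<exists>q\<in>QQ n N. \<forall>j. ss n q j = ss n (\<lambda>i. \<bar>\<eta> i\<bar>) j"
    using assms by (intro QQ_exists) (auto simp: int_vecs_def norm1_def)
  then obtain q where q: "q \<in> QQ n N \<and> (\<forall>j\<in>{1..N}. ss n q j = ss n (\<lambda>i. \<bar>\<eta> i\<bar>) j)" by blast
  have "q_of n N \<eta> \<in> QQ n N \<and> (\<forall>j\<in>{1..N}. ss n (q_of n N \<eta>) j = ss n (\<lambda>i. \<bar>\<eta> i\<bar>) j)"
    unfolding q_of_def
  proof (rule theI[of _ q])
    fix p assume "p \<in> QQ n N \<and> (\<forall>j\<in>{1..N}. ss n p j = ss n (\<lambda>i. \<bar>\<eta> i\<bar>) j)"
    then show "p = q" using q by (intro QQ_unique) auto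
  qed (rule q)
  then show "q_of n N \<eta> \<in> QQ n N" "j \<in> {1..N} \<Longrightarrow> ss n (q_of n N \<eta>) j = ss n (\<lambda>i. \<bar>\<eta> i\<bar>) j" by auto
qed

lemma q_of_eqI:
  assumes "\<eta> \<in> int_vecs n N" "q \<in> QQ n N" "\<And>j. j \<in> {1..N} \<Longrightarrow> ss n q j = ss n (\<lambda>i. \<bar>\<eta> i\<bar>) j"
  shows "q_of n N \<eta> = q"
  by (rule QQ_unique[OF q_of(1)[OF assms(1)] assms(2)]) (simp add: q_of(2)[OF assms(1)] assms(3))

lemma beta_of_BB: assumes "\<eta> \<in> int_vecs n N" shows "beta_of n \<mu> N \<eta> \<in> BB n N (q_of n N \<eta>)"
  unfolding BB_def
proof (intro CollectI conjI ballI)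
  show "beta_of n \<mu> N \<eta> \<in> (\<Pi>\<^sub>E j\<in>{1..N}. {1..j} \<rightarrow>\<^sub>E {0..})" by (auto simp: beta_of_def cnt_cls_def)
  fix j assume j: "j \<in> {1..N}"
  have "(\<Sum>t=1..j. beta_of n \<mu> N \<eta> j t) = (\<Sum>t=1..j. cnt_cls n \<mu> \<eta> j t)"
    using j by (intro sum.cong) (auto simp: beta_of_def)
  moreover have "cnt_zero n \<mu> \<eta> j \<ge> 0" by (simp add: cnt_zero_def)
  ultimately show "(\<Sum>t=1..j. beta_of n \<mu> N \<eta> j t) \<le> ss n (q_of n N \<eta>) j"
    using level_count_split[of j n \<eta> \<mu>] j q_of(2)[OF assms j] by simp
qed

lemma alpha_of_AA: "alpha_of n \<mu> N \<eta> \<in> AA N (beta_of n \<mu> N \<eta>)"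
  unfolding AA_def using cnt_pos_le_cnt_cls[of n \<mu> \<eta>] by (auto simp: alpha_of_def beta_of_def)

text \<open>
  The norm condition $\|\eta\|_1 = N$ and the sorted vector $q$ are recovered from the
  counts.
\<close>

lemma fibre:
  assumes q: "q \<in> QQ n N" and \<beta>: "\<beta> \<in> BB n N q" and \<alpha>: "\<alpha> \<in> AA N \<beta>"
  shows "{\<eta> \<in> int_vecs n N. (q_of n N \<eta>, beta_of n \<mu> N \<eta>, alpha_of n \<mu> N \<eta>) = (q, \<beta>, \<alpha>)} =
     partial_vecs n \<mu> N (\<lambda>j. ss n q j - (\<Sum>t=1..j. \<beta> j t)) \<beta> \<alpha> 1"
proof (rule equalityI; rule subsetI)
  fix \<eta> assume "\<eta> \<in> {\<eta> \<in> int_vecs n N. (q_of n N \<eta>, beta_of n \<mu> N \<eta>, alpha_of n \<mu> N \<eta>) = (q, \<beta>, \<alpha>)}"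
  then have \<eta>: "\<eta> \<in> int_vecs n N" and e: "q_of n N \<eta> = q" "beta_of n \<mu> N \<eta> = \<beta>" "alpha_of n \<mu> N \<eta> = \<alpha>" by auto
  have "\<bar>\<eta> i\<bar> \<le> int N" if "i \<in> {1..n}" for i
    using member_le_sum[of i "{1..n}" "\<lambda>i. \<bar>\<eta> i\<bar>"] that \<eta> by (auto simp: int_vecs_def norm1_def)
  moreover have "level_counts n \<mu> (\<lambda>j. ss n q j - (\<Sum>t=1..j. \<beta> j t)) \<beta> \<alpha> \<eta> j" if j: "j \<in> {1..N}" for j
  proof -
    have b: "cnt_cls n \<mu> \<eta> j t = \<beta> j t" "cnt_pos n \<mu> \<eta> j t = \<alpha> j t" if "t \<in> {1..j}" for t
      using j that by (simp_all add: e(2,3)[symmetric] beta_of_def alpha_of_def)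
    have "cnt_zero n \<mu> \<eta> j = ss n q j - (\<Sum>t=1..j. cnt_cls n \<mu> \<eta> j t)"
      using level_count_split[of j n \<eta> \<mu>] q_of(2)[OF \<eta> j] j e(1) by simp
    also have "(\<Sum>t=1..j. cnt_cls n \<mu> \<eta> j t) = (\<Sum>t=1..j. \<beta> j t)" by (intro sum.cong refl b)
    finally show ?thesis using b unfolding level_counts_def by blast
  qed
  moreover have "\<eta> \<in> {1..n} \<rightarrow>\<^sub>E UNIV" using \<eta> by (simp add: int_vecs_def)
  ultimately show "\<eta> \<in> partial_vecs n \<mu> N (\<lambda>j. ss n q j - (\<Sum>t=1..j. \<beta> j t)) \<beta> \<alpha> 1"
    unfolding partial_vecs_def by force
next
  fix \<eta> assume \<eta>: "\<eta> \<in> partial_vecs n \<mu> N (\<lambda>j. ss n q j - (\<Sum>t=1..j. \<beta> j t)) \<beta> \<alpha> 1"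
  have ext: "\<eta> \<in> {1..n} \<rightarrow>\<^sub>E UNIV" using \<eta> unfolding partial_vecs_def by blast
  have bd: "\<bar>\<eta> i\<bar> \<le> int N" if "i \<in> {1..n}" for i
  proof -
    have "\<eta> i = 0 \<or> (int 1 \<le> \<bar>\<eta> i\<bar> \<and> \<bar>\<eta> i\<bar> \<le> int N)" using \<eta> that unfolding partial_vecs_def by blast
    then show ?thesis by auto
  qed
  have lv: "level_counts n \<mu> (\<lambda>j. ss n q j - (\<Sum>t=1..j. \<beta> j t)) \<beta> \<alpha> \<eta> j" if "j \<in> {1..N}" for j
    using \<eta> that unfolding partial_vecs_def by blast
  then have b: "cnt_cls n \<mu> \<eta> j t = \<beta> j t" "cnt_pos n \<mu> \<eta> j t = \<alpha> j t" if "j \<in> {1..N}" "t \<in> {1..j}" for j t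
    using that unfolding level_counts_def by blast+
  have cnt: "ss n (\<lambda>i. \<bar>\<eta> i\<bar>) j = ss n q j" if j: "j \<in> {1..N}" for j
  proof -
    have "cnt_zero n \<mu> \<eta> j = ss n q j - (\<Sum>t=1..j. \<beta> j t)" using lv[OF j] by (simp add: level_counts_def)
    moreover have "(\<Sum>t=1..j. cnt_cls n \<mu> \<eta> j t) = (\<Sum>t=1..j. \<beta> j t)" using j by (intro sum.cong refl b)
    ultimately show ?thesis using level_count_split[of j n \<eta> \<mu>] j by simp
  qed
  have "norm1 n \<eta> = (\<Sum>j=1..N. int j * ss n (\<lambda>i. \<bar>\<eta> i\<bar>) j)"
    unfolding norm1_def by (rule sum_by_value) (use bd in auto)
  also have "\<dots> = (\<Sum>j=1..N. int j * ss n q j)" by (intro sum.cong refl) (simp only: cnt)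
  also have "\<dots> = (\<Sum>i=1..n. q i)" by (rule sum_by_value[symmetric, OF QQ_bounds[OF q]])
  also have "\<dots> = int N" using q by (simp add: QQ_def)
  finally have E: "\<eta> \<in> int_vecs n N" using ext by (simp add: int_vecs_def)
  have "q_of n N \<eta> = q" by (rule q_of_eqI[OF E q cnt[symmetric]])
  moreover have "beta_of n \<mu> N \<eta> = \<beta>"
  proof (rule PiE_ext[of _ "{1..N}" "\<lambda>j. {1..j} \<rightarrow>\<^sub>E {0..}"])
    show "beta_of n \<mu> N \<eta> \<in> (\<Pi>\<^sub>E j\<in>{1..N}. {1..j} \<rightarrow>\<^sub>E {0..})" by (auto simp: beta_of_def cnt_cls_def)
    show \<beta>P: "\<beta> \<in> (\<Pi>\<^sub>E j\<in>{1..N}. {1..j} \<rightarrow>\<^sub>E {0..})" using \<beta> by (simp add: BB_def)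
    fix j assume j: "j \<in> {1..N}"
    have "\<beta> j \<in> {1..j} \<rightarrow>\<^sub>E {0..}" using \<beta>P j by (rule PiE_mem)
    then show "beta_of n \<mu> N \<eta> j = \<beta> j"
      using j b(1)[OF j] by (intro PiE_ext[of _ "{1..j}" "\<lambda>_. {0..}"]) (auto simp: beta_of_def cnt_cls_def)
  qed
  moreover have "alpha_of n \<mu> N \<eta> = \<alpha>"
  proof (rule PiE_ext[of _ "{1..N}" "\<lambda>j. {1..j} \<rightarrow>\<^sub>E UNIV"])
    show "alpha_of n \<mu> N \<eta> \<in> (\<Pi>\<^sub>E j\<in>{1..N}. {1..j} \<rightarrow>\<^sub>E UNIV)" by (auto simp: alpha_of_def)
    show \<alpha>P: "\<alpha> \<in> (\<Pi>\<^sub>E j\<in>{1..N}. {1..j} \<rightarrow>\<^sub>E UNIV)" using \<alpha> by (auto simp: AA_def PiE_iff)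
    fix j assume j: "j \<in> {1..N}"
    have "\<alpha> j \<in> {1..j} \<rightarrow>\<^sub>E UNIV" using \<alpha>P j by (rule PiE_mem)
    then show "alpha_of n \<mu> N \<eta> j = \<alpha> j"
      using j b(2)[OF j] by (intro PiE_ext[of _ "{1..j}" "\<lambda>_. UNIV"]) (auto simp: alpha_of_def)
  qed
  ultimately show "\<eta> \<in> {\<eta> \<in> int_vecs n N. (q_of n N \<eta>, beta_of n \<mu> N \<eta>, alpha_of n \<mu> N \<eta>) = (q, \<beta>, \<alpha>)}" using E by simp
qed

lemma card_fibre:
  assumes q: "q \<in> QQ n N" and \<beta>: "\<beta> \<in> BB n N q" and \<alpha>: "\<alpha> \<in> AA N \<beta>"
  shows "int (card {\<eta> \<in> int_vecs n N. (q_of n N \<eta>, beta_of n \<mu> N \<eta>, alpha_of n \<mu> N \<eta>) = (q, \<beta>, \<alpha>)}) =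
     (\<Prod>j=1..N. level_factor n (ell n \<mu>) N (\<lambda>j. ss n q j - (\<Sum>t=1..j. \<beta> j t)) \<beta> \<alpha> j)"
  unfolding fibre[OF assms]
proof (rule card_partial_vecs)
  show "ss n q j - (\<Sum>t=1..j. \<beta> j t) \<ge> 0" if "j \<in> {1..N}" for j using \<beta> that by (auto simp: BB_def)
  show "\<beta> j t \<ge> 0" if "j \<in> {1..N}" "t \<in> {1..j}" for j t
  proof -
    have "\<beta> \<in> (\<Pi>\<^sub>E j\<in>{1..N}. {1..j} \<rightarrow>\<^sub>E {0..})" using \<beta> by (simp add: BB_def)
    from PiE_mem[OF PiE_mem[OF this that(1)] that(2)] show ?thesis by simp
  qed
  show "\<alpha> j t \<ge> 0" if "j \<in> {1..N}" "t \<in> {1..j}" for j t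
    using PiE_mem[OF PiE_mem[OF \<alpha>[unfolded AA_def] that(1)] that(2)] by simp
qed

lemma sum_int_vecs_group:
  fixes G :: "(nat \<Rightarrow> nat \<Rightarrow> int) \<Rightarrow> int"
  shows "(\<Sum>\<eta>\<in>int_vecs n N. G (alpha_of n \<mu> N \<eta>)) = (\<Sum>q\<in>QQ n N. \<Sum>\<beta>\<in>BB n N q. \<Sum>\<alpha>\<in>AA N \<beta>.
     G \<alpha> * (\<Prod>j=1..N. level_factor n (ell n \<mu>) N (\<lambda>j. ss n q j - (\<Sum>t=1..j. \<beta> j t)) \<beta> \<alpha> j))"
proof -
  define d where "d \<eta> = (q_of n N \<eta>, beta_of n \<mu> N \<eta>, alpha_of n \<mu> N \<eta>)" for \<eta>
  define T where "T = Sigma (QQ n N) (\<lambda>q. Sigma (BB n N q) (AA N))"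
  have finT: "finite T" unfolding T_def by (intro finite_SigmaI finite_QQ finite_BB finite_AA)
  have dT: "d ` int_vecs n N \<subseteq> T" unfolding d_def T_def using q_of(1) beta_of_BB alpha_of_AA by auto
  have "(\<Sum>\<eta>\<in>int_vecs n N. G (alpha_of n \<mu> N \<eta>)) = (\<Sum>p\<in>T. \<Sum>\<eta>\<in>{\<eta> \<in> int_vecs n N. d \<eta> = p}. G (alpha_of n \<mu> N \<eta>))"
    by (rule sum.group[symmetric, OF finite_int_vecs finT dT])
  also have "\<dots> = (\<Sum>(q, \<beta>, \<alpha>)\<in>T. G \<alpha> * (\<Prod>j=1..N. level_factor n (ell n \<mu>) N (\<lambda>j. ss n q j - (\<Sum>t=1..j. \<beta> j t)) \<beta> \<alpha> j))"
  proof (rule sum.cong[OF refl])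
    fix p assume p: "p \<in> T"
    obtain q \<beta> \<alpha> where e: "p = (q, \<beta>, \<alpha>)" by (cases p) auto
    have m: "q \<in> QQ n N" "\<beta> \<in> BB n N q" "\<alpha> \<in> AA N \<beta>" using p by (auto simp: T_def e)
    have "(\<Sum>\<eta>\<in>{\<eta> \<in> int_vecs n N. d \<eta> = p}. G (alpha_of n \<mu> N \<eta>)) = (\<Sum>\<eta>\<in>{\<eta> \<in> int_vecs n N. d \<eta> = p}. G \<alpha>)"
      by (intro sum.cong) (auto simp: d_def e)
    also have "\<dots> = G \<alpha> * int (card {\<eta> \<in> int_vecs n N. d \<eta> = p})" by simp
    also have "int (card {\<eta> \<in> int_vecs n N. d \<eta> = p}) = (\<Prod>j=1..N. level_factor n (ell n \<mu>) N (\<lambda>j. ss n q j - (\<Sum>t=1..j. \<beta> j t)) \<beta> \<alpha> j)"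
      unfolding d_def e by (rule card_fibre[OF m])
    finally show "(\<Sum>\<eta>\<in>{\<eta> \<in> int_vecs n N. d \<eta> = p}. G (alpha_of n \<mu> N \<eta>)) =
       (case p of (q, \<beta>, \<alpha>) \<Rightarrow> G \<alpha> * (\<Prod>j=1..N. level_factor n (ell n \<mu>) N (\<lambda>j. ss n q j - (\<Sum>t=1..j. \<beta> j t)) \<beta> \<alpha> j))"
      by (simp add: e)
  qed
  also have "\<dots> = (\<Sum>q\<in>QQ n N. \<Sum>(\<beta>, \<alpha>)\<in>Sigma (BB n N q) (AA N).
      G \<alpha> * (\<Prod>j=1..N. level_factor n (ell n \<mu>) N (\<lambda>j. ss n q j - (\<Sum>t=1..j. \<beta> j t)) \<beta> \<alpha> j))"
    unfolding T_def by (rule sum.Sigma[symmetric]) (auto intro: finite_QQ finite_BB finite_AA)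
  also have "\<dots> = (\<Sum>q\<in>QQ n N. \<Sum>\<beta>\<in>BB n N q. \<Sum>\<alpha>\<in>AA N \<beta>.
      G \<alpha> * (\<Prod>j=1..N. level_factor n (ell n \<mu>) N (\<lambda>j. ss n q j - (\<Sum>t=1..j. \<beta> j t)) \<beta> \<alpha> j))"
    by (rule sum.cong[OF refl], rule sum.Sigma[symmetric]) (auto intro: finite_BB finite_AA)
  finally show ?thesis .
qed

section \<open>The multiplicity formula\<close>

text \<open>
  $|\mu_i - \eta_i| = |\mu_i| + |\eta_i|$, except that equal signs lower it by twice the
  smaller absolute value.
\<close>

lemma norm1_diff:
  assumes \<eta>: "\<eta> \<in> int_vecs n N"
  shows "norm1 n (\<lambda>i. \<mu> i - \<eta> i) = norm1 n \<mu> + int N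
     - 2 * (\<Sum>j=1..N. \<Sum>t=1..j. (int j + 1 - int t) * alpha_of n \<mu> N \<eta> j t)"
proof -
  have bd: "\<bar>\<eta> i\<bar> \<le> int N" if "i \<in> {1..n}" for i
    using member_le_sum[of i "{1..n}" "\<lambda>i. \<bar>\<eta> i\<bar>"] that \<eta> by (auto simp: int_vecs_def norm1_def)
  let ?c = "\<lambda>j t i. \<bar>\<eta> i\<bar> = int j \<and> mu_cls \<mu> j t i \<and> \<eta> i * \<mu> i > 0"
  define ov where "ov i = (if \<eta> i * \<mu> i > 0 then min \<bar>\<eta> i\<bar> \<bar>\<mu> i\<bar> else 0)" for i
  have "(\<Sum>j=1..N. \<Sum>t=1..j. (int j + 1 - int t) * alpha_of n \<mu> N \<eta> j t)
      = (\<Sum>j=1..N. \<Sum>t=1..j. \<Sum>i=1..n. if ?c j t i then int j + 1 - int t else 0)"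
  proof (rule sum.cong[OF refl], rule sum.cong[OF refl])
    fix j t assume jt: "j \<in> {1..N}" "t \<in> {1..j}"
    have "(\<Sum>i=1..n. if ?c j t i then int j + 1 - int t else 0) = (\<Sum>i\<in>{i\<in>{1..n}. ?c j t i}. int j + 1 - int t)"
      by (rule sum.inter_filter[symmetric]) simp
    also have "\<dots> = (int j + 1 - int t) * alpha_of n \<mu> N \<eta> j t" using jt by (simp add: alpha_of_def cnt_pos_def mult.commute)
    finally show "(int j + 1 - int t) * alpha_of n \<mu> N \<eta> j t = (\<Sum>i=1..n. if ?c j t i then int j + 1 - int t else 0)" ..
  qed
  also have "\<dots> = (\<Sum>j=1..N. \<Sum>i=1..n. \<Sum>t=1..j. if ?c j t i then int j + 1 - int t else 0)"
    by (rule sum.cong[OF refl], rule sum.swap)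
  also have "\<dots> = (\<Sum>i=1..n. \<Sum>j=1..N. \<Sum>t=1..j. if ?c j t i then int j + 1 - int t else 0)"
    by (rule sum.swap)
  also have "\<dots> = (\<Sum>i=1..n. ov i)"
  proof (rule sum.cong[OF refl])
    fix i assume i: "i \<in> {1..n}"
    show "(\<Sum>j=1..N. \<Sum>t=1..j. if ?c j t i then int j + 1 - int t else 0) = ov i"
    proof (cases "\<eta> i * \<mu> i > 0")
      case False
      then show ?thesis by (simp add: ov_def)
    next
      case True
      then have nz: "\<eta> i \<noteq> 0" "\<mu> i \<noteq> 0" by auto
      \<comment> \<open>the only level and class that contribute at this position\<close>
      define j0 where "j0 = nat \<bar>\<eta> i\<bar>"
      define t0 where "t0 = (if int j0 \<le> \<bar>\<mu> i\<bar> then 1 else nat (int j0 - \<bar>\<mu> i\<bar> + 1))"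
      have j0: "j0 \<in> {1..N}" "int j0 = \<bar>\<eta> i\<bar>" using nz bd[OF i] by (auto simp: j0_def)
      have t0: "t0 \<in> {1..j0}" using nz j0 by (auto simp: t0_def)
      have val: "int j0 + 1 - int t0 = ov i" using True j0(2) by (auto simp: t0_def ov_def)
      have "(\<Sum>t=1..j. if ?c j t i then int j + 1 - int t else 0) = (if j = j0 then ov i else 0)"
        if j: "j \<in> {1..N}" for j
      proof (cases "j = j0")
        case F: False
        then have "\<bar>\<eta> i\<bar> \<noteq> int j" using j0(2) by simp
        then show ?thesis using F by simp
      next
        case T: True
        have "mu_cls \<mu> j0 t i \<longleftrightarrow> t = t0" if "t \<in> {1..j0}" for t
          using that nz by (auto simp: mu_cls_def t0_def)
        then have "(\<Sum>t=1..j. if ?c j t i then int j + 1 - int t else 0) = (\<Sum>t=1..j0. if t = t0 then ov i else 0)"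
          unfolding T using True j0(2) val by (intro sum.cong refl) auto
        then show ?thesis using T t0 by simp
      qed
      then have "(\<Sum>j=1..N. \<Sum>t=1..j. if ?c j t i then int j + 1 - int t else 0) = (\<Sum>j=1..N. if j = j0 then ov i else 0)"
        by (intro sum.cong refl)
      then show ?thesis using j0(1) by simp
    qed
  qed
  finally have ov: "(\<Sum>j=1..N. \<Sum>t=1..j. (int j + 1 - int t) * alpha_of n \<mu> N \<eta> j t) = (\<Sum>i=1..n. ov i)" .
  have "norm1 n (\<lambda>i. \<mu> i - \<eta> i) = (\<Sum>i=1..n. \<bar>\<mu> i\<bar> + \<bar>\<eta> i\<bar> - 2 * ov i)"
    unfolding norm1_def
  proof (rule sum.cong[OF refl])
    fix i
    show "\<bar>\<mu> i - \<eta> i\<bar> = \<bar>\<mu> i\<bar> + \<bar>\<eta> i\<bar> - 2 * ov i"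
      unfolding ov_def zero_less_mult_iff by (cases "\<mu> i > 0"; cases "\<eta> i > 0"; cases "\<mu> i = 0"; cases "\<eta> i = 0") auto
  qed
  also have "\<dots> = norm1 n \<mu> + norm1 n \<eta> - 2 * (\<Sum>i=1..n. ov i)"
    by (simp add: norm1_def sum.distrib sum_subtractf sum_distrib_left)
  finally show ?thesis using \<eta> unfolding ov by (simp add: int_vecs_def)
qed

lemma CC_level_factor:
  "CC n l r L = (\<Sum>N\<in>{N::nat. int N \<le> l \<and> int N mod 2 = l mod 2}. \<Sum>q\<in>QQ n N. \<Sum>\<beta>\<in>BB n N q. \<Sum>\<alpha>\<in>AA N \<beta>.
     binom ((l - int N) div 2 + int n - 1) (int n - 1) *
     binom (r - (l + int N) div 2 + (\<Sum>j=1..N. \<Sum>i=1..j. (int j + 1 - int i) * \<alpha> j i) + int n - 1) (int n - 1) *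
     (\<Prod>j=1..N. level_factor n L N (\<lambda>j. ss n q j - (\<Sum>t=1..j. \<beta> j t)) \<beta> \<alpha> j))"
  unfolding CC_def level_factor_def ..

text \<open>
  Vectors $\eta$ whose norm has the wrong parity contribute nothing. For the others both
  binomial coefficients are evaluated by \<open>card_row_monos\<close> and
  \<open>norm1_diff\<close>, and the vectors are grouped by their counts.
\<close>

lemma card_wt_monos_eq_CC:
  assumes n: "n \<ge> 1" and r: "2 * r = k + l - norm1 n \<mu>"
  shows "int (card (wt_monos n \<mu> k l)) = CC n l r (ell n \<mu>)"
proof -
  let ?A = "\<lambda>N \<eta>. int (card (row_monos n (\<lambda>i. \<mu> i - \<eta> i) k)) * int (card (row_monos n \<eta> l))"
  have fin: "finite {N. int N \<le> l}" by (rule finite_subset[of _ "{..nat l}"]) auto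
  have "int (card (wt_monos n \<mu> k l)) = (\<Sum>N\<in>{N. int N \<le> l}. \<Sum>\<eta>\<in>int_vecs n N. ?A N \<eta>)" by (rule card_wt_monos_split)
  also have "\<dots> = (\<Sum>N\<in>{N. int N \<le> l \<and> int N mod 2 = l mod 2}. \<Sum>\<eta>\<in>int_vecs n N. ?A N \<eta>)"
  proof (rule sum.mono_neutral_right[OF fin])
    show "\<forall>N\<in>{N. int N \<le> l} - {N. int N \<le> l \<and> int N mod 2 = l mod 2}. (\<Sum>\<eta>\<in>int_vecs n N. ?A N \<eta>) = 0"
    proof (rule ballI, rule sum.neutral, rule ballI)
      fix N \<eta> assume N: "N \<in> {N. int N \<le> l} - {N. int N \<le> l \<and> int N mod 2 = l mod 2}" and \<eta>: "\<eta> \<in> int_vecs n N"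
      then have "odd (l - norm1 n \<eta>)" unfolding int_vecs_def by simp presburger
      then show "?A N \<eta> = 0" using card_row_monos[OF n, of \<eta> l] by simp
    qed
  qed auto
  also have "\<dots> = CC n l r (ell n \<mu>)"
    unfolding CC_level_factor
  proof (rule sum.cong[OF refl])
    fix N assume "N \<in> {N::nat. int N \<le> l \<and> int N mod 2 = l mod 2}"
    then have N: "int N \<le> l" "int N mod 2 = l mod 2" by auto
    define G where "G \<alpha> = binom ((l - int N) div 2 + int n - 1) (int n - 1) *
       binom (r - (l + int N) div 2 + (\<Sum>j=1..N. \<Sum>i=1..j. (int j + 1 - int i) * \<alpha> j i) + int n - 1) (int n - 1)"
      for \<alpha> :: "nat \<Rightarrow> nat \<Rightarrow> int"
    have "(\<Sum>\<eta>\<in>int_vecs n N. ?A N \<eta>) = (\<Sum>\<eta>\<in>int_vecs n N. G (alpha_of n \<mu> N \<eta>))"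
    proof (rule sum.cong[OF refl])
      fix \<eta> assume \<eta>: "\<eta> \<in> int_vecs n N"
      define s where "s = (\<Sum>j=1..N. \<Sum>i=1..j. (int j + 1 - int i) * alpha_of n \<mu> N \<eta> j i)"
      have n\<eta>: "norm1 n \<eta> = int N" using \<eta> by (simp add: int_vecs_def)
      have par: "even (l + int N)" "even (l - int N)" using N(2) by presburger+
      have "k - norm1 n (\<lambda>i. \<mu> i - \<eta> i) = 2 * (r - (l + int N) div 2 + s)"
        using norm1_diff[OF \<eta>, of \<mu>] r par(1) unfolding s_def by (simp add: algebra_simps)
      then have 1: "even (k - norm1 n (\<lambda>i. \<mu> i - \<eta> i))" "(k - norm1 n (\<lambda>i. \<mu> i - \<eta> i)) div 2 = r - (l + int N) div 2 + s"
        by simp_all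
      show "?A N \<eta> = G (alpha_of n \<mu> N \<eta>)"
        unfolding card_row_monos[OF n] G_def s_def[symmetric] n\<eta> using 1 par(2) by simp
    qed
    also have "\<dots> = (\<Sum>q\<in>QQ n N. \<Sum>\<beta>\<in>BB n N q. \<Sum>\<alpha>\<in>AA N \<beta>.
      G \<alpha> * (\<Prod>j=1..N. level_factor n (ell n \<mu>) N (\<lambda>j. ss n q j - (\<Sum>t=1..j. \<beta> j t)) \<beta> \<alpha> j))"
      by (rule sum_int_vecs_group)
    finally show "(\<Sum>\<eta>\<in>int_vecs n N. ?A N \<eta>) = (\<Sum>q\<in>QQ n N. \<Sum>\<beta>\<in>BB n N q. \<Sum>\<alpha>\<in>AA N \<beta>.
       binom ((l - int N) div 2 + int n - 1) (int n - 1) *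
       binom (r - (l + int N) div 2 + (\<Sum>j=1..N. \<Sum>i=1..j. (int j + 1 - int i) * \<alpha> j i) + int n - 1) (int n - 1) *
       (\<Prod>j=1..N. level_factor n (ell n \<mu>) N (\<lambda>j. ss n q j - (\<Sum>t=1..j. \<beta> j t)) \<beta> \<alpha> j))"
      unfolding G_def .
  qed
  finally show ?thesis .
qed

text \<open>
  Opposite variables cancel in the weight, so there are no monomials at all unless the
  quantity $r$ of the formula is a nonnegative integer.
\<close>

lemma norm1_wt_monos: assumes "m \<in> wt_monos n \<mu> k l" shows "norm1 n \<mu> \<le> k + l" "even (k + l - norm1 n \<mu>)"
proof -
  have m: "(\<Sum>a<2*n. int (m (False, a))) = k" "(\<Sum>a<2*n. int (m (True, a))) = l"
    "\<And>i. i < n \<Longrightarrow> int (m (False, i)) - int (m (False, n + i)) + (int (m (True, i)) - int (m (True, n + i))) = \<mu> (i + 1)"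
    using assms unfolding wt_monos_iff by blast+
  define e where "e i = (int (m (False, i)) + int (m (False, n + i)) + (int (m (True, i)) + int (m (True, n + i)))) - \<bar>\<mu> (i + 1)\<bar>" for i
  have "k + l - norm1 n \<mu> = (\<Sum>i<n. e i)"
    unfolding m(1,2)[symmetric] sum_double norm1_shift e_def by (simp add: sum.distrib sum_subtractf)
  moreover have "e i \<ge> 0 \<and> even (e i)" if "i < n" for i
    unfolding e_def m(3)[OF that, symmetric] by (auto simp: abs_if)
  then have "(\<Sum>i<n. e i) \<ge> 0" "even (\<Sum>i<n. e i)" by (auto intro: sum_nonneg dvd_sum)
  ultimately show "norm1 n \<mu> \<le> k + l" "even (k + l - norm1 n \<mu>)" by auto
qed

theorem theorem3p2:
  fixes n k l :: nat and \<mu> :: "nat \<Rightarrow> int"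
    and scale :: "complex \<Rightarrow> 'v::ab_group_add \<Rightarrow> 'v"
    and \<pi> :: "complex mat \<Rightarrow> 'v \<Rightarrow> 'v"
    and r\<mu> :: rat
  assumes "n \<ge> 2" and "l \<le> k"
    and "irreducible_sp_rep scale n \<pi>"
    and "sp_rep.has_highest_weight scale n \<pi> (\<lambda>H. of_nat k * eps 1 H + of_nat l * eps 2 H)"
    and "r\<mu> = of_int (int k + int l - norm1 n \<mu>) / 2"
  shows "(r\<mu> \<notin> \<nat> \<longrightarrow> sp_rep.multiplicity scale n \<pi> (weight_of n \<mu>) = 0) \<and>
    (\<forall>r::nat. r\<mu> = of_nat r \<longrightarrow>
       int (sp_rep.multiplicity scale n \<pi> (weight_of n \<mu>)) =
         CC n (int l) (int r) (ell n \<mu>) - CC n (int l - 1) (int r) (ell n \<mu>)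
         - CC n (int l - 1) (int r - 1) (ell n \<mu>) + CC n (int l - 2) (int r - 1) (ell n \<mu>))"
proof -
  interpret irreducible_sp_rep scale n \<pi> by (rule assms(3))
  have n: "n \<ge> 1" using assms(1) by simp
  note mult = multiplicity_count[OF assms(1,2,4), of \<mu>]
  show ?thesis
  proof (intro conjI allI impI)
    assume notin: "r\<mu> \<notin> \<nat>"
    have no: "wt_monos n \<mu> k' l' = {}" if "k' + l' = int k + int l \<or> k' + l' = int k + int l - 2" for k' l'
    proof (rule ccontr)
      assume "wt_monos n \<mu> k' l' \<noteq> {}"
      then obtain m where "m \<in> wt_monos n \<mu> k' l'" by blast
      note wp = norm1_wt_monos[OF this]
      have "norm1 n \<mu> \<le> int k + int l" using that wp(1) by linarith
      moreover have "even (int k + int l - norm1 n \<mu>)" using that wp(2) by presburger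
      ultimately obtain r where r: "int k + int l - norm1 n \<mu> = 2 * r" "r \<ge> 0" by (elim evenE) auto
      then have "r\<mu> = of_nat (nat r)" unfolding assms(5) r(1) by simp
      then show False using notin by simp
    qed
    show "multiplicity (weight_of n \<mu>) = 0"
      using mult no[of "int k" "int l"] no[of "int k + 1" "int l - 1"] no[of "int k - 1" "int l - 1"] no[of "int k" "int l - 2"]
      by simp
  next
    fix r :: nat assume "r\<mu> = of_nat r"
    then have "(of_int (int k + int l - norm1 n \<mu>) :: rat) = of_int (2 * int r)" unfolding assms(5) by simp
    then have r: "int k + int l - norm1 n \<mu> = 2 * int r" by (simp only: of_int_eq_iff)
    show "int (multiplicity (weight_of n \<mu>)) =
         CC n (int l) (int r) (ell n \<mu>) - CC n (int l - 1) (int r) (ell n \<mu>)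
         - CC n (int l - 1) (int r - 1) (ell n \<mu>) + CC n (int l - 2) (int r - 1) (ell n \<mu>)"
      unfolding mult
      using card_wt_monos_eq_CC[OF n, of "int r" "int k" "int l" \<mu>] card_wt_monos_eq_CC[OF n, of "int r" "int k + 1" "int l - 1" \<mu>]
        card_wt_monos_eq_CC[OF n, of "int r - 1" "int k - 1" "int l - 1" \<mu>] card_wt_monos_eq_CC[OF n, of "int r - 1" "int k" "int l - 2" \<mu>] r
      by simp
  qed
qed

end
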